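(* The Sparse VR-TOS algorithm (described in the context) converges for every step size $0<\gamma\le 1/(3L_f)$, in the sense that $\min_{k=0,\dots,t}\mathbb E\|\boldsymbol y_k-\boldsymbol G_\gamma(\boldsymbol y_k)\|\to 0$ as $t\to\infty$. In particular, for $\gamma=1/(3L_f)$, every $\boldsymbol y^\star\in\operatorname{Fix}(\boldsymbol G_\gamma)$ and every $t\ge 1$, $$\min_{k=0,\dots,t}\left\{\mathbb E\|\boldsymbol y_k-\boldsymbol G_\gamma(\boldsymbol y_k)\|\right\}\le\sqrt{\frac{C_0}{L_f\,q\,(t+1)}}=\mathcal O\left(\frac1{\sqrt t}\right),$$ with $C_0=5\,d_{\max}\,n\left[\frac{2L_fq}{n}\|\boldsymbol y_0-\boldsymbol y^\star\|^2+H_0\right]$.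
   Context: Problem: minimize over $\boldsymbol x\in\mathbb R^p$ the function $\mathcal P(\boldsymbol x)=f(\boldsymbol x)+g(\boldsymbol x)+h(\boldsymbol x)$, with $f=\frac1n\sum_{i=1}^n\psi_i+\omega$. Each $\psi_i:\mathbb R^p\to\mathbb R$ is convex and $L_\psi$-smooth, $\omega:\mathbb R^p\to\mathbb R$ is convex and $L_\omega$-smooth ($L$-smooth: differentiable with $L$-Lipschitz gradient), $g,h:\mathbb R^p\to(-\infty,+\infty]$ are proper, lower semicontinuous and convex, and the relative interiors of $\operatorname{dom} g$ and $\operatorname{dom} h$ intersect. $\boldsymbol x^\star$ denotes an arbitrary minimizer of $\mathcal P$ (assumed to exist). Block structure: $\mathcal B$ is a partition of $\{1,\dots,p\}$ into blocks, and $g,\omega$ are block separable: $g(\boldsymbol x)=\sum_{B\in\mathcal B}g_B([\boldsymbol x]_B)$, $\omega(\boldsymbol x)=\sum_{B\in\mathcal B}\omega_B([\boldsymbol x]_B)$, where $[\boldsymbol x]_B$ is the restriction of $\boldsymbol x$ to the coordinates in $B$. The extended support of $\nabla\psi_i$ is $T_i=\{B\in\mathcal B:\operatorname{supp}(\nabla\psi_i)\cap B\ne\varnothing\}$, where $\operatorname{supp}(\nabla\psi_i)$ is the set of coordinates in which $\nabla\psi_i$ is not identically zero. $\boldsymbol P_i$ is the diagonal projection onto the coordinates in the blocks of $T_i$. Each block is assumed to belong to at least one $T_i$; $d_B=n/|\{i:B\in T_i\}|$, $\boldsymbol D$ is the diagonal matrix equal to $d_B\boldsymbol I$ on block $B$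 (so $\frac1n\sum_i\boldsymbol P_i=\boldsymbol D^{-1}$), $d_{\max}$ is its largest diagonal entry, and $L_f=L_\psi+d_{\max}L_\omega$. For a positive definite $\boldsymbol H$, $\|\boldsymbol x\|_{\boldsymbol H}^2=\langle\boldsymbol x,\boldsymbol H\boldsymbol x\rangle$ and $\operatorname{prox}^{\boldsymbol H}_{\gamma\varphi}(\boldsymbol x)=\arg\min_{\boldsymbol z}\{\varphi(\boldsymbol z)+\frac1{2\gamma}\|\boldsymbol x-\boldsymbol z\|^2_{\boldsymbol H}\}$. Sparse VR-TOS algorithm: given deterministic $\boldsymbol y_0\in\mathbb R^p$, $\boldsymbol\alpha_0\in\mathbb R^{n\times p}$ (rows $\boldsymbol\alpha_{i,0}$) and $\gamma>0$, for $t=0,1,\dots$: $\boldsymbol z_t=\operatorname{prox}^{\boldsymbol D^{-1}}_{\gamma h}(\boldsymbol y_t)$; sample $i\in\{1,\dots,n\}$ uniformly, independently of the past; $\boldsymbol v_t=\boldsymbol P_i\left[\nabla\psi_i(\boldsymbol z_t)-\boldsymbol\alpha_{i,t}+\boldsymbol D(\overline{\boldsymbol\alpha}_t+\nabla\omega(\boldsymbol z_t))\right]$ with $\overline{\boldsymbol\alpha}_t=\frac1n\sum_j\boldsymbol\alpha_{j,t}$; $\boldsymbol x_t=\operatorname{prox}^{\boldsymbol D^{-1}}_{\gamma g}(2\boldsymbol z_t-\boldsymbol y_t-\gamma\boldsymbol v_t)$ (only its coordinates in $T_i$ are needed, and they depend only on coordinates in $T_i$); $\boldsymbol y_{t+1}=\boldsymbol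 y_t+\boldsymbol P_i(\boldsymbol x_t-\boldsymbol z_t)$; update the memory by uniform $q$-memorization: a random index set $J_t$ is selected (possibly depending on $i$) such that, conditionally on the past up to iteration $t$, every $j$ belongs to $J_t$ with the same probability $q/n$ ($q>0$ fixed), and $\boldsymbol\alpha_{j,t+1}=\nabla\psi_j(\boldsymbol z_t)$ if $j\in J_t$, $\boldsymbol\alpha_{j,t+1}=\boldsymbol\alpha_{j,t}$ otherwise. Further notation: $\boldsymbol G_\gamma(\boldsymbol y)=\boldsymbol y-\boldsymbol z_{\boldsymbol y}+\operatorname{prox}^{\boldsymbol D^{-1}}_{\gamma g}(2\boldsymbol z_{\boldsymbol y}-\boldsymbol y-\gamma\boldsymbol D\nabla f(\boldsymbol z_{\boldsymbol y}))$ with $\boldsymbol z_{\boldsymbol y}=\operatorname{prox}^{\boldsymbol D^{-1}}_{\gamma h}(\boldsymbol y)$, and $\operatorname{Fix}(\boldsymbol G_\gamma)$ is its set of fixed points; $H_0=\frac1{2nL_f}\sum_{i=1}^n\|\boldsymbol\alpha_{i,0}-\nabla\psi_i(\boldsymbol x^\star)\|^2$. $\mathbb E$ is the full expectation over all randomness.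
   Formalization: The explicit bound with C_0 is stated only for initial memories whose rows vanish outside the extended supports (P_i α_{i,0} = α_{i,0}), as it fails for general α_0; the convergence and the O(1/√t) rate are stated for arbitrary α_0. *)

theory Defs
  imports "HOL-Probability.Probability" "HOL-Library.Landau_Symbols"
begin

section \<open>Convex analysis\<close>

definition gradient :: "('a::real_inner \<Rightarrow> real) \<Rightarrow> 'a \<Rightarrow> 'a" where
  "gradient \<phi> x = (THE v. GDERIV \<phi> x :> v)"

definition smooth_fun :: "real \<Rightarrow> ('a::real_inner \<Rightarrow> real) \<Rightarrow> bool" where
  "smooth_fun L \<phi> \<longleftrightarrow> (\<forall>x. \<phi> differentiable (at x)) \<and> L-lipschitz_on UNIV (gradient \<phi>)"

definition effective_domain :: "('a \<Rightarrow> ereal) \<Rightarrow> 'a set" where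
  "effective_domain \<phi> = {x. \<phi> x < \<infinity>}"

definition proper_fun :: "('a \<Rightarrow> ereal) \<Rightarrow> bool" where
  "proper_fun \<phi> \<longleftrightarrow> (\<forall>x. \<phi> x \<noteq> -\<infinity>) \<and> effective_domain \<phi> \<noteq> {}"

definition lsc_fun :: "('a::topological_space \<Rightarrow> ereal) \<Rightarrow> bool" where
  "lsc_fun \<phi> \<longleftrightarrow> (\<forall>x. \<phi> x \<le> Liminf (at x) \<phi>)"

text \<open>Only used together with \<open>proper_fun\<close>, so that no \<open>\<infinity> - \<infinity>\<close> occurs on the right-hand side.\<close>

definition convex_fun :: "('a::real_vector \<Rightarrow> ereal) \<Rightarrow> bool" where
  "convex_fun \<phi> \<longleftrightarrow> (\<forall>x y. \<forall>u\<in>{0<..<1}.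
     \<phi> ((1 - u) *\<^sub>R x + u *\<^sub>R y) \<le> ereal (1 - u) * \<phi> x + ereal u * \<phi> y)"

definition norm_sq :: "real ^ 'p ^ 'p \<Rightarrow> real ^ 'p \<Rightarrow> real" where
  "norm_sq H x = x \<bullet> (H *v x)"

text \<open>For \<open>\<gamma> > 0\<close>, \<open>H\<close> positive definite and \<open>\<phi>\<close> proper, lower semicontinuous and convex,
  the minimizer exists and is unique.\<close>

definition prox :: "real ^ 'p ^ 'p \<Rightarrow> real \<Rightarrow> (real ^ 'p \<Rightarrow> ereal) \<Rightarrow> real ^ 'p \<Rightarrow> real ^ 'p" where
  "prox H \<gamma> \<phi> x = (ARG_MIN (\<lambda>z. \<phi> z + ereal (1 / (2 * \<gamma>) * norm_sq H (x - z))) z. True)"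


section \<open>Block structure\<close>

definition block_restrict :: "real ^ 'p \<Rightarrow> 'p set \<Rightarrow> 'p \<Rightarrow> real" where
  "block_restrict x B = restrict (\<lambda>j. x $ j) B"

text \<open>For a proper extended-valued \<open>F\<close> the components \<open>F\<^sub>B\<close> automatically avoid \<open>-\<infinity>\<close>:
  since \<open>\<infinity> + -\<infinity> = \<infinity>\<close> in \<open>ereal\<close>, a component with value \<open>-\<infinity>\<close> would
  force \<open>F\<close> to attain \<open>-\<infinity>\<close> or to be identically \<open>\<infinity>\<close>.\<close>

definition block_separable :: "'p set set \<Rightarrow> (real ^ 'p \<Rightarrow> 'b::comm_monoid_add) \<Rightarrow> bool" where
  "block_separable \<B> F \<longleftrightarrow>
     (\<exists>F\<^sub>B :: 'p set \<Rightarrow> ('p \<Rightarrow> real) \<Rightarrow> 'b. \<forall>x. F x = (\<Sum>B\<in>\<B>. F\<^sub>B B (block_restrict x B)))"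

definition grad_support :: "(real ^ 'p \<Rightarrow> real) \<Rightarrow> 'p set" where
  "grad_support \<phi> = {j. \<exists>x. gradient \<phi> x $ j \<noteq> 0}"

definition ext_support :: "'p set set \<Rightarrow> (real ^ 'p \<Rightarrow> real) \<Rightarrow> 'p set set" where
  "ext_support \<B> \<phi> = {B\<in>\<B>. grad_support \<phi> \<inter> B \<noteq> {}}"

definition block_proj :: "'p set set \<Rightarrow> (real ^ 'p \<Rightarrow> real) \<Rightarrow> real ^ 'p ^ 'p" where
  "block_proj \<B> \<phi> = (\<chi> j k. if j = k \<and> j \<in> \<Union> (ext_support \<B> \<phi>) then 1 else 0)"

definition block_weight ::
  "'p set set \<Rightarrow> ('n::finite \<Rightarrow> real ^ 'p \<Rightarrow> real) \<Rightarrow> 'p set \<Rightarrow> real" where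
  "block_weight \<B> \<psi> B = real CARD('n) / real (card {i. B \<in> ext_support \<B> (\<psi> i)})"

definition weight_mat ::
  "'p set set \<Rightarrow> ('n::finite \<Rightarrow> real ^ 'p \<Rightarrow> real) \<Rightarrow> real ^ 'p ^ 'p" where
  "weight_mat \<B> \<psi> =
     (\<chi> j k. if j = k then block_weight \<B> \<psi> (THE B. B \<in> \<B> \<and> j \<in> B) else 0)"

definition d_max ::
  "'p::finite set set \<Rightarrow> ('n::finite \<Rightarrow> real ^ 'p \<Rightarrow> real) \<Rightarrow> real" where
  "d_max \<B> \<psi> = Max (range (\<lambda>j. weight_mat \<B> \<psi> $ j $ j))"


section \<open>Problem and algorithm\<close>

definition smooth_part ::
  "('n::finite \<Rightarrow> real ^ 'p \<Rightarrow> real) \<Rightarrow> (real ^ 'p \<Rightarrow> real) \<Rightarrow> real ^ 'p \<Rightarrow> real" where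
  "smooth_part \<psi> \<omega> x = (1 / real CARD('n)) * (\<Sum>i\<in>UNIV. \<psi> i x) + \<omega> x"

definition objective ::
  "('n::finite \<Rightarrow> real ^ 'p \<Rightarrow> real) \<Rightarrow> (real ^ 'p \<Rightarrow> real) \<Rightarrow> (real ^ 'p \<Rightarrow> ereal) \<Rightarrow>
   (real ^ 'p \<Rightarrow> ereal) \<Rightarrow> real ^ 'p \<Rightarrow> ereal" where
  "objective \<psi> \<omega> g h x = ereal (smooth_part \<psi> \<omega> x) + g x + h x"

definition L_f ::
  "'p::finite set set \<Rightarrow> ('n::finite \<Rightarrow> real ^ 'p \<Rightarrow> real) \<Rightarrow> real \<Rightarrow> real \<Rightarrow> real" where
  "L_f \<B> \<psi> L\<^sub>\<psi> L\<^sub>\<omega> = L\<^sub>\<psi> + d_max \<B> \<psi> * L\<^sub>\<omega>"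

definition vrtos_step ::
  "'p::finite set set \<Rightarrow> ('n::finite \<Rightarrow> real ^ 'p \<Rightarrow> real) \<Rightarrow> (real ^ 'p \<Rightarrow> real) \<Rightarrow>
   (real ^ 'p \<Rightarrow> ereal) \<Rightarrow> (real ^ 'p \<Rightarrow> ereal) \<Rightarrow> real \<Rightarrow>
   'n \<Rightarrow> 'n set \<Rightarrow> (real ^ 'p) \<times> (real ^ 'p ^ 'n) \<Rightarrow> (real ^ 'p) \<times> (real ^ 'p ^ 'n)" where
  "vrtos_step \<B> \<psi> \<omega> g h \<gamma> i J = (\<lambda>(y, \<alpha>).
     let D = weight_mat \<B> \<psi>;
         P = block_proj \<B> (\<psi> i);
         z = prox (matrix_inv D) \<gamma> h y;
         \<alpha>_avg = (1 / real CARD('n)) *\<^sub>R (\<Sum>j\<in>UNIV. \<alpha> $ j);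
         v = P *v (gradient (\<psi> i) z - \<alpha> $ i + D *v (\<alpha>_avg + gradient \<omega> z));
         x = prox (matrix_inv D) \<gamma> g (2 *\<^sub>R z - y - \<gamma> *\<^sub>R v)
     in (y + P *v (x - z), \<chi> j. if j \<in> J then gradient (\<psi> j) z else \<alpha> $ j))"

text \<open>The pair \<open>(y\<^sub>t, \<alpha>\<^sub>t)\<close> for one realization \<open>I\<close>, \<open>J\<close> of the sampled indices and of the
  index sets of the memory updates.\<close>

primrec vrtos ::
  "'p::finite set set \<Rightarrow> ('n::finite \<Rightarrow> real ^ 'p \<Rightarrow> real) \<Rightarrow> (real ^ 'p \<Rightarrow> real) \<Rightarrow>
   (real ^ 'p \<Rightarrow> ereal) \<Rightarrow> (real ^ 'p \<Rightarrow> ereal) \<Rightarrow> real \<Rightarrow> real ^ 'p \<Rightarrow> real ^ 'p ^ 'n \<Rightarrow>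
   (nat \<Rightarrow> 'n) \<Rightarrow> (nat \<Rightarrow> 'n set) \<Rightarrow> nat \<Rightarrow> (real ^ 'p) \<times> (real ^ 'p ^ 'n)" where
  "vrtos \<B> \<psi> \<omega> g h \<gamma> y\<^sub>0 \<alpha>\<^sub>0 I J 0 = (y\<^sub>0, \<alpha>\<^sub>0)"
| "vrtos \<B> \<psi> \<omega> g h \<gamma> y\<^sub>0 \<alpha>\<^sub>0 I J (Suc t) =
     vrtos_step \<B> \<psi> \<omega> g h \<gamma> (I t) (J t) (vrtos \<B> \<psi> \<omega> g h \<gamma> y\<^sub>0 \<alpha>\<^sub>0 I J t)"

text \<open>The rows of \<open>\<alpha>\<close> share the block sparsity of the gradients they approximate.  The updates
  preserve this, but an arbitrary \<open>\<alpha>\<^sub>0\<close> need not satisfy it; the gradient estimate is then biased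
  until the offending rows have been overwritten, and the explicit rate can fail.  Example:
  \<open>p = 1\<close>, \<open>g = h = \<omega> = 0\<close>, \<open>n = 1000\<close>, \<open>\<psi>\<^sub>1 x = x\<^sup>2 / 2\<close>, \<open>\<psi>\<^sub>i = 0\<close> for \<open>i \<ge> 2\<close>, \<open>L\<^sub>\<psi> = 1\<close>,
  \<open>L\<^sub>\<omega> = 0\<close>, initial memory \<open>0\<close> for \<open>i = 1\<close> and \<open>1\<close> for \<open>i \<ge> 2\<close>, \<open>y\<^sub>0 = -999\<close>, and \<open>J\<^sub>t\<close> either
  everything (probability \<open>q / n\<close>) or empty: \<open>y\<^sub>t\<close> stays at \<open>y\<^sub>0\<close> until the first memory update,
  with residual \<open>333\<close>, which for small \<open>q\<close> violates the bound at \<open>t \<approx> n / (2 q)\<close>.\<close>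

definition sparse_memory ::
  "'p::finite set set \<Rightarrow> ('n::finite \<Rightarrow> real ^ 'p \<Rightarrow> real) \<Rightarrow> real ^ 'p ^ 'n \<Rightarrow> bool" where
  "sparse_memory \<B> \<psi> \<alpha> \<longleftrightarrow> (\<forall>i. block_proj \<B> (\<psi> i) *v (\<alpha> $ i) = \<alpha> $ i)"

definition tos_operator ::
  "'p::finite set set \<Rightarrow> ('n::finite \<Rightarrow> real ^ 'p \<Rightarrow> real) \<Rightarrow> (real ^ 'p \<Rightarrow> real) \<Rightarrow>
   (real ^ 'p \<Rightarrow> ereal) \<Rightarrow> (real ^ 'p \<Rightarrow> ereal) \<Rightarrow> real \<Rightarrow> real ^ 'p \<Rightarrow> real ^ 'p" where
  "tos_operator \<B> \<psi> \<omega> g h \<gamma> y =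
     (let D = weight_mat \<B> \<psi>;
          z = prox (matrix_inv D) \<gamma> h y
      in y - z + prox (matrix_inv D) \<gamma> g
                   (2 *\<^sub>R z - y - \<gamma> *\<^sub>R (D *v gradient (smooth_part \<psi> \<omega>) z)))"

definition H_0 ::
  "'p::finite set set \<Rightarrow> ('n::finite \<Rightarrow> real ^ 'p \<Rightarrow> real) \<Rightarrow> real \<Rightarrow> real \<Rightarrow>
   real ^ 'p ^ 'n \<Rightarrow> real ^ 'p \<Rightarrow> real" where
  "H_0 \<B> \<psi> L\<^sub>\<psi> L\<^sub>\<omega> \<alpha>\<^sub>0 x_star =
     1 / (2 * real CARD('n) * L_f \<B> \<psi> L\<^sub>\<psi> L\<^sub>\<omega>) *
       (\<Sum>i\<in>UNIV. (norm (\<alpha>\<^sub>0 $ i - gradient (\<psi> i) x_star))\<^sup>2)"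

definition C_0 ::
  "'p::finite set set \<Rightarrow> ('n::finite \<Rightarrow> real ^ 'p \<Rightarrow> real) \<Rightarrow> real \<Rightarrow> real \<Rightarrow> real \<Rightarrow>
   real ^ 'p \<Rightarrow> real ^ 'p ^ 'n \<Rightarrow> real ^ 'p \<Rightarrow> real ^ 'p \<Rightarrow> real" where
  "C_0 \<B> \<psi> L\<^sub>\<psi> L\<^sub>\<omega> q y\<^sub>0 \<alpha>\<^sub>0 x_star y_star =
     5 * d_max \<B> \<psi> * real CARD('n) *
       (2 * L_f \<B> \<psi> L\<^sub>\<psi> L\<^sub>\<omega> * q / real CARD('n) * (norm (y\<^sub>0 - y_star))\<^sup>2
        + H_0 \<B> \<psi> L\<^sub>\<psi> L\<^sub>\<omega> \<alpha>\<^sub>0 x_star)"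


section \<open>Randomness\<close>

definition history ::
  "(nat \<Rightarrow> 's \<Rightarrow> 'n) \<Rightarrow> (nat \<Rightarrow> 's \<Rightarrow> 'n set) \<Rightarrow> nat \<Rightarrow> 's \<Rightarrow> ('n \<times> 'n set) list" where
  "history I J t \<xi> = map (\<lambda>s. (I s \<xi>, J s \<xi>)) [0..<t]"

definition past ::
  "'s measure \<Rightarrow> (nat \<Rightarrow> 's \<Rightarrow> 'n) \<Rightarrow> (nat \<Rightarrow> 's \<Rightarrow> 'n set) \<Rightarrow> nat \<Rightarrow> 's measure" where
  "past M I J t = vimage_algebra (space M) (history I J t) (count_space UNIV)"

definition uniform_sampling ::
  "'s measure \<Rightarrow> (nat \<Rightarrow> 's \<Rightarrow> 'n::finite) \<Rightarrow> (nat \<Rightarrow> 's \<Rightarrow> 'n set) \<Rightarrow> bool" where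
  "uniform_sampling M I J \<longleftrightarrow> (\<forall>t. I t \<in> measurable M (count_space UNIV) \<and>
     (\<forall>i. measure M {\<xi> \<in> space M. I t \<xi> = i} = 1 / real CARD('n)) \<and>
     prob_space.indep_set M (sets (vimage_algebra (space M) (I t) (count_space UNIV)))
       (sets (past M I J t)))"

text \<open>The index \<open>I t\<close> is not part of the past at iteration \<open>t\<close>, so \<open>J t\<close> may depend on it.\<close>

definition uniform_memorization ::
  "'s measure \<Rightarrow> (nat \<Rightarrow> 's \<Rightarrow> 'n::finite) \<Rightarrow> (nat \<Rightarrow> 's \<Rightarrow> 'n set) \<Rightarrow> real \<Rightarrow> bool" where
  "uniform_memorization M I J q \<longleftrightarrow> (\<forall>t. J t \<in> measurable M (count_space UNIV) \<and>
     (\<forall>j. AE \<xi> in M.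
        real_cond_exp M (past M I J t) (\<lambda>\<xi>'. indicator (J t \<xi>') j) \<xi> = q / real CARD('n)))"

end

theory Submission
  imports Defs
begin

text \<open>Fix a fixed point \<open>y\<^sub>s\<close> of \<open>G\<close>, put \<open>z\<^sub>s = prox\<^sub>h y\<^sub>s\<close>, let \<open>u\<close> be the residual \<open>G y - y\<close> and \<open>W\<close>
the inverse of the weight matrix \<open>D\<close>.  The proof follows the Lyapunov function
\<open>E \<parallel>y\<^sub>t - y\<^sub>s\<parallel>\<^sup>2 + \<kappa> E (mean\<^sub>i \<parallel>P\<^sub>i \<alpha>\<^sub>i - \<nabla>\<psi>\<^sub>i z\<^sub>s\<parallel>\<^sup>2)\<close> with \<open>\<kappa> = 3\<gamma>n / (4Lq)\<close> and \<open>L = L\<^sub>f\<close>.  The distance to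
\<open>y\<^sub>s\<close> is measured in the plain norm although the proximal operators use \<open>W\<close>.  Two facts make this
work.  Since \<open>g\<close> is block separable, its subdifferential is monotone on every single block, and on a
block \<open>W\<close> is a multiple of the identity; so the proximal step on the sampled blocks satisfies a
monotonicity inequality for the plain inner product (\<open>prox_block_monotone\<close>).  And the average of the
projections \<open>P\<^sub>i\<close> is \<open>W\<close>, so averaging over the sampled index turns plain inner products on the
sampled blocks into the \<open>W\<close>-inner product, for which the subdifferential of \<open>h\<close> is monotone.

In the resulting inequality the gradient estimate enters through its variance and through its
covariance with the step.  Cocoercivity of the gradients, the gain of the memory update, and the fact
that the noise has mean zero suffice, for \<open>3\<gamma>L \<le> 1\<close>, to write the remainder as a sum of squares that
still contains \<open>\<langle>u, W u\<rangle> / 10\<close> (\<open>step_sum_of_squares\<close>, \<open>mean_step_bound\<close>, \<open>mean_step\<close>).  So if the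
memory is sparse, the Lyapunov function decreases by at least \<open>E \<langle>u, W u\<rangle> / 10\<close> in each step.
Summation bounds \<open>\<Sum>\<^sub>k E \<langle>u\<^sub>k, W u\<^sub>k\<rangle>\<close> by ten times the initial value, and \<open>\<parallel>u\<parallel>\<^sup>2 \<le> d\<^sub>m \<langle>u, W u\<rangle>\<close> with
Jensen's inequality gives the explicit rate.

If the initial memory is not sparse, the gradient estimate is biased by the average of the parts of
the \<open>\<alpha>\<^sub>i\<close> outside their supports.  These parts only ever get erased, so their mean square decays
geometrically in expectation.  With weights \<open>r\<^sup>t\<close> in Young's inequality the bias costs a factor
\<open>1 + K r\<^sup>t\<close> per step, and Gronwall's inequality still bounds the sum of the residuals
(\<open>residual_energy_sum_bounded\<close>).

Two facts link fixed points with minimizers.  A fixed point exists because the qualification on the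
relative interiors splits the optimality condition of the minimizer into a subgradient of \<open>g\<close> and one
of \<open>h\<close> (\<open>subgradient_sum_split\<close>, \<open>fixed_point_exists\<close>).  And \<open>z\<^sub>s\<close> may differ from the minimizer in
the definition of \<open>H\<^sub>0\<close>, but all \<open>\<nabla>\<psi>\<^sub>i\<close> agree at both points (\<open>gradient_at_minimizer\<close>).\<close>

section \<open>Subgradients of convex functions\<close>

definition subgradient_on :: "'a::real_inner set \<Rightarrow> ('a \<Rightarrow> real) \<Rightarrow> 'a \<Rightarrow> 'a \<Rightarrow> bool" where
  "subgradient_on S F x s \<longleftrightarrow> x \<in> S \<and> (\<forall>w\<in>S. F x + s \<bullet> (w - x) \<le> F w)"

lemma subgradient_on_monotone:
  assumes "subgradient_on S F x s" "subgradient_on S F x' s'"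
  shows "0 \<le> (s - s') \<bullet> (x - x')"
proof -
  have "F x + s \<bullet> (x' - x) \<le> F x'" "F x' + s' \<bullet> (x - x') \<le> F x"
    using assms by (auto simp: subgradient_on_def)
  then show ?thesis
    by (simp add: inner_diff_left inner_diff_right)
qed

lemma convex_on_add_linear:
  assumes "convex_on S F"
  shows "convex_on S (\<lambda>x. F x + v \<bullet> x)"
proof -
  have "convex_on S (\<lambda>x. v \<bullet> x)"
    using assms by (auto simp: convex_on_def inner_add_right inner_scaleR_right)
  with assms show ?thesis by (rule convex_on_add)
qed

text \<open>Fermat's rule for a convex plus a differentiable function: along the segment from \<open>p\<close> to \<open>w\<close>,
convexity bounds the growth of \<open>F\<close> and the derivative that of \<open>r\<close>.  It serves for the proximal
operators (quadratic \<open>r\<close>), for the minimizer of the objective, and for tangent inequalities.\<close>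

lemma minimizer_subgradient_on:
  fixes F r :: "'a::real_inner \<Rightarrow> real"
  assumes conv: "convex_on S F" and p: "p \<in> S"
    and min: "\<And>w. w \<in> S \<Longrightarrow> F p + r p \<le> F w + r w"
    and r: "GDERIV r p :> v"
  shows "subgradient_on S F p (- v)"
  unfolding subgradient_on_def
proof (intro conjI ballI)
  fix w assume w: "w \<in> S"
  have D: "((\<lambda>u. r (p + u *\<^sub>R (w - p))) has_real_derivative ((w - p) \<bullet> v)) (at 0)"
  proof -
    have "(r has_derivative (\<lambda>h. h \<bullet> v)) (at (p + 0 *\<^sub>R (w - p)))"
      using r by (simp add: gderiv_def)
    moreover have "((\<lambda>u. p + u *\<^sub>R (w - p)) has_derivative (\<lambda>u. u *\<^sub>R (w - p))) (at (0::real))"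
      by (auto intro!: derivative_eq_intros)
    ultimately have "((\<lambda>u. r (p + u *\<^sub>R (w - p))) has_derivative (\<lambda>u. (u *\<^sub>R (w - p)) \<bullet> v)) (at 0)"
      by (rule has_derivative_compose[rotated])
    then show ?thesis
      by (simp add: has_field_derivative_def mult_commute_abs)
  qed
  then have lim: "((\<lambda>u. (r (p + u *\<^sub>R (w - p)) - r p) / u) \<longlongrightarrow> (w - p) \<bullet> v) (at_right 0)"
    by (auto simp: has_field_derivative_iff intro: tendsto_mono[OF at_le])
  have "\<forall>\<^sub>F u in at_right 0. F p - F w \<le> (r (p + u *\<^sub>R (w - p)) - r p) / u"
    using eventually_at_right_less[of 0] eventually_at_right_real[OF zero_less_one]
  proof eventually_elim
    case (elim u)
    then have u: "0 < u" "u < 1" by auto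
    have comb: "(1 - u) *\<^sub>R p + u *\<^sub>R w = p + u *\<^sub>R (w - p)"
      by (simp add: algebra_simps)
    have "p + u *\<^sub>R (w - p) \<in> S"
      using convexD[OF convex_on_imp_convex[OF conv] p w, of "1 - u" u] u comb by simp
    from min[OF this]
    have "F p + r p \<le> F (p + u *\<^sub>R (w - p)) + r (p + u *\<^sub>R (w - p))" .
    moreover have "F (p + u *\<^sub>R (w - p)) \<le> (1 - u) * F p + u * F w"
      using conv p w u comb unfolding convex_on_def by (metis add.commute diff_add_cancel diff_ge_0_iff_ge less_eq_real_def)
    ultimately have "u * (F p - F w) \<le> r (p + u *\<^sub>R (w - p)) - r p"
      by (simp add: algebra_simps)
    then show ?case using u by (simp add: pos_le_divide_eq mult.commute)
  qed
  from tendsto_lowerbound[OF lim this]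
  have "F p - F w \<le> (w - p) \<bullet> v" by simp
  then show "F p + (- v) \<bullet> (w - p) \<le> F w"
    by (simp add: inner_commute)
qed (fact p)

lemma rel_interior_extend:
  fixes S :: "'a::euclidean_space set"
  assumes "convex S" "z \<in> rel_interior S" "x \<in> S"
  obtains e where "0 < e" "\<And>t. 0 \<le> t \<Longrightarrow> t \<le> e \<Longrightarrow> z + t *\<^sub>R (z - x) \<in> S"
proof -
  from assms obtain e where e: "e > 1" "(1 - e) *\<^sub>R x + e *\<^sub>R z \<in> S"
    using convex_rel_interior_iff[of S z] by blast
  have zS: "z \<in> S" using assms(2) rel_interior_subset by blast
  have "z + t *\<^sub>R (z - x) \<in> S" if t: "0 \<le> t" "t \<le> e - 1" for t
  proof -
    define l where "l = t / (e - 1)"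
    have l: "0 \<le> l" "l \<le> 1" "l * (e - 1) = t" using t e by (auto simp: l_def)
    have "(1 - l) *\<^sub>R z + l *\<^sub>R ((1 - e) *\<^sub>R x + e *\<^sub>R z) \<in> S"
      using convexD[OF assms(1) zS e(2), of "1 - l" l] l by simp
    also have "(1 - l) *\<^sub>R z + l *\<^sub>R ((1 - e) *\<^sub>R x + e *\<^sub>R z) = z + (l * (e - 1)) *\<^sub>R (z - x)"
      by (simp add: algebra_simps)
    finally show ?thesis using l by simp
  qed
  then show ?thesis using that[of "e - 1"] e by auto
qed

text \<open>The sum rule of Moreau and Rockafellar.  The set \<open>K\<close> is the epigraph of the perturbation function
\<open>k \<mapsto> inf {F a + G b - m | a - b = k}\<close>.  Minimality of \<open>x\<close> makes the origin a boundary point of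
\<open>K\<close>, and the slope of a supporting hyperplane there is the required subgradient.  The hyperplane
is not vertical because the relative interiors meet.\<close>

lemma subgradient_sum_split:
  fixes F G :: "'a::euclidean_space \<Rightarrow> real"
  assumes F: "convex_on S F" and G: "convex_on T G"
    and ri: "rel_interior S \<inter> rel_interior T \<noteq> {}"
    and x: "x \<in> S" "x \<in> T"
    and min: "\<And>w. w \<in> S \<Longrightarrow> w \<in> T \<Longrightarrow> F x + G x \<le> F w + G w"
  shows "\<exists>s. subgradient_on S F x s \<and> subgradient_on T G x (- s)"
proof -
  define m where "m = F x + G x"
  define K where "K = {(a - b, r) | a b r. a \<in> S \<and> b \<in> T \<and> F a + G b - m \<le> r}"
  have cS: "convex S" and cT: "convex T"
    using F G by (auto simp: convex_on_def)
  have K: "convex K"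
  proof (rule convexI)
    fix k k' and u v :: real
    assume kk: "k \<in> K" "k' \<in> K" and uv: "0 \<le> u" "0 \<le> v" "u + v = 1"
    obtain a b r where k: "k = (a - b, r)" "a \<in> S" "b \<in> T" "F a + G b - m \<le> r"
      using kk(1) by (auto simp: K_def)
    obtain a' b' r' where k': "k' = (a' - b', r')" "a' \<in> S" "b' \<in> T" "F a' + G b' - m \<le> r'"
      using kk(2) by (auto simp: K_def)
    have "F (u *\<^sub>R a + v *\<^sub>R a') \<le> u * F a + v * F a'"
      using F k k' uv by (simp add: convex_on_def)
    moreover have "G (u *\<^sub>R b + v *\<^sub>R b') \<le> u * G b + v * G b'"
      using G k k' uv by (simp add: convex_on_def)
    moreover have "u * (F a + G b - m) + v * (F a' + G b' - m) \<le> u * r + v * r'"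
      using k k' uv by (intro add_mono mult_left_mono) auto
    moreover have "u * (F a + G b - m) + v * (F a' + G b' - m)
        = (u * F a + v * F a') + (u * G b + v * G b') - (u + v) * m"
      by (simp add: algebra_simps)
    ultimately have le: "F (u *\<^sub>R a + v *\<^sub>R a') + G (u *\<^sub>R b + v *\<^sub>R b') - m \<le> u * r + v * r'"
      using uv by simp
    have "u *\<^sub>R a + v *\<^sub>R a' \<in> S" "u *\<^sub>R b + v *\<^sub>R b' \<in> T"
      using convexD[OF cS] convexD[OF cT] k k' uv by auto
    moreover have "u *\<^sub>R k + v *\<^sub>R k' = ((u *\<^sub>R a + v *\<^sub>R a') - (u *\<^sub>R b + v *\<^sub>R b'), u * r + v * r')"
      by (simp add: k k' algebra_simps)
    ultimately show "u *\<^sub>R k + v *\<^sub>R k' \<in> K"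
      using le unfolding K_def by blast
  qed
  have inK: "(a - b, r) \<in> K" if "a \<in> S" "b \<in> T" "F a + G b - m \<le> r" for a b r
    using that unfolding K_def by blast
  have 0: "(0, 0) \<in> K" and 1: "(0, 1) \<in> K"
    using inK[of x x 0] inK[of x x 1] x by (simp_all add: m_def)
  have above: "0 \<le> r" if "(0, r) \<in> K" for r
    using that min unfolding K_def m_def by force
  have "(0, 0) \<notin> rel_interior K"
  proof
    assume "(0, 0) \<in> rel_interior K"
    from rel_interior_extend[OF K this 1] obtain e
      where "0 < e" "\<And>t. 0 \<le> t \<Longrightarrow> t \<le> e \<Longrightarrow> (0, 0) + t *\<^sub>R ((0, 0) - (0::'a, 1::real)) \<in> K" by metis
    then have "(0, - e) \<in> K" by (force simp: zero_prod_def)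
    with above[of "- e"] \<open>0 < e\<close> show False by simp
  qed
  from supporting_hyperplane_rel_boundary[OF K 0 this]
  obtain c where c: "\<And>k. k \<in> K \<Longrightarrow> c \<bullet> (0, 0) \<le> c \<bullet> k"
    and c': "\<And>k. k \<in> rel_interior K \<Longrightarrow> c \<bullet> (0, 0) < c \<bullet> k" by metis
  obtain w \<tau> where wt: "c = (w, \<tau>)" by (cases c)
  have sup: "0 \<le> w \<bullet> (a - b) + \<tau> * r" if "a \<in> S" "b \<in> T" "F a + G b - m \<le> r" for a b r
    using c[OF inK[OF that]] by (simp add: wt)
  have "0 \<le> \<tau>" using c[OF 1] by (simp add: wt)
  moreover have "\<tau> \<noteq> 0"
  proof
    assume \<tau>: "\<tau> = 0"
    from ri obtain z where z: "z \<in> rel_interior S" "z \<in> rel_interior T" by blast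
    have *: "w \<bullet> (a - b) = 0" if ab: "a \<in> S" "b \<in> T" for a b
    proof -
      obtain e where e: "0 < e" "\<And>t. 0 \<le> t \<Longrightarrow> t \<le> e \<Longrightarrow> z + t *\<^sub>R (z - a) \<in> S"
        using rel_interior_extend[OF cS z(1) ab(1)] by blast
      obtain e' where e': "0 < e'" "\<And>t. 0 \<le> t \<Longrightarrow> t \<le> e' \<Longrightarrow> z + t *\<^sub>R (z - b) \<in> T"
        using rel_interior_extend[OF cT z(2) ab(2)] by blast
      define t where "t = min e e'"
      have t: "0 < t" using e e' by (simp add: t_def)
      have "z + t *\<^sub>R (z - a) \<in> S" "z + t *\<^sub>R (z - b) \<in> T" using e e' t by (auto simp: t_def)
      from sup[OF this order_refl] have "0 \<le> t * (w \<bullet> (b - a))"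
        by (simp add: \<tau> inner_diff_right inner_add_right algebra_simps)
      with t have "0 \<le> w \<bullet> (b - a)" by (simp add: zero_le_mult_iff)
      moreover have "0 \<le> w \<bullet> (a - b)" using sup[OF ab order_refl] by (simp add: \<tau>)
      ultimately show ?thesis by (simp add: inner_diff_right)
    qed
    have "rel_interior K \<noteq> {}" using K 0 rel_interior_eq_empty by blast
    then obtain k where k: "k \<in> rel_interior K" by blast
    then have "k \<in> K" using rel_interior_subset by blast
    then have "c \<bullet> k = 0" using * by (auto simp: K_def wt \<tau>)
    with c'[OF k] show False by (simp add: wt)
  qed
  ultimately have \<tau>: "0 < \<tau>" by simp
  define s where "s = - (1 / \<tau>) *\<^sub>R w"
  have key: "m + s \<bullet> (a - b) \<le> F a + G b" if "a \<in> S" "b \<in> T" for a b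
  proof -
    have "0 \<le> w \<bullet> (a - b) + \<tau> * (F a + G b - m)" using sup[OF that] by simp
    then have "0 \<le> (w \<bullet> (a - b) + \<tau> * (F a + G b - m)) / \<tau>"
      using \<tau> by simp
    also have "\<dots> = - (s \<bullet> (a - b)) + (F a + G b - m)"
      using \<tau> by (simp add: s_def field_simps)
    finally show ?thesis by simp
  qed
  have "subgradient_on S F x s"
    using key[OF _ x(2)] x by (auto simp: subgradient_on_def m_def)
  moreover have "subgradient_on T G x (- s)"
    using key[OF x(1)] x by (auto simp: subgradient_on_def m_def inner_diff_right)
  ultimately show ?thesis by blast
qed

text \<open>The sum rule with a singleton as second set yields subgradients at relative interior points; this
is the affine minorant that makes proximal problems coercive.\<close>

lemma convex_on_has_subgradient:
  fixes F :: "'a::euclidean_space \<Rightarrow> real"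
  assumes "convex_on S F" "S \<noteq> {}"
  shows "\<exists>x s. subgradient_on S F x s"
proof -
  have cS: "convex S" using assms(1) by (simp add: convex_on_def)
  then obtain x where x: "x \<in> rel_interior S" using assms(2) rel_interior_eq_empty by blast
  have "convex_on {x} (\<lambda>_. 0::real)" by (simp add: convex_on_def)
  moreover have "rel_interior S \<inter> rel_interior {x} \<noteq> {}" using x by simp
  ultimately show ?thesis
    using subgradient_sum_split[OF assms(1), of "{x}" "\<lambda>_. 0" x] x rel_interior_subset[of S] by blast
qed

section \<open>Smooth convex functions\<close>

lemma GDERIV_gradient:
  fixes \<phi> :: "'a::euclidean_space \<Rightarrow> real"
  assumes "\<phi> differentiable (at x)"
  shows "GDERIV \<phi> x :> gradient \<phi> x"
proof -
  obtain A where A: "(\<phi> has_derivative A) (at x)"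
    using assms by (auto simp: differentiable_def)
  then have lin: "linear A" by (rule has_derivative_linear)
  have "A h = h \<bullet> adjoint A 1" for h
    using adjoint_works[OF lin, of h 1] by simp
  then have "A = (\<lambda>h. h \<bullet> adjoint A 1)" by blast
  with A have ex: "GDERIV \<phi> x :> adjoint A 1" by (simp add: gderiv_def)
  have "GDERIV \<phi> x :> (THE v. GDERIV \<phi> x :> v)"
  proof (rule theI[where P = "\<lambda>v. GDERIV \<phi> x :> v", OF ex])
    fix v assume "GDERIV \<phi> x :> v"
    then have "(\<lambda>h. h \<bullet> v) = (\<lambda>h. h \<bullet> adjoint A 1)"
      using ex has_derivative_unique unfolding gderiv_def by blast
    then show "v = adjoint A 1" by (metis vector_eq_ldot inner_commute)
  qed
  then show ?thesis by (simp add: gradient_def)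
qed

lemma gradient_eqI:
  fixes \<phi> :: "'a::euclidean_space \<Rightarrow> real"
  assumes "GDERIV \<phi> x :> v"
  shows "gradient \<phi> x = v"
proof -
  have "\<phi> differentiable (at x)" using assms by (auto simp: gderiv_def differentiable_def)
  from GDERIV_gradient[OF this] assms have "(\<lambda>h. h \<bullet> gradient \<phi> x) = (\<lambda>h. h \<bullet> v)"
    using has_derivative_unique unfolding gderiv_def by blast
  then show ?thesis by (metis vector_eq_ldot inner_commute)
qed

definition bregman :: "('a::real_inner \<Rightarrow> real) \<Rightarrow> 'a \<Rightarrow> 'a \<Rightarrow> real" where
  "bregman \<phi> x w = \<phi> w - \<phi> x - gradient \<phi> x \<bullet> (w - x)"

lemma bregman_symmetrized:
  "bregman \<phi> x w + bregman \<phi> w x = (gradient \<phi> w - gradient \<phi> x) \<bullet> (w - x)"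
  by (simp add: bregman_def inner_diff_left inner_diff_right)

lemma bregman_nonneg:
  fixes \<phi> :: "'a::euclidean_space \<Rightarrow> real"
  assumes "convex_on UNIV \<phi>" "\<phi> differentiable (at x)"
  shows "0 \<le> bregman \<phi> x w"
proof -
  have "GDERIV (\<lambda>z. - \<phi> z) x :> - gradient \<phi> x"
    by (intro GDERIV_minus GDERIV_gradient assms)
  from minimizer_subgradient_on[OF assms(1) _ _ this] show ?thesis
    by (simp add: subgradient_on_def bregman_def) (metis add_le_imp_le_diff diff_diff_eq2 diff_ge_0_iff_ge diff_diff_add)
qed

lemma bregman_descent:
  fixes \<phi> :: "'a::euclidean_space \<Rightarrow> real"
  assumes "smooth_fun L \<phi>"
  shows "bregman \<phi> x w \<le> L / 2 * (norm (w - x))\<^sup>2"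
proof -
  define d where "d = w - x"
  \<comment> \<open>the defect of the descent inequality along the segment; it is nonincreasing\<close>
  define k where "k t = \<phi> (x + t *\<^sub>R d) - t * (gradient \<phi> x \<bullet> d) - L / 2 * (t\<^sup>2 * (norm d)\<^sup>2)" for t
  have diff: "\<phi> differentiable (at z)" for z using assms by (simp add: smooth_fun_def)
  have Lip: "norm (gradient \<phi> a - gradient \<phi> b) \<le> L * norm (a - b)" for a b
    using assms by (auto simp: smooth_fun_def lipschitz_on_def dist_norm)
  have "k 1 \<le> k 0"
  proof (rule DERIV_nonpos_imp_nonincreasing[where f = k and a = 0 and b = 1])
    fix t :: real assume t: "0 \<le> t" "t \<le> 1"
    have "(\<phi> has_derivative (\<lambda>h. h \<bullet> gradient \<phi> (x + t *\<^sub>R d))) (at (x + t *\<^sub>R d))"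
      using GDERIV_gradient[OF diff] by (simp add: gderiv_def)
    moreover have "((\<lambda>u. x + u *\<^sub>R d) has_derivative (\<lambda>u. u *\<^sub>R d)) (at t)"
      by (auto intro!: derivative_eq_intros)
    ultimately have "((\<lambda>u. \<phi> (x + u *\<^sub>R d)) has_derivative
        (\<lambda>u. (u *\<^sub>R d) \<bullet> gradient \<phi> (x + t *\<^sub>R d))) (at t)"
      by (rule has_derivative_compose[rotated])
    then have "((\<lambda>u. \<phi> (x + u *\<^sub>R d)) has_real_derivative (d \<bullet> gradient \<phi> (x + t *\<^sub>R d))) (at t)"
      by (simp add: has_field_derivative_def mult_commute_abs)
    then have D: "(k has_real_derivative
        (d \<bullet> gradient \<phi> (x + t *\<^sub>R d) - gradient \<phi> x \<bullet> d - L * t * (norm d)\<^sup>2)) (at t)"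
      unfolding k_def by (auto intro!: derivative_eq_intros)
    have "(gradient \<phi> (x + t *\<^sub>R d) - gradient \<phi> x) \<bullet> d
        \<le> norm (gradient \<phi> (x + t *\<^sub>R d) - gradient \<phi> x) * norm d"
      by (rule norm_cauchy_schwarz)
    also have "\<dots> \<le> (L * norm (t *\<^sub>R d)) * norm d"
      using Lip[of "x + t *\<^sub>R d" x] by (intro mult_right_mono) auto
    also have "\<dots> = L * t * (norm d)\<^sup>2" using t by (simp add: power2_eq_square)
    finally have "d \<bullet> gradient \<phi> (x + t *\<^sub>R d) - gradient \<phi> x \<bullet> d - L * t * (norm d)\<^sup>2 \<le> 0"
      by (simp add: inner_diff_left inner_diff_right inner_commute)
    with D show "\<exists>y. (k has_real_derivative y) (at t) \<and> y \<le> 0" by blast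
  qed simp
  then show ?thesis by (simp add: k_def bregman_def d_def)
qed

text \<open>The Bregman distance from \<open>x\<close> is nonnegative everywhere, in particular after one gradient step of
length \<open>1 / L\<close> from \<open>w\<close>, and the descent lemma says how much that step decreases it.\<close>

lemma norm_gradient_diff_le_bregman:
  fixes \<phi> :: "'a::euclidean_space \<Rightarrow> real"
  assumes conv: "convex_on UNIV \<phi>" and smooth: "smooth_fun L \<phi>"
  shows "(norm (gradient \<phi> w - gradient \<phi> x))\<^sup>2 \<le> 2 * L * bregman \<phi> x w"
proof -
  have diff: "\<phi> differentiable (at z)" for z using smooth by (simp add: smooth_fun_def)
  have L0: "0 \<le> L" and Lip: "norm (gradient \<phi> a - gradient \<phi> b) \<le> L * norm (a - b)" for a b
    using smooth by (auto simp: smooth_fun_def lipschitz_on_def dist_norm)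
  define v where "v = gradient \<phi> w - gradient \<phi> x"
  show ?thesis
  proof (cases "L = 0")
    case True
    with Lip[of w x] show ?thesis by simp
  next
    case False
    with L0 have L: "0 < L" by simp
    define w' where "w' = w - (1 / L) *\<^sub>R v"
    have "0 \<le> bregman \<phi> x w'" by (rule bregman_nonneg[OF conv diff])
    also have "bregman \<phi> x w' = bregman \<phi> x w + bregman \<phi> w w' + v \<bullet> (w' - w)"
      by (simp add: bregman_def v_def inner_diff_left inner_diff_right)
    also have "\<dots> \<le> bregman \<phi> x w + L / 2 * (norm (w' - w))\<^sup>2 + v \<bullet> (w' - w)"
      using bregman_descent[OF smooth, of w w'] by simp
    also have "\<dots> = bregman \<phi> x w - (norm v)\<^sup>2 / (2 * L)"
      using L by (simp add: w'_def power2_norm_eq_inner power_mult_distrib field_simps power2_eq_square[of L])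
    finally show ?thesis using L by (simp add: v_def field_simps)
  qed
qed

lemma gradient_cocoercive:
  fixes \<phi> :: "'a::euclidean_space \<Rightarrow> real"
  assumes "convex_on UNIV \<phi>" "smooth_fun L \<phi>"
  shows "(norm (gradient \<phi> w - gradient \<phi> x))\<^sup>2 \<le> L * ((gradient \<phi> w - gradient \<phi> x) \<bullet> (w - x))"
proof -
  have "2 * (norm (gradient \<phi> w - gradient \<phi> x))\<^sup>2 \<le> 2 * L * bregman \<phi> x w + 2 * L * bregman \<phi> w x"
    using norm_gradient_diff_le_bregman[OF assms, of w x] norm_gradient_diff_le_bregman[OF assms, of x w]
    by (simp add: norm_minus_commute)
  also have "\<dots> = 2 * (L * ((gradient \<phi> w - gradient \<phi> x) \<bullet> (w - x)))"
    by (simp add: bregman_symmetrized[symmetric] distrib_left)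
  finally show ?thesis by simp
qed

section \<open>Proximal operators of extended-valued convex functions\<close>

abbreviation subgradient :: "('a::real_inner \<Rightarrow> ereal) \<Rightarrow> 'a \<Rightarrow> 'a \<Rightarrow> bool" where
  "subgradient \<phi> \<equiv> subgradient_on (effective_domain \<phi>) (\<lambda>x. real_of_ereal (\<phi> x))"

lemma proper_fun_ereal_real:
  assumes "proper_fun \<phi>" "x \<in> effective_domain \<phi>"
  shows "ereal (real_of_ereal (\<phi> x)) = \<phi> x"
  using assms by (cases "\<phi> x") (auto simp: proper_fun_def effective_domain_def)

lemma convex_on_effective_domain:
  assumes proper: "proper_fun \<phi>" and conv: "convex_fun \<phi>"
  shows "convex_on (effective_domain \<phi>) (\<lambda>x. real_of_ereal (\<phi> x))"
proof -
  have *: "u *\<^sub>R x + v *\<^sub>R y \<in> effective_domain \<phi> \<and>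
      real_of_ereal (\<phi> (u *\<^sub>R x + v *\<^sub>R y)) \<le> u * real_of_ereal (\<phi> x) + v * real_of_ereal (\<phi> y)"
    if xy: "x \<in> effective_domain \<phi>" "y \<in> effective_domain \<phi>" and uv: "0 \<le> u" "0 \<le> v" "u + v = 1"
    for x y and u v :: real
  proof (cases "v = 0 \<or> v = 1")
    case True
    with xy uv show ?thesis by auto
  next
    case False
    then have v: "v \<in> {0<..<1}" and u: "u = 1 - v" using uv by auto
    from conv v have "\<phi> (u *\<^sub>R x + v *\<^sub>R y) \<le> ereal u * \<phi> x + ereal v * \<phi> y"
      unfolding convex_fun_def u by blast
    also have "\<dots> = ereal (u * real_of_ereal (\<phi> x) + v * real_of_ereal (\<phi> y))"
      using proper_fun_ereal_real[OF proper xy(1)] proper_fun_ereal_real[OF proper xy(2)]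
      by (metis plus_ereal.simps(1) times_ereal.simps(1))
    finally have le: "\<phi> (u *\<^sub>R x + v *\<^sub>R y) \<le> ereal (u * real_of_ereal (\<phi> x) + v * real_of_ereal (\<phi> y))" .
    then have dom: "u *\<^sub>R x + v *\<^sub>R y \<in> effective_domain \<phi>"
      by (auto simp: effective_domain_def)
    from le show ?thesis
      using proper_fun_ereal_real[OF proper dom] dom by (metis ereal_less_eq(3))
  qed
  then have "convex (effective_domain \<phi>)" by (intro convexI) auto
  with * show ?thesis by (auto simp: convex_on_def)
qed

text \<open>\<open>lsc_fun\<close> is stated with the punctured filter; superlevel sets are open because the value at the
point itself exceeds \<open>c\<close> as well.\<close>

lemma lsc_fun_open_superlevel:
  assumes "lsc_fun \<phi>"
  shows "open {z. c < \<phi> z}"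
proof (subst open_subopen, intro ballI)
  fix z assume "z \<in> {z. c < \<phi> z}"
  then have cz: "c < \<phi> z" by simp
  also have "\<phi> z \<le> Liminf (at z) \<phi>" using assms by (simp add: lsc_fun_def)
  finally have "\<forall>\<^sub>F w in at z. c < \<phi> w" by (rule less_LiminfD)
  then have "\<forall>\<^sub>F w in nhds z. c < \<phi> w"
    using cz by (auto simp: eventually_at_filter elim: eventually_mono)
  then show "\<exists>T. open T \<and> z \<in> T \<and> T \<subseteq> {z. c < \<phi> z}"
    unfolding eventually_nhds by blast
qed

lemma lsc_fun_add_continuous_open:
  fixes r :: "'a::topological_space \<Rightarrow> real"
  assumes lsc: "lsc_fun \<phi>" and proper: "proper_fun \<phi>" and r: "continuous_on UNIV r"
  shows "open {z. c < \<phi> z + ereal (r z)}"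
proof (cases c)
  case (real c')
  have "{z. c < \<phi> z + ereal (r z)} = (\<Union>e. {z. ereal e < \<phi> z} \<inter> {z. c' - e < r z})" (is "?A = ?B")
  proof
    show "?A \<subseteq> ?B"
    proof
      fix z assume z: "z \<in> ?A"
      have "ereal (c' - r z) < \<phi> z"
        using z proper real by (cases "\<phi> z") (auto simp: proper_fun_def)
      then obtain e where e: "ereal (c' - r z) < ereal e" "ereal e < \<phi> z"
        using ereal_dense2 by blast
      then have "z \<in> {z. ereal e < \<phi> z} \<inter> {z. c' - e < r z}" by auto
      then show "z \<in> ?B" by blast
    qed
    show "?B \<subseteq> ?A"
    proof
      fix z assume "z \<in> ?B"
      then obtain e where e: "ereal e < \<phi> z" "c' - e < r z" by blast
      then show "z \<in> ?A" using real by (cases "\<phi> z") auto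
    qed
  qed
  moreover have "open \<dots>"
    using lsc_fun_open_superlevel[OF lsc] r
    by (intro open_UN ballI open_Int) (auto intro!: open_Collect_less continuous_on_const)
  ultimately show ?thesis by simp
next
  case MInf
  have "{z. c < \<phi> z + ereal (r z)} = UNIV"
    using proper MInf
    by (auto simp: proper_fun_def)
  then show ?thesis by simp
qed simp

text \<open>If no point were a minimizer, the open sets \<open>{z. f w < f z}\<close> would cover \<open>K\<close>; the best centre of a
finite subcover is then not covered.\<close>

lemma compact_attains_min_lsc:
  fixes f :: "'a::topological_space \<Rightarrow> 'b::linorder"
  assumes K: "compact K" "K \<noteq> {}" and "\<And>c. open {z. c < f z}"
  shows "\<exists>p\<in>K. \<forall>w\<in>K. f p \<le> f w"
proof (rule ccontr)
  assume "\<not> ?thesis"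
  then have "K \<subseteq> (\<Union>w\<in>K. {z. f w < f z})" by (force simp: not_le)
  then obtain C where C: "C \<subseteq> K" "finite C" "K \<subseteq> (\<Union>w\<in>C. {z. f w < f z})"
    using compactE_image[OF K(1), of K "\<lambda>w. {z. f w < f z}"] assms(3) by metis
  then have "C \<noteq> {}" using K(2) by auto
  with C(2) obtain w where w: "w \<in> C" "\<forall>v\<in>C. f w \<le> f v"
    by (meson ex_min_if_finite finite_imageI arg_min_if_finite(1) arg_min_least)
  with C have "w \<in> (\<Union>w\<in>C. {z. f w < f z})" by blast
  with w(2) show False by (auto simp: not_le[symmetric])
qed

text \<open>A symmetric positive definite weight, with an explicit lower bound \<open>c\<close> on its eigenvalues.\<close>

locale prox_weight =
  fixes H :: "real ^ 'p::finite ^ 'p" and c :: real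
  assumes symmetric: "v \<bullet> (H *v w) = (H *v v) \<bullet> w"
    and c_pos: "0 < c"
    and coercive: "c * (norm v)\<^sup>2 \<le> v \<bullet> (H *v v)"
begin

lemma pd_eq_0: "v \<bullet> (H *v v) \<le> 0 \<Longrightarrow> v = 0"
  using coercive[of v] c_pos by (smt (verit) mult_pos_pos zero_less_norm_iff zero_less_power)

lemma GDERIV_prox_term:
  assumes "0 < \<gamma>"
  shows "GDERIV (\<lambda>z. 1 / (2 * \<gamma>) * norm_sq H (x - z)) z :> - ((1 / \<gamma>) *\<^sub>R (H *v (x - z)))"
proof -
  have lin: "bounded_linear ((*v) H)" by (simp add: linear_conv_bounded_linear[symmetric])
  have "((\<lambda>z. 1 / (2 * \<gamma>) * ((x - z) \<bullet> (H *v (x - z)))) has_derivative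
      (\<lambda>h. 1 / (2 * \<gamma>) * ((x - z) \<bullet> (H *v (- h)) + (- h) \<bullet> (H *v (x - z))))) (at z)"
    using assms
    by (auto intro!: derivative_eq_intros bounded_linear.has_derivative[OF lin] simp: fun_eq_iff field_simps)
  moreover have "(\<lambda>h. 1 / (2 * \<gamma>) * ((x - z) \<bullet> (H *v (- h)) + (- h) \<bullet> (H *v (x - z))))
      = (\<lambda>h. h \<bullet> - ((1 / \<gamma>) *\<^sub>R (H *v (x - z))))"
    using assms symmetric[of "x - z" "- h" for h] by (simp add: fun_eq_iff inner_commute field_simps)
  ultimately show ?thesis unfolding gderiv_def norm_sq_def by (simp only:)
qed

context
  fixes \<phi> :: "real ^ 'p \<Rightarrow> ereal" and \<gamma> :: real
  assumes proper: "proper_fun \<phi>" and lsc: "lsc_fun \<phi>" and conv: "convex_fun \<phi>"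
    and \<gamma>: "0 < \<gamma>"
begin

text \<open>Existence: an affine minorant of \<open>\<phi>\<close> loses against the quadratic term, so outside a large ball all
values exceed the one at a point of the domain, and on the ball lower semicontinuity suffices.\<close>

lemma prox_is_arg_min:
  "is_arg_min (\<lambda>z. \<phi> z + ereal (1 / (2 * \<gamma>) * norm_sq H (x - z))) (\<lambda>_. True) (prox H \<gamma> \<phi> x)"
proof -
  define r where "r z = 1 / (2 * \<gamma>) * norm_sq H (x - z)" for z
  let ?f = "\<lambda>z. \<phi> z + ereal (r z)"
  have dom_ne: "effective_domain \<phi> \<noteq> {}" using proper by (simp add: proper_fun_def)
  obtain x0 s where s: "subgradient \<phi> x0 s"
    using convex_on_has_subgradient[OF convex_on_effective_domain[OF proper conv] dom_ne] by blast
  define F where "F z = real_of_ereal (\<phi> z)" for z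
  have x0: "x0 \<in> effective_domain \<phi>" using s by (simp add: subgradient_on_def)
  have cont: "continuous_on UNIV r"
  proof -
    have "isCont r z" for z
      using GDERIV_prox_term[OF \<gamma>, of x z] has_derivative_continuous unfolding gderiv_def r_def by blast
    then show ?thesis by (simp add: continuous_on_eq_continuous_at)
  qed
  define k where "k = c / (2 * \<gamma>)"
  have k: "0 < k" using c_pos \<gamma> by (simp add: k_def)
  have r_ge: "k * (norm (x - z))\<^sup>2 \<le> r z" for z
    using coercive[of "x - z"] \<gamma> by (simp add: r_def k_def norm_sq_def field_simps)
  \<comment> \<open>\<open>t * A\<close> bounds what the affine minorant can lose at distance \<open>t \<ge> 1\<close>; beyond \<open>A / k\<close> the quadratic term wins\<close>
  define A where "A = norm s * (1 + norm (x - x0)) + r x0"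
  define R where "R = max (max 1 (norm (x - x0))) (A / k)"
  have r0: "0 \<le> r x0" using r_ge[of x0] k by (smt (verit) mult_nonneg_nonneg zero_le_power2)
  have outside: "?f x0 \<le> ?f z" if z: "z \<notin> cball x R" for z
  proof (cases "z \<in> effective_domain \<phi>")
    case True
    define t where "t = norm (x - z)"
    have t: "1 \<le> t" "A / k < t" using z by (auto simp: R_def t_def dist_norm)
    have "norm (z - x0) \<le> t + norm (x - x0)"
      using norm_triangle_ineq[of "z - x" "x - x0"] by (simp add: t_def norm_minus_commute)
    also have "\<dots> \<le> t * (1 + norm (x - x0))"
      using t mult_right_mono[of 1 t "norm (x - x0)"] by (simp add: algebra_simps)
    finally have n: "norm (z - x0) \<le> t * (1 + norm (x - x0))" .
    have "F x0 + s \<bullet> (z - x0) \<le> F z" using s True by (simp add: subgradient_on_def F_def)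
    moreover have "- (s \<bullet> (z - x0)) \<le> norm s * norm (z - x0)"
      using norm_cauchy_schwarz[of "- s" "z - x0"] by simp
    moreover have "norm s * norm (z - x0) \<le> norm s * (t * (1 + norm (x - x0)))"
      by (intro mult_left_mono n) simp
    moreover have "norm s * (t * (1 + norm (x - x0))) + r x0 \<le> t * A"
      using t r0 mult_right_mono[of 1 t "r x0"] by (simp add: A_def algebra_simps)
    moreover have "t * A \<le> k * t\<^sup>2"
      using t k by (simp add: power2_eq_square field_simps)
    moreover have "k * t\<^sup>2 \<le> r z" using r_ge[of z] by (simp add: t_def)
    ultimately have "F x0 + r x0 \<le> F z + r z" by linarith
    then have "ereal (F x0) + ereal (r x0) \<le> ereal (F z) + ereal (r z)" by simp
    then show ?thesis
      using proper_fun_ereal_real[OF proper True] proper_fun_ereal_real[OF proper x0]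
      by (simp add: F_def)
  qed (auto simp: effective_domain_def)
  have x0in: "x0 \<in> cball x R" by (simp add: R_def dist_norm)
  have "open {z. a < ?f z}" for a
    by (rule lsc_fun_add_continuous_open[OF lsc proper cont])
  from compact_attains_min_lsc[OF compact_cball _ this] x0in
  obtain p where p: "p \<in> cball x R" "\<And>w. w \<in> cball x R \<Longrightarrow> ?f p \<le> ?f w" by blast
  have "?f p \<le> ?f w" for w
    using p(2)[of w] outside[of w] p(2)[OF x0in] by (cases "w \<in> cball x R") auto
  then have "is_arg_min ?f (\<lambda>_. True) p" by (auto simp: is_arg_min_def not_less)
  then show ?thesis
    unfolding prox_def arg_min_def r_def[symmetric] by (rule someI)
qed

lemma prox_subgradient:
  "subgradient \<phi> (prox H \<gamma> \<phi> x) ((1 / \<gamma>) *\<^sub>R (H *v (x - prox H \<gamma> \<phi> x)))"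
proof -
  let ?r = "\<lambda>z. 1 / (2 * \<gamma>) * norm_sq H (x - z)" and ?p = "prox H \<gamma> \<phi> x"
  have min: "\<phi> ?p + ereal (?r ?p) \<le> \<phi> w + ereal (?r w)" for w
    using prox_is_arg_min[of x] by (simp add: is_arg_min_def not_less)
  obtain x0 where x0: "x0 \<in> effective_domain \<phi>" using proper by (auto simp: proper_fun_def)
  have dom: "?p \<in> effective_domain \<phi>"
    using min[of x0] x0 by (cases "\<phi> ?p"; cases "\<phi> x0") (auto simp: effective_domain_def)
  have "real_of_ereal (\<phi> ?p) + ?r ?p \<le> real_of_ereal (\<phi> w) + ?r w" if "w \<in> effective_domain \<phi>" for w
    using min[of w] proper_fun_ereal_real[OF proper dom] proper_fun_ereal_real[OF proper that]
    by (metis ereal_less_eq(3) plus_ereal.simps(1))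
  from minimizer_subgradient_on[OF convex_on_effective_domain[OF proper conv] dom this
      GDERIV_prox_term[OF \<gamma>]]
  show ?thesis by simp
qed

lemma prox_eqI:
  assumes "subgradient \<phi> p ((1 / \<gamma>) *\<^sub>R (H *v (x - p)))"
  shows "prox H \<gamma> \<phi> x = p"
proof -
  let ?q = "prox H \<gamma> \<phi> x"
  have "0 \<le> ((1 / \<gamma>) *\<^sub>R (H *v (x - ?q)) - (1 / \<gamma>) *\<^sub>R (H *v (x - p))) \<bullet> (?q - p)"
    by (rule subgradient_on_monotone[OF prox_subgradient assms])
  also have "\<dots> = - (1 / \<gamma>) * ((?q - p) \<bullet> (H *v (?q - p)))"
    by (simp add: matrix_vector_mult_diff_distrib inner_commute algebra_simps inner_diff_left inner_diff_right)
  finally have "(?q - p) \<bullet> (H *v (?q - p)) \<le> 0"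
    using \<gamma> by (simp add: divide_le_0_iff)
  from pd_eq_0[OF this] show ?thesis by simp
qed

end

end

section \<open>Averages over the summands\<close>

definition mean :: "('n::finite \<Rightarrow> 'a::real_vector) \<Rightarrow> 'a" where
  "mean f = (1 / real CARD('n)) *\<^sub>R (\<Sum>i\<in>UNIV. f i)"

lemma mean_add: "mean (\<lambda>i. f i + f' i) = mean f + mean f'"
  by (simp add: mean_def sum.distrib scaleR_add_right)

lemma mean_diff: "mean (\<lambda>i. f i - f' i) = mean f - mean f'"
  by (simp add: mean_def sum_subtractf scaleR_diff_right)

lemma mean_const: "mean (\<lambda>i::'n::finite. v) = v"
  by (simp add: mean_def sum_constant_scaleR)

lemma mean_linear: "linear F \<Longrightarrow> mean (\<lambda>i. F (f i)) = F (mean f)"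
  by (simp add: mean_def linear_scale linear_sum)

lemma mean_cmult: "mean (\<lambda>i. r * f i) = r * mean f" for f :: "'n::finite \<Rightarrow> real"
  by (simp add: mean_def sum_distrib_left)

lemma mean_inner_right: "mean (\<lambda>i. v \<bullet> f i) = v \<bullet> mean f"
  by (simp add: mean_def inner_sum_right)

lemma mean_inner_left: "mean (\<lambda>i. f i \<bullet> v) = mean f \<bullet> v"
  by (simp add: mean_def inner_sum_left)

lemma mean_mono: "(\<And>i. f i \<le> f' i) \<Longrightarrow> mean f \<le> mean f'" for f :: "'n::finite \<Rightarrow> real"
  by (simp add: mean_def sum_mono divide_right_mono)

lemma mean_nonneg: "(\<And>i. 0 \<le> f i) \<Longrightarrow> 0 \<le> mean f" for f :: "'n::finite \<Rightarrow> real"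
  by (simp add: mean_def sum_nonneg)

lemma norm_mean_le:
  fixes f :: "'n::finite \<Rightarrow> 'a::real_inner"
  shows "(norm (mean f))\<^sup>2 \<le> mean (\<lambda>i. (norm (f i))\<^sup>2)"
proof -
  define m where "m = mean f"
  have "0 \<le> mean (\<lambda>i. (norm (f i - m))\<^sup>2)" by (rule mean_nonneg) simp
  also have "(\<lambda>i. (norm (f i - m))\<^sup>2) = (\<lambda>i. (norm (f i))\<^sup>2 - 2 * (f i \<bullet> m) + m \<bullet> m)"
    by (simp add: fun_eq_iff power2_norm_eq_inner inner_diff_left inner_diff_right inner_commute)
  also have "mean \<dots> = mean (\<lambda>i. (norm (f i))\<^sup>2) - m \<bullet> m"
    by (simp only: mean_add mean_diff mean_cmult mean_const mean_inner_left m_def[symmetric])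
  finally show ?thesis by (simp add: m_def power2_norm_eq_inner)
qed

section \<open>One splitting step with sparse projections\<close>

text \<open>The algebraic core of the step inequality.  Here \<open>u\<close> is the residual on the sampled blocks, \<open>u + d\<close>
the step actually taken, and \<open>a - b + p + x\<close> is \<open>\<gamma>\<close> times the error of the gradient estimate: \<open>a\<close> is
the sampling noise, \<open>b\<close> the noise of the memory, \<open>p\<close> the deviation of the true gradient, \<open>x\<close> the
bias.  The term with \<open>5 / 8\<close> has mean zero and the bracket is nonpositive by monotonicity, so both can
be added freely; \<open>5 / 8 = 2 - 2 * 11 / 16\<close> is chosen such that completing the squares in \<open>a\<close>, \<open>b\<close>
and \<open>p\<close> leaves no product of \<open>u\<close> and \<open>d\<close>.  The weights \<open>15 / 4\<close> and \<open>9 / 4\<close> are what \<open>3\<gamma>L \<le> 1\<close>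
affords.\<close>

lemma step_sum_of_squares:
  fixes u d a b p x :: "'a::real_inner"
  shows "0 \<le> (u + d) \<bullet> (u + d) + 2 * ((u + d) \<bullet> (a - b + p + x)) + 15 / 4 * (a \<bullet> a + p \<bullet> p)
    + 9 / 4 * (b \<bullet> b) - 1 / 10 * (u \<bullet> u) + (d \<bullet> d + d \<bullet> (a - b + x)) - 5 / 8 * (u \<bullet> (a - b))
    + 30 * (x \<bullet> x)" (is "0 \<le> ?Q")
proof -
  define m where "m = (11 / 16) *\<^sub>R u + (3 / 2) *\<^sub>R d"
  have "?Q = 1 / 60 * ((15 *\<^sub>R a + 4 *\<^sub>R m) \<bullet> (15 *\<^sub>R a + 4 *\<^sub>R m))
      + 1 / 36 * ((9 *\<^sub>R b - 4 *\<^sub>R m) \<bullet> (9 *\<^sub>R b - 4 *\<^sub>R m))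
      + 1 / 60 * ((15 *\<^sub>R p + 4 *\<^sub>R (u + d)) \<bullet> (15 *\<^sub>R p + 4 *\<^sub>R (u + d)))
      + 1 / 4 * ((u + 4 *\<^sub>R x) \<bullet> (u + 4 *\<^sub>R x))
      + 1 / 120 * ((4 *\<^sub>R d + 45 *\<^sub>R x) \<bullet> (4 *\<^sub>R d + 45 *\<^sub>R x))
      + 17 / 360 * (u \<bullet> u) + 73 / 8 * (x \<bullet> x)"
    by (simp add: m_def inner_add_left inner_add_right inner_diff_left inner_diff_right inner_commute)
      (simp add: field_simps)
  also have "0 \<le> \<dots>"
    by (intro add_nonneg_nonneg mult_nonneg_nonneg inner_ge_zero) auto
  finally show ?thesis .
qed

text \<open>What the block structure means for the sampling, free of coordinates: \<open>D\<close> reweights the projections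
\<open>P\<^sub>i\<close> to the identity on average.\<close>

locale sparse_projections =
  fixes P :: "'n::finite \<Rightarrow> 'a::real_inner \<Rightarrow> 'a" and D W :: "'a \<Rightarrow> 'a" and d\<^sub>m :: real
  assumes P_linear: "linear (P i)" and P_idem: "P i (P i x) = P i x"
    and P_symmetric: "P i x \<bullet> y = x \<bullet> P i y"
    and D_linear: "linear D" and P_D_commute: "P i (D x) = D (P i x)"
    and D_symmetric: "D x \<bullet> y = x \<bullet> D y"
    and D_lower: "x \<bullet> x \<le> x \<bullet> D x" and D_upper: "x \<bullet> D x \<le> d\<^sub>m * (x \<bullet> x)"
    and mean_P: "mean (\<lambda>i. P i x) = W x"
    and W_D: "W (D x) = x" and D_W: "D (W x) = x"
begin

lemma masked_inner: "P i x = x \<Longrightarrow> P i y \<bullet> x = y \<bullet> x"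
  by (simp add: P_symmetric)

lemma mean_P_inner: "mean (\<lambda>i. P i x \<bullet> y) = W x \<bullet> y"
  by (simp add: mean_inner_left mean_P)

lemma mean_P_norm: "mean (\<lambda>i. P i x \<bullet> P i x) = x \<bullet> W x"
  by (simp add: P_symmetric P_idem mean_inner_right mean_P)

lemma mean_centered: "mean (\<lambda>i. f i - P i (D (mean f))) = 0"
  by (simp add: mean_diff mean_P W_D)

text \<open>Variance is at most the second moment, where \<open>P\<^sub>i D\<close> applied to the average plays the role of the
mean.\<close>

lemma mean_norm_centered_le:
  assumes "\<And>i. P i (f i) = f i"
  shows "mean (\<lambda>i. (f i - P i (D (mean f))) \<bullet> (f i - P i (D (mean f)))) \<le> mean (\<lambda>i. f i \<bullet> f i)"
proof -
  let ?k = "D (mean f)"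
  have "(f i - P i ?k) \<bullet> (f i - P i ?k) = f i \<bullet> f i - 2 * (f i \<bullet> ?k) + P i ?k \<bullet> P i ?k" for i
    using masked_inner[OF assms[of i], of ?k]
    by (simp add: inner_diff_left inner_diff_right inner_commute)
  then have "mean (\<lambda>i. (f i - P i ?k) \<bullet> (f i - P i ?k))
      = mean (\<lambda>i. f i \<bullet> f i) - 2 * (mean f \<bullet> ?k) + ?k \<bullet> W ?k"
    by (simp add: mean_add mean_diff mean_cmult mean_inner_left mean_P_norm)
  also have "\<dots> = mean (\<lambda>i. f i \<bullet> f i) - mean f \<bullet> D (mean f)"
    by (simp add: W_D inner_commute)
  finally show ?thesis
    using D_lower[of "mean f"] inner_ge_zero[of "mean f"] by linarith
qed

text \<open>Pythagoras: the centered family is orthogonal on average to every family \<open>P\<^sub>i w\<close> with fixed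
\<open>w\<close>.\<close>

lemma mean_norm_split:
  assumes "\<And>i. P i (f i) = f i"
  shows "mean (\<lambda>i. (f i - P i (D (mean f))) \<bullet> (f i - P i (D (mean f))))
      + mean (\<lambda>i. P i (D (mean f + v)) \<bullet> P i (D (mean f + v)))
    = mean (\<lambda>i. (f i + P i (D v)) \<bullet> (f i + P i (D v)))"
proof -
  let ?c = "\<lambda>i. f i - P i (D (mean f))" and ?k = "D (mean f + v)"
  have c: "P i (?c i) = ?c i" for i
    by (simp add: linear_diff[OF P_linear] assms P_idem)
  have "(f i + P i (D v)) = ?c i + P i ?k" for i
    by (simp add: linear_add[OF P_linear] linear_add[OF D_linear])
  then have "(f i + P i (D v)) \<bullet> (f i + P i (D v)) = ?c i \<bullet> ?c i + P i ?k \<bullet> P i ?k + 2 * (?c i \<bullet> ?k)" for i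
    using masked_inner[OF c, of i ?k] by (simp only: inner_add_left inner_add_right) (simp add: inner_commute)
  then have "mean (\<lambda>i. (f i + P i (D v)) \<bullet> (f i + P i (D v)))
      = mean (\<lambda>i. ?c i \<bullet> ?c i) + mean (\<lambda>i. P i ?k \<bullet> P i ?k) + 2 * (mean ?c \<bullet> ?k)"
    by (simp only: mean_add mean_cmult mean_inner_left)
  then show ?thesis by (simp add: mean_centered)
qed

text \<open>The Cauchy-Schwarz inequality in the form \<open>(\<surd>(l s) + \<surd>(k s'))\<^sup>2 \<le> (l + k) (s + s')\<close> with \<open>k = d\<^sub>m l'\<close>.  It combines the
smoothness constants of the \<open>\<psi>\<^sub>i\<close> and of \<open>\<omega>\<close> into \<open>L\<^sub>f\<close>.\<close>

lemma mean_norm_sum_le: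
  assumes f: "\<And>i. P i (f i) = f i" and f_le: "mean (\<lambda>i. f i \<bullet> f i) \<le> l * s"
    and v_le: "v \<bullet> v \<le> l' * s'" and l: "0 \<le> l" "0 \<le> l'" and s: "0 \<le> s" "0 \<le> s'"
    and d: "0 < d\<^sub>m"
  shows "mean (\<lambda>i. (f i + P i (D v)) \<bullet> (f i + P i (D v))) \<le> (l + d\<^sub>m * l') * (s + s')"
proof -
  define F where "F = mean (\<lambda>i. f i \<bullet> f i)"
  define Q where "Q = v \<bullet> D v"
  define k where "k = d\<^sub>m * l'"
  have Fl: "F \<le> l * s" and F0: "0 \<le> F" using f_le by (auto simp: F_def mean_nonneg)
  have Q0: "0 \<le> Q" using order_trans[OF inner_ge_zero D_lower] by (simp add: Q_def)
  have Qk: "Q \<le> k * s'"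
    using order_trans[OF D_upper[of v] mult_left_mono[OF v_le, of d\<^sub>m]] d by (simp add: Q_def k_def mult.assoc)
  have k0: "0 \<le> k" using l d by (simp add: k_def)
  have PD: "mean (\<lambda>i. P i (D v) \<bullet> P i (D v)) = Q"
    by (simp add: mean_P_norm W_D Q_def inner_commute)
  let ?M = "mean (\<lambda>i. (f i + P i (D v)) \<bullet> (f i + P i (D v)))"
  have young: "l * k * ?M \<le> (l + k) * (k * F + l * Q)"
  proof -
    have "l * k * ((f i + P i (D v)) \<bullet> (f i + P i (D v)))
        \<le> (l + k) * (k * (f i \<bullet> f i) + l * (P i (D v) \<bullet> P i (D v)))" for i
    proof -
      have "0 \<le> (k *\<^sub>R f i - l *\<^sub>R P i (D v)) \<bullet> (k *\<^sub>R f i - l *\<^sub>R P i (D v))"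
        by (rule inner_ge_zero)
      then show ?thesis
        by (simp add: inner_add_left inner_add_right inner_diff_left inner_diff_right inner_commute algebra_simps)
    qed
    then have "mean (\<lambda>i. l * k * ((f i + P i (D v)) \<bullet> (f i + P i (D v))))
        \<le> mean (\<lambda>i. (l + k) * (k * (f i \<bullet> f i) + l * (P i (D v) \<bullet> P i (D v))))"
      by (rule mean_mono)
    then show ?thesis by (simp only: mean_cmult mean_add PD F_def)
  qed
  have "?M \<le> (l + k) * (s + s')"
  proof -
    consider "l = 0" | "k = 0" | "0 < l" "0 < k" using l(1) k0 by linarith
    then show ?thesis
    proof cases
      case 1
      have "F = 0" using Fl F0 1 by simp
      then have "(\<Sum>i\<in>UNIV. f i \<bullet> f i) = 0" by (simp add: F_def mean_def)
      then have "f i = 0" for i by (simp add: sum_nonneg_eq_0_iff)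
      then have "?M = Q" by (simp add: PD)
      also have "\<dots> \<le> (l + k) * (s + s')"
        using Qk 1 mult_nonneg_nonneg[OF k0 s(1)] by (simp add: distrib_left)
      finally show ?thesis .
    next
      case 2
      have "v \<bullet> v \<le> 0" using Qk 2 D_lower[of v] by (simp add: Q_def)
      then have "v = 0" by (metis antisym inner_ge_zero inner_eq_zero_iff)
      then have "?M = F" by (simp add: F_def linear_0[OF D_linear] linear_0[OF P_linear])
      also have "\<dots> \<le> (l + k) * (s + s')"
        using Fl 2 mult_nonneg_nonneg[OF l(1) s(2)] by (simp add: distrib_left)
      finally show ?thesis .
    next
      case 3
      have "k * F + l * Q \<le> k * (l * s) + l * (k * s')"
        using 3 Fl Qk by (intro add_mono mult_left_mono) auto
      then have "(l + k) * (k * F + l * Q) \<le> (l + k) * (k * (l * s) + l * (k * s'))"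
        using 3 by (intro mult_left_mono) auto
      with young have "(l * k) * ?M \<le> (l * k) * ((l + k) * (s + s'))"
        by (simp add: algebra_simps)
      moreover have "0 < l * k" using 3 by simp
      ultimately show ?thesis by (rule mult_left_le_imp_le)
    qed
  qed
  then show ?thesis by (simp add: k_def)
qed

text \<open>In the algorithm \<open>a = y - y\<^sub>s\<close>, \<open>z\<close> is the difference of the \<open>h\<close>-proximal points, \<open>u\<close> the residual, \<open>\<delta>\<^sub>i\<close>
the deviation of the stochastic proximal point from the exact one, \<open>p\<^sub>i\<close> and \<open>v\<close> are differences of
the gradients of \<open>\<psi>\<^sub>i\<close> and \<open>\<omega>\<close>, \<open>c\<^sub>i\<close> is the error of the memory, \<open>\<xi>\<close> the bias, and \<open>e\<^sub>i\<close> the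
error of the gradient estimate.  Monotonicity of the subdifferential of \<open>g\<close> against the fixed point
bounds the new distance for each \<open>i\<close>; the sum of squares absorbs the cross terms; averaging removes
the noise and makes \<open>W\<close> appear, so that monotonicity of the subdifferential of \<open>h\<close> applies.  Since
\<open>3\<gamma>L \<le> 1\<close>, the three multiples \<open>5/4\<close>, \<open>3/4\<close> and \<open>-2\<close> of \<open>\<gamma> \<langle>z, mean p + v\<rangle>\<close> cancel.\<close>

lemma mean_step_bound:
  fixes u z a \<xi> v :: 'a and p c \<delta> e :: "'n \<Rightarrow> 'a" and \<gamma> L :: real
  assumes masked: "\<And>i. P i (p i) = p i" "\<And>i. P i (c i) = c i" "\<And>i. P i (\<delta> i) = \<delta> i"
    and e: "\<And>i. e i = p i - c i + P i (D (mean c + v + \<xi>))"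
    and mono_g: "\<And>i. 0 \<le> (P i u + \<delta> i + P i z) \<bullet> (z - a - (P i u + \<delta> i) - \<gamma> *\<^sub>R e i)"
    and mono_g': "\<And>i. 0 \<le> \<delta> i \<bullet> (- (\<gamma> *\<^sub>R (e i - P i (D (mean p + v)))) - \<delta> i)"
    and mono_h: "0 \<le> W z \<bullet> (a - z)"
    and smooth: "mean (\<lambda>i. p i \<bullet> p i) \<le> L * (z \<bullet> (mean p + v))"
      "mean (\<lambda>i. (p i + P i (D v)) \<bullet> (p i + P i (D v))) \<le> L * (z \<bullet> (mean p + v))"
    and L: "0 < L" and \<gamma>: "0 < \<gamma>" "\<gamma> \<le> 1 / (3 * L)"
  shows "mean (\<lambda>i. (norm (a + (P i u + \<delta> i)))\<^sup>2)
      + 3 * \<gamma> / (4 * L) * (mean (\<lambda>i. p i \<bullet> p i) - mean (\<lambda>i. c i \<bullet> c i)) + 1 / 10 * (u \<bullet> W u)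
    \<le> (norm a)\<^sup>2 + 2 * \<gamma> * norm z * norm \<xi> + 30 * \<gamma>\<^sup>2 * (\<xi> \<bullet> D \<xi>)"
proof -
  define S where "S = z \<bullet> (mean p + v)"
  define A where "A i = \<gamma> *\<^sub>R (p i - P i (D (mean p)))" for i
  define B where "B i = \<gamma> *\<^sub>R (c i - P i (D (mean c)))" for i
  define F where "F i = \<gamma> *\<^sub>R P i (D (mean p + v))" for i
  define X where "X i = \<gamma> *\<^sub>R P i (D \<xi>)" for i
  define w where "w i = P i u + \<delta> i" for i
  note P_simps = linear_add[OF P_linear] linear_diff[OF P_linear] linear_scale[OF P_linear]
    linear_add[OF D_linear] P_idem masked
  have e_split: "\<gamma> *\<^sub>R e i = A i - B i + F i + X i" for i
    by (simp add: e A_def B_def F_def X_def P_simps algebra_simps)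
  have e_masked: "P i (e i) = e i" and w_masked: "P i (w i) = w i" for i
    by (simp_all add: e w_def P_simps)
  have AB_masked: "P i (A i - B i) = A i - B i" for i
    by (simp add: A_def B_def P_simps)
  have step: "(norm (a + w i))\<^sup>2 \<le> (norm a)\<^sup>2 + 15 / 4 * (A i \<bullet> A i + F i \<bullet> F i) + 9 / 4 * (B i \<bullet> B i)
      - 1 / 10 * (P i u \<bullet> P i u) - 5 / 8 * (u \<bullet> (A i - B i)) + 30 * (X i \<bullet> X i)
      - 2 * \<gamma> * (z \<bullet> e i) + 2 * (P i z \<bullet> z - P i z \<bullet> a)" for i
  proof -
    have "P i u \<bullet> (A i - B i) = u \<bullet> (A i - B i)" by (rule masked_inner[OF AB_masked])
    then have sos: "- (w i \<bullet> w i) - 2 * (w i \<bullet> (\<gamma> *\<^sub>R e i)) \<le> 15 / 4 * (A i \<bullet> A i + F i \<bullet> F i) + 9 / 4 * (B i \<bullet> B i)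
      - 1 / 10 * (P i u \<bullet> P i u) + (\<delta> i \<bullet> \<delta> i + \<delta> i \<bullet> (A i - B i + X i)) - 5 / 8 * (u \<bullet> (A i - B i)) + 30 * (X i \<bullet> X i)"
      using step_sum_of_squares[of "P i u" "\<delta> i" "A i" "B i" "F i" "X i"]
      unfolding e_split by (simp add: w_def)
    have "- (\<gamma> *\<^sub>R (e i - P i (D (mean p + v)))) = - (A i - B i + X i)"
      using e_split[of i] by (simp add: F_def scaleR_diff_right)
    with mono_g'[of i] have "\<delta> i \<bullet> \<delta> i + \<delta> i \<bullet> (A i - B i + X i) \<le> 0"
      by (simp add: inner_diff_right inner_add_right)
    moreover have "0 \<le> (w i + P i z) \<bullet> (z - a - w i - \<gamma> *\<^sub>R e i)"
      using mono_g[of i] by (simp add: w_def)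
    then have "0 \<le> w i \<bullet> z - w i \<bullet> a - w i \<bullet> w i - w i \<bullet> (\<gamma> *\<^sub>R e i) + P i z \<bullet> z - P i z \<bullet> a
        - P i z \<bullet> w i - \<gamma> * (P i z \<bullet> e i)"
      by (simp only: inner_add_left inner_diff_right inner_scaleR_right) (simp add: algebra_simps)
    then have "0 \<le> - (w i \<bullet> a) - w i \<bullet> w i - w i \<bullet> (\<gamma> *\<^sub>R e i) + P i z \<bullet> z - P i z \<bullet> a - \<gamma> * (z \<bullet> e i)"
      using masked_inner[OF w_masked, of i z] masked_inner[OF e_masked, of i z] by (simp add: inner_commute)
    moreover have "(norm (a + w i))\<^sup>2 = (norm a)\<^sup>2 + 2 * (w i \<bullet> a) + w i \<bullet> w i"
      by (simp add: power2_norm_eq_inner inner_add_left inner_add_right inner_commute)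
    ultimately show ?thesis using sos by simp
  qed
  have meanA: "mean A = 0" and meanB: "mean B = 0"
    using mean_linear[OF linear_scaleR, of \<gamma> "\<lambda>i. p i - P i (D (mean p))"]
      mean_linear[OF linear_scaleR, of \<gamma> "\<lambda>i. c i - P i (D (mean c))"]
    by (simp_all add: A_def[abs_def] B_def[abs_def] mean_centered)
  have "mean (\<lambda>i. (norm (a + w i))\<^sup>2) \<le> (norm a)\<^sup>2 + 15 / 4 * (mean (\<lambda>i. A i \<bullet> A i) + mean (\<lambda>i. F i \<bullet> F i))
      + 9 / 4 * mean (\<lambda>i. B i \<bullet> B i) - 1 / 10 * (u \<bullet> W u) - 5 / 8 * (u \<bullet> (mean A - mean B))
      + 30 * mean (\<lambda>i. X i \<bullet> X i) - 2 * \<gamma> * (z \<bullet> mean e) + 2 * (W z \<bullet> z - W z \<bullet> a)"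
    using mean_mono[of "\<lambda>i. (norm (a + w i))\<^sup>2", OF step]
    by (simp only: mean_add mean_diff mean_cmult mean_const mean_inner_right mean_P_norm mean_P_inner)
  moreover have "mean e = mean p + v + \<xi>"
    unfolding e[abs_def] by (simp add: mean_add mean_diff mean_P W_D)
  then have "z \<bullet> mean e = S + z \<bullet> \<xi>" by (simp add: S_def inner_add_right)
  moreover have "mean (\<lambda>i. A i \<bullet> A i) + mean (\<lambda>i. F i \<bullet> F i)
      = \<gamma>\<^sup>2 * mean (\<lambda>i. (p i + P i (D v)) \<bullet> (p i + P i (D v)))"
    unfolding mean_norm_split[OF masked(1), of v, symmetric]
    by (simp add: A_def F_def mean_cmult power2_eq_square mult.assoc distrib_left)
  moreover have "mean (\<lambda>i. B i \<bullet> B i) \<le> \<gamma>\<^sup>2 * mean (\<lambda>i. c i \<bullet> c i)"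
    using mult_left_mono[OF mean_norm_centered_le[OF masked(2)], of "\<gamma>\<^sup>2"]
    by (simp add: B_def mean_cmult power2_eq_square mult.assoc)
  moreover have "mean (\<lambda>i. X i \<bullet> X i) = \<gamma>\<^sup>2 * (\<xi> \<bullet> D \<xi>)"
    by (simp add: X_def mean_cmult mean_P_norm W_D power2_eq_square mult.assoc inner_commute)
  moreover have "W z \<bullet> z - W z \<bullet> a \<le> 0" using mono_h by (simp add: inner_diff_right)
  ultimately have main: "mean (\<lambda>i. (norm (a + w i))\<^sup>2) \<le> (norm a)\<^sup>2
      + 15 / 4 * (\<gamma>\<^sup>2 * mean (\<lambda>i. (p i + P i (D v)) \<bullet> (p i + P i (D v))))
      + 9 / 4 * (\<gamma>\<^sup>2 * mean (\<lambda>i. c i \<bullet> c i)) - 1 / 10 * (u \<bullet> W u)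
      + 30 * (\<gamma>\<^sup>2 * (\<xi> \<bullet> D \<xi>)) - 2 * \<gamma> * (S + z \<bullet> \<xi>)"
    by (simp add: meanA meanB)
  have \<gamma>L: "3 * (\<gamma> * L) \<le> 1" using \<gamma>(2) L by (simp add: field_simps)
  have S0: "0 \<le> S"
    using order_trans[OF mean_nonneg smooth(1)] L by (simp add: S_def zero_le_mult_iff)
  have "\<gamma>\<^sup>2 * mean (\<lambda>i. (p i + P i (D v)) \<bullet> (p i + P i (D v))) \<le> \<gamma>\<^sup>2 * (L * S)"
    using smooth(2) by (simp add: S_def mult_left_mono)
  also have "\<dots> = (\<gamma> * S) * (\<gamma> * L)" by (simp add: power2_eq_square)
  also have "\<dots> \<le> (\<gamma> * S) * (1 / 3)" using \<gamma>L \<gamma> S0 by (intro mult_left_mono) auto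
  finally have t1: "\<gamma>\<^sup>2 * mean (\<lambda>i. (p i + P i (D v)) \<bullet> (p i + P i (D v))) \<le> \<gamma> * S / 3" by simp
  have "9 / 4 * \<gamma>\<^sup>2 \<le> 3 * \<gamma> / (4 * L)"
  proof -
    have "9 / 4 * \<gamma>\<^sup>2 = 9 * \<gamma> / 4 * \<gamma>" by (simp add: power2_eq_square)
    also have "\<dots> \<le> 9 * \<gamma> / 4 * (1 / (3 * L))" using \<gamma> by (intro mult_left_mono) auto
    finally show ?thesis using L by (simp add: field_simps)
  qed
  then have "9 / 4 * \<gamma>\<^sup>2 * mean (\<lambda>i. c i \<bullet> c i) \<le> 3 * \<gamma> / (4 * L) * mean (\<lambda>i. c i \<bullet> c i)"
    by (intro mult_right_mono mean_nonneg) auto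
  then have t2: "9 / 4 * (\<gamma>\<^sup>2 * mean (\<lambda>i. c i \<bullet> c i)) \<le> 3 * \<gamma> / (4 * L) * mean (\<lambda>i. c i \<bullet> c i)"
    by (simp add: mult.assoc)
  have "3 * \<gamma> / (4 * L) * mean (\<lambda>i. p i \<bullet> p i) \<le> 3 * \<gamma> / (4 * L) * (L * S)"
    using smooth(1) \<gamma> L by (intro mult_left_mono) (auto simp: S_def)
  then have t3: "3 * \<gamma> / (4 * L) * mean (\<lambda>i. p i \<bullet> p i) \<le> 3 / 4 * (\<gamma> * S)"
    using L by simp
  have "\<bar>z \<bullet> \<xi>\<bar> \<le> norm z * norm \<xi>" by (rule Cauchy_Schwarz_ineq2)
  then have "- (z \<bullet> \<xi>) \<le> norm z * norm \<xi>" by linarith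
  then have "\<gamma> * (- (z \<bullet> \<xi>)) \<le> \<gamma> * (norm z * norm \<xi>)" using \<gamma> by (intro mult_left_mono) auto
  then have t4: "- 2 * \<gamma> * (z \<bullet> \<xi>) \<le> 2 * \<gamma> * norm z * norm \<xi>" by (simp add: mult_ac)
  show ?thesis
    using main t1 t2 t3 t4 unfolding w_def by (simp add: algebra_simps)
qed

end

section \<open>Blocks and block weights\<close>

lemma partition_block:
  assumes "partition_on UNIV \<B>"
  shows "(THE B. B \<in> \<B> \<and> j \<in> B) \<in> \<B>" "j \<in> (THE B. B \<in> \<B> \<and> j \<in> B)"
    and "B \<in> \<B> \<Longrightarrow> j \<in> B \<longleftrightarrow> B = (THE B. B \<in> \<B> \<and> j \<in> B)"
proof -
  have ex1: "\<exists>!B. B \<in> \<B> \<and> j \<in> B"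
  proof -
    have "j \<in> \<Union> \<B>" using partition_onD1[OF assms] by blast
    moreover have "B = C" if "B \<in> \<B>" "C \<in> \<B>" "j \<in> B" "j \<in> C" for B C
      using partition_onD2[OF assms] that unfolding disjoint_def by blast
    ultimately show ?thesis by blast
  qed
  note th = theI'[OF ex1] the1_equality[OF ex1]
  from th(1) show "(THE B. B \<in> \<B> \<and> j \<in> B) \<in> \<B>" "j \<in> (THE B. B \<in> \<B> \<and> j \<in> B)" by auto
  then show "B \<in> \<B> \<Longrightarrow> j \<in> B \<longleftrightarrow> B = (THE B. B \<in> \<B> \<and> j \<in> B)"
    using th(2)[of B] by auto
qed

text \<open>Exchanging the coordinates of one block between two points redistributes the summands but keeps
their total.\<close>

lemma block_separable_swap:
  assumes part: "partition_on UNIV \<B>" and sep: "block_separable \<B> F" and B: "B \<in> \<B>"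
  shows "F (\<chi> j. if j \<in> B then x' $ j else x $ j) + F (\<chi> j. if j \<in> B then x $ j else x' $ j)
    = F x + F x'"
proof -
  obtain F\<^sub>B where F: "\<And>x. F x = (\<Sum>B\<in>\<B>. F\<^sub>B B (block_restrict x B))"
    using sep unfolding block_separable_def by blast
  have "block_restrict (\<chi> j. if j \<in> B then a $ j else b $ j) C
      = block_restrict (if C = B then a else b) C" if "C \<in> \<B>" for a b :: "real ^ 'a" and C
  proof -
    have "C = B \<or> C \<inter> B = {}" using partition_onD2[OF part] B that by (auto simp: disjoint_def)
    then show ?thesis
    proof
      assume "C \<inter> B = {}"
      then have "j \<notin> B" if "j \<in> C" for j using that by blast
      moreover have "C \<noteq> B" using \<open>C \<inter> B = {}\<close> B partition_onD3[OF part] by auto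
      ultimately show ?thesis by (simp add: block_restrict_def fun_eq_iff restrict_def)
    qed (simp add: block_restrict_def fun_eq_iff restrict_def)
  qed
  then have "F\<^sub>B C (block_restrict (\<chi> j. if j \<in> B then x' $ j else x $ j) C)
      + F\<^sub>B C (block_restrict (\<chi> j. if j \<in> B then x $ j else x' $ j) C)
      = F\<^sub>B C (block_restrict x C) + F\<^sub>B C (block_restrict x' C)" if "C \<in> \<B>" for C
    using that by (cases "C = B") (simp_all add: add.commute)
  then show ?thesis unfolding F sum.distrib[symmetric] by (rule sum.cong[OF refl])
qed

text \<open>The two subgradient inequalities, tested at the points with the block \<open>B\<close> exchanged, add up to
monotonicity on \<open>B\<close> alone, since the function values cancel.\<close>

lemma subgradient_block_monotone:
  fixes \<phi> :: "real ^ 'p::finite \<Rightarrow> ereal"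
  assumes part: "partition_on UNIV \<B>" and sep: "block_separable \<B> \<phi>" and B: "B \<in> \<B>"
    and proper: "proper_fun \<phi>"
    and sub: "subgradient \<phi> x s" "subgradient \<phi> x' s'"
  shows "0 \<le> (\<Sum>j\<in>B. (s - s') $ j * (x - x') $ j)"
proof -
  define w where "w = (\<chi> j. if j \<in> B then x' $ j else x $ j)"
  define w' where "w' = (\<chi> j. if j \<in> B then x $ j else x' $ j)"
  have swap: "\<phi> w + \<phi> w' = \<phi> x + \<phi> x'"
    unfolding w_def w'_def by (rule block_separable_swap[OF part sep B])
  have dom: "x \<in> effective_domain \<phi>" "x' \<in> effective_domain \<phi>"
    using sub by (simp_all add: subgradient_on_def)
  then have "\<phi> x + \<phi> x' < \<infinity>" by (auto simp: effective_domain_def)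
  then have dom': "w \<in> effective_domain \<phi>" "w' \<in> effective_domain \<phi>"
    using proper unfolding swap[symmetric] by (auto simp: effective_domain_def proper_fun_def)
  have sum: "real_of_ereal (\<phi> w) + real_of_ereal (\<phi> w') = real_of_ereal (\<phi> x) + real_of_ereal (\<phi> x')"
  proof -
    note real = proper_fun_ereal_real[OF proper]
    have "ereal (real_of_ereal (\<phi> w) + real_of_ereal (\<phi> w')) = ereal (real_of_ereal (\<phi> x) + real_of_ereal (\<phi> x'))"
      unfolding plus_ereal.simps(1)[symmetric] real[OF dom(1)] real[OF dom(2)] real[OF dom'(1)] real[OF dom'(2)]
      by (rule swap)
    then show ?thesis by simp
  qed
  have "w - x = - (\<chi> j. if j \<in> B then (x - x') $ j else 0)" "w' - x' = (\<chi> j. if j \<in> B then (x - x') $ j else 0)"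
    by (auto simp: w_def w'_def vec_eq_iff)
  moreover have "real_of_ereal (\<phi> x) + s \<bullet> (w - x) \<le> real_of_ereal (\<phi> w)"
    "real_of_ereal (\<phi> x') + s' \<bullet> (w' - x') \<le> real_of_ereal (\<phi> w')"
    using sub dom' by (auto simp: subgradient_on_def)
  ultimately have "0 \<le> (s - s') \<bullet> (\<chi> j. if j \<in> B then (x - x') $ j else 0)"
    using sum by (simp add: inner_diff_left)
  also have "\<dots> = (\<Sum>j\<in>UNIV. if j \<in> B then (s - s') $ j * (x - x') $ j else 0)"
    by (auto simp: inner_vec_def intro!: sum.cong)
  also have "\<dots> = (\<Sum>j\<in>B. (s - s') $ j * (x - x') $ j)"
    by (subst sum.inter_restrict[symmetric]) auto
  finally show ?thesis .
qed

lemma diagonal_component: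
  fixes f :: "'p::finite \<Rightarrow> real"
  shows "((\<chi> j k. if j = k then f j else 0) *v x) $ j = f j * x $ j"
proof -
  have "((\<chi> j k. if j = k then f j else 0) *v x) $ j = (\<Sum>k\<in>UNIV. (if j = k then f j else 0) * x $ k)"
    by (simp add: matrix_vector_mult_def)
  also have "\<dots> = (\<Sum>k\<in>UNIV. if j = k then f j * x $ j else 0)"
    by (rule sum.cong) auto
  finally show ?thesis by simp
qed

lemma block_proj_component:
  "(block_proj \<B> \<phi> *v x) $ j = (if j \<in> \<Union> (ext_support \<B> \<phi>) then x $ j else 0)"
proof -
  have "block_proj \<B> \<phi> = (\<chi> j k. if j = k then (if j \<in> \<Union> (ext_support \<B> \<phi>) then 1 else 0) else 0)"
    unfolding block_proj_def by (rule arg_cong[where f = vec_lambda] ext)+ auto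
  then show ?thesis by (simp only: diagonal_component) simp
qed

lemma matrix_inv_diagonal:
  fixes f :: "'p::finite \<Rightarrow> real"
  assumes "\<And>j. f j \<noteq> 0"
  shows "matrix_inv (\<chi> j k. if j = k then f j else 0) = (\<chi> j k. if j = k then 1 / f j else 0)" (is "matrix_inv ?A = ?B")
proof -
  have mult: "(\<chi> j k. if j = k then a j else 0) ** (\<chi> j k. if j = k then b j else 0) = mat 1"
    if "\<And>j. a j * b j = 1" for a b :: "'p \<Rightarrow> real"
  proof (subst matrix_eq, rule allI)
    fix x :: "real ^ 'p"
    show "((\<chi> j k. if j = k then a j else 0) ** (\<chi> j k. if j = k then b j else 0)) *v x = mat 1 *v x"
      unfolding matrix_vector_mul_assoc[symmetric] matrix_vector_mul_lid
      by (rule iffD2[OF vec_eq_iff], rule allI)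
        (simp only: diagonal_component mult.assoc[symmetric] that mult_1_left)
  qed
  have AB: "?A ** ?B = mat 1" and BA: "?B ** ?A = mat 1"
    using assms by (auto intro!: mult)
  then have "?A ** matrix_inv ?A = mat 1 \<and> matrix_inv ?A ** ?A = mat 1"
    unfolding matrix_inv_def by (rule_tac someI[of "\<lambda>B. ?A ** B = mat 1 \<and> B ** ?A = mat 1" ?B]) (rule conjI)
  then have "?B ** (?A ** matrix_inv ?A) = ?B ** mat 1" by (rule arg_cong[OF conjunct1])
  then show ?thesis unfolding matrix_mul_assoc BA matrix_mul_lid matrix_mul_rid .
qed

locale block_structure =
  fixes \<B> :: "'p::finite set set" and \<psi> :: "'n::finite \<Rightarrow> real ^ 'p \<Rightarrow> real"
  assumes blocks: "partition_on UNIV \<B>"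
    and covered: "\<And>B. B \<in> \<B> \<Longrightarrow> \<exists>i. B \<in> ext_support \<B> (\<psi> i)"
begin

abbreviation blk :: "'p \<Rightarrow> 'p set" where "blk j \<equiv> THE B. B \<in> \<B> \<and> j \<in> B"

abbreviation P :: "'n \<Rightarrow> real ^ 'p \<Rightarrow> real ^ 'p" where "P i x \<equiv> block_proj \<B> (\<psi> i) *v x"

abbreviation D :: "real ^ 'p \<Rightarrow> real ^ 'p" where "D x \<equiv> weight_mat \<B> \<psi> *v x"

abbreviation W :: "real ^ 'p \<Rightarrow> real ^ 'p" where "W x \<equiv> matrix_inv (weight_mat \<B> \<psi>) *v x"

abbreviation d\<^sub>m :: real where "d\<^sub>m \<equiv> d_max \<B> \<psi>"

lemma in_support_iff: "j \<in> \<Union> (ext_support \<B> (\<psi> i)) \<longleftrightarrow> blk j \<in> ext_support \<B> (\<psi> i)"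
  using partition_block(1,2)[OF blocks, of j] partition_block(3)[OF blocks, where j = j]
  by (auto simp: ext_support_def)

lemma P_component: "P i x $ j = (if blk j \<in> ext_support \<B> (\<psi> i) then x $ j else 0)"
  by (simp only: block_proj_component in_support_iff)

lemma D_component: "D x $ j = block_weight \<B> \<psi> (blk j) * x $ j"
  unfolding weight_mat_def by (rule diagonal_component)

lemma block_weight_ge_1:
  assumes "B \<in> \<B>"
  shows "1 \<le> block_weight \<B> \<psi> B"
proof -
  have "{i. B \<in> ext_support \<B> (\<psi> i)} \<noteq> {}" using covered[OF assms] by blast
  then have "0 < card {i. B \<in> ext_support \<B> (\<psi> i)}" by (simp add: card_gt_0_iff)
  moreover have "card {i. B \<in> ext_support \<B> (\<psi> i)} \<le> CARD('n)" by (rule card_mono) auto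
  ultimately show ?thesis by (simp add: block_weight_def)
qed

lemma weight_ge_1: "1 \<le> block_weight \<B> \<psi> (blk j)"
  by (rule block_weight_ge_1[OF partition_block(1)[OF blocks]])

lemma weight_le_d_max: "block_weight \<B> \<psi> (blk j) \<le> d\<^sub>m"
  unfolding d_max_def by (rule Max_ge) (auto simp: weight_mat_def)

lemma d_max_ge_1: "1 \<le> d\<^sub>m"
  using weight_ge_1 weight_le_d_max order_trans by blast

lemma W_component: "W x $ j = x $ j / block_weight \<B> \<psi> (blk j)"
proof -
  have "block_weight \<B> \<psi> (blk j) \<noteq> 0" for j using weight_ge_1[of j] by linarith
  then have "matrix_inv (weight_mat \<B> \<psi>) = (\<chi> j k. if j = k then 1 / block_weight \<B> \<psi> (blk j) else 0)"
    unfolding weight_mat_def by (rule matrix_inv_diagonal)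
  then show ?thesis by (simp add: diagonal_component)
qed

sublocale sparse_projections "\<lambda>i x. P i x" "\<lambda>x. D x" "\<lambda>x. W x" d\<^sub>m
proof
  fix i and x y :: "real ^ 'p"
  show "P i (P i x) = P i x" by (simp add: vec_eq_iff P_component)
  show "P i x \<bullet> y = x \<bullet> P i y" by (auto simp: inner_vec_def P_component intro!: sum.cong)
  show "P i (D x) = D (P i x)" by (simp add: vec_eq_iff P_component D_component)
  show "D x \<bullet> y = x \<bullet> D y" by (auto simp: inner_vec_def D_component intro!: sum.cong)
  show "x \<bullet> x \<le> x \<bullet> D x"
    unfolding inner_vec_def
  proof (rule sum_mono)
    fix j show "x $ j \<bullet> x $ j \<le> x $ j \<bullet> D x $ j"
      using mult_right_mono[OF weight_ge_1[of j], of "x $ j * x $ j"] by (simp add: D_component mult_ac)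
  qed
  show "x \<bullet> D x \<le> d\<^sub>m * (x \<bullet> x)"
    unfolding inner_vec_def sum_distrib_left
  proof (rule sum_mono)
    fix j show "x $ j \<bullet> D x $ j \<le> d\<^sub>m * (x $ j \<bullet> x $ j)"
      using mult_right_mono[OF weight_le_d_max[of j], of "x $ j * x $ j"] by (simp add: D_component mult_ac)
  qed
  have ne: "block_weight \<B> \<psi> (blk j) \<noteq> 0" for j using weight_ge_1[of j] by linarith
  show "W (D x) = x" "D (W x) = x" by (simp_all add: vec_eq_iff W_component D_component ne)
  show "mean (\<lambda>i. P i x) = W x"
  proof (subst vec_eq_iff, rule allI)
    fix j
    have "mean (\<lambda>i. P i x) $ j = (\<Sum>i\<in>UNIV. if blk j \<in> ext_support \<B> (\<psi> i) then x $ j else 0) / real CARD('n)"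
      by (simp add: mean_def P_component)
    also have "(\<Sum>i\<in>UNIV. if blk j \<in> ext_support \<B> (\<psi> i) then x $ j else 0)
        = real (card {i. blk j \<in> ext_support \<B> (\<psi> i)}) * x $ j"
      by (simp add: sum.If_cases)
    finally show "mean (\<lambda>i. P i x) $ j = W x $ j"
      by (simp add: W_component block_weight_def)
  qed
qed (simp_all add: matrix_vector_right_distrib matrix_vector_mult_scaleR)

lemma W_symmetric: "x \<bullet> W y = W x \<bullet> y"
  by (auto simp: inner_vec_def W_component intro!: sum.cong)

lemma norm_sq_le_W: "(norm x)\<^sup>2 \<le> d\<^sub>m * (x \<bullet> W x)"
  unfolding power2_norm_eq_inner inner_vec_def sum_distrib_left
proof (rule sum_mono)
  fix j
  have "1 \<le> d\<^sub>m / block_weight \<B> \<psi> (blk j)"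
    using weight_le_d_max[of j] weight_ge_1[of j] by simp
  from mult_right_mono[OF this, of "x $ j * x $ j"]
  show "x $ j \<bullet> x $ j \<le> d\<^sub>m * (x $ j \<bullet> W x $ j)" by (simp add: W_component mult_ac)
qed

lemma norm_W_le: "norm (W x) \<le> norm x"
  unfolding norm_vec_def
proof (rule L2_set_mono)
  fix j
  show "norm (W x $ j) \<le> norm (x $ j)"
    using weight_ge_1[of j] mult_left_mono[OF weight_ge_1[of j], of "\<bar>x $ j\<bar>"]
    by (simp add: W_component divide_le_eq)
qed simp

text \<open>A crude Lipschitz bound for the \<open>h\<close>-proximal operator in the plain norm.\<close>

lemma norm_le_of_W_monotone:
  assumes "0 \<le> W z \<bullet> (a - z)"
  shows "norm z \<le> d\<^sub>m * norm a"
proof -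
  have "(norm z)\<^sup>2 \<le> d\<^sub>m * (W z \<bullet> z)" using norm_sq_le_W[of z] by (simp add: inner_commute)
  also have "\<dots> \<le> d\<^sub>m * (W z \<bullet> a)"
    using assms d_max_ge_1 by (intro mult_left_mono) (auto simp: inner_diff_right)
  also have "\<dots> \<le> d\<^sub>m * (norm (W z) * norm a)"
    using d_max_ge_1 by (intro mult_left_mono norm_cauchy_schwarz) auto
  also have "\<dots> \<le> d\<^sub>m * (norm z * norm a)"
    using d_max_ge_1 by (intro mult_left_mono mult_right_mono norm_W_le) auto
  finally have "norm z * norm z \<le> norm z * (d\<^sub>m * norm a)" by (simp add: power2_eq_square mult_ac)
  then show ?thesis
    using d_max_ge_1 by (cases "norm z = 0") (auto simp: mult_le_cancel_left)
qed

sublocale prox_weight "matrix_inv (weight_mat \<B> \<psi>)" "1 / d\<^sub>m"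
proof
  show "1 / d\<^sub>m * (norm v)\<^sup>2 \<le> v \<bullet> W v" for v
    using norm_sq_le_W[of v] d_max_ge_1 by (simp add: divide_le_eq mult.commute)
qed (use W_symmetric d_max_ge_1 in auto)

lemma P_gradient: "P i (gradient (\<psi> i) x) = gradient (\<psi> i) x"
proof -
  have "gradient (\<psi> i) x $ j = 0" if "blk j \<notin> ext_support \<B> (\<psi> i)" for j
    using that partition_block(1,2)[OF blocks, of j] by (auto simp: ext_support_def grad_support_def)
  then show ?thesis by (simp add: vec_eq_iff P_component)
qed

text \<open>Within a block the weight is constant, so it can be divided out before summing over the sampled
blocks; this is why the plain inner product appears.\<close>

lemma prox_block_monotone:
  assumes g: "proper_fun g" "lsc_fun g" "convex_fun g" and sep: "block_separable \<B> g" and \<gamma>: "0 < \<gamma>"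
    and x: "x = prox (matrix_inv (weight_mat \<B> \<psi>)) \<gamma> g r" "x' = prox (matrix_inv (weight_mat \<B> \<psi>)) \<gamma> g r'"
  shows "0 \<le> P i (x - x') \<bullet> ((r - x) - (r' - x'))"
proof -
  let ?k = "\<lambda>j. ((r - x) - (r' - x')) $ j * (x - x') $ j"
  have B: "0 \<le> sum ?k B" if B: "B \<in> ext_support \<B> (\<psi> i)" for B
  proof -
    from B have BB: "B \<in> \<B>" by (simp add: ext_support_def)
    have blk: "blk j = B" if "j \<in> B" for j using partition_block(3)[OF blocks BB, where j = j] that by simp
    have "0 \<le> (\<Sum>j\<in>B. ((1 / \<gamma>) *\<^sub>R W (r - x) - (1 / \<gamma>) *\<^sub>R W (r' - x')) $ j * (x - x') $ j)"
      unfolding x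
      by (rule subgradient_block_monotone[OF blocks sep BB g(1)]) (rule prox_subgradient[OF g \<gamma>])+
    also have "\<dots> = (\<Sum>j\<in>B. (1 / (\<gamma> * block_weight \<B> \<psi> B)) * ?k j)"
      by (intro sum.cong refl) (simp add: W_component blk diff_divide_distrib left_diff_distrib mult.commute[of \<gamma>])
    also have "\<dots> = (1 / (\<gamma> * block_weight \<B> \<psi> B)) * sum ?k B"
      by (rule sum_distrib_left[symmetric])
    finally have "0 \<le> (1 / (\<gamma> * block_weight \<B> \<psi> B)) * sum ?k B" .
    moreover have "0 < 1 / (\<gamma> * block_weight \<B> \<psi> B)" using \<gamma> block_weight_ge_1[OF BB] by simp
    ultimately show ?thesis by (simp add: zero_le_mult_iff zero_le_divide_iff)
  qed
  have "P i (x - x') \<bullet> ((r - x) - (r' - x'))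
      = (\<Sum>j\<in>UNIV. if j \<in> \<Union> (ext_support \<B> (\<psi> i)) then ?k j else 0)"
    unfolding inner_vec_def block_proj_component by (auto intro!: sum.cong)
  also have "\<dots> = sum ?k (\<Union> (ext_support \<B> (\<psi> i)))"
    by (subst sum.inter_restrict[symmetric]) auto
  also have "\<dots> = (\<Sum>B\<in>ext_support \<B> (\<psi> i). sum ?k B)"
    using partition_onD2[OF blocks]
    by (subst sum.Union_disjoint) (auto simp: ext_support_def disjoint_def)
  also have "0 \<le> \<dots>" by (rule sum_nonneg[OF B])
  finally show ?thesis .
qed

end

section \<open>Optimality conditions and fixed points\<close>

locale vrtos_problem = block_structure \<B> \<psi>
  for \<B> :: "'p::finite set set" and \<psi> :: "'n::finite \<Rightarrow> real ^ 'p \<Rightarrow> real" +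
  fixes \<omega> :: "real ^ 'p \<Rightarrow> real" and g h :: "real ^ 'p \<Rightarrow> ereal" and L\<^sub>\<psi> L\<^sub>\<omega> \<gamma> :: real
  assumes psi: "\<And>i. convex_on UNIV (\<psi> i)" "\<And>i. smooth_fun L\<^sub>\<psi> (\<psi> i)"
    and omega: "convex_on UNIV \<omega>" "smooth_fun L\<^sub>\<omega> \<omega>"
    and g: "proper_fun g" "lsc_fun g" "convex_fun g"
    and h: "proper_fun h" "lsc_fun h" "convex_fun h"
    and separable: "block_separable \<B> g"
    and gamma: "0 < \<gamma>" "\<gamma> \<le> 1 / (3 * L_f \<B> \<psi> L\<^sub>\<psi> L\<^sub>\<omega>)"
begin

abbreviation L :: real where "L \<equiv> L_f \<B> \<psi> L\<^sub>\<psi> L\<^sub>\<omega>"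

abbreviation prox\<^sub>g :: "real ^ 'p \<Rightarrow> real ^ 'p" where
  "prox\<^sub>g \<equiv> prox (matrix_inv (weight_mat \<B> \<psi>)) \<gamma> g"

abbreviation prox\<^sub>h :: "real ^ 'p \<Rightarrow> real ^ 'p" where
  "prox\<^sub>h \<equiv> prox (matrix_inv (weight_mat \<B> \<psi>)) \<gamma> h"

abbreviation f :: "real ^ 'p \<Rightarrow> real" where "f \<equiv> smooth_part \<psi> \<omega>"

abbreviation g\<^sub>r :: "real ^ 'p \<Rightarrow> real" where "g\<^sub>r x \<equiv> real_of_ereal (g x)"

abbreviation h\<^sub>r :: "real ^ 'p \<Rightarrow> real" where "h\<^sub>r x \<equiv> real_of_ereal (h x)"

abbreviation step where "step \<equiv> vrtos_step \<B> \<psi> \<omega> g h \<gamma>"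

definition residual :: "real ^ 'p \<Rightarrow> real ^ 'p" where
  "residual y = prox\<^sub>g (2 *\<^sub>R prox\<^sub>h y - y - \<gamma> *\<^sub>R D (gradient f (prox\<^sub>h y))) - prox\<^sub>h y"

lemma tos_operator_eq: "tos_operator \<B> \<psi> \<omega> g h \<gamma> y = y + residual y"
  by (simp add: tos_operator_def residual_def Let_def)

text \<open>The constant \<open>L\<close> is positive because otherwise no \<open>\<gamma> > 0\<close> would satisfy \<open>\<gamma> \<le> 1 / (3 * L)\<close>, the
quotient being \<open>0\<close> for \<open>L = 0\<close>.\<close>

lemma L_constants: "0 \<le> L\<^sub>\<psi>" "0 \<le> L\<^sub>\<omega>" "0 < L" "L\<^sub>\<psi> \<le> L" "0 < d\<^sub>m"
proof -
  show 1: "0 \<le> L\<^sub>\<psi>" "0 \<le> L\<^sub>\<omega>"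
    using psi(2)[of undefined] omega(2) by (auto simp: smooth_fun_def lipschitz_on_def)
  show d: "0 < d\<^sub>m" using d_max_ge_1 by simp
  show "L\<^sub>\<psi> \<le> L" using 1 d by (simp add: L_f_def)
  have "0 < 1 / (3 * L)" using gamma by linarith
  then show "0 < L" by simp
qed

lemma differentiable: "\<psi> i differentiable (at x)" "\<omega> differentiable (at x)"
  using psi omega by (auto simp: smooth_fun_def)

lemma GDERIV_smooth_part: "GDERIV f x :> mean (\<lambda>i. gradient (\<psi> i) x) + gradient \<omega> x"
proof -
  have "(\<psi> i has_derivative (\<lambda>h. h \<bullet> gradient (\<psi> i) x)) (at x)" for i
    using GDERIV_gradient[OF differentiable(1)] by (simp add: gderiv_def)
  moreover have "(\<omega> has_derivative (\<lambda>h. h \<bullet> gradient \<omega> x)) (at x)"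
    using GDERIV_gradient[OF differentiable(2)] by (simp add: gderiv_def)
  ultimately have "((\<lambda>x. (1 / real CARD('n)) * (\<Sum>i\<in>UNIV. \<psi> i x) + \<omega> x) has_derivative
      (\<lambda>h. (1 / real CARD('n)) * (\<Sum>i\<in>UNIV. h \<bullet> gradient (\<psi> i) x) + h \<bullet> gradient \<omega> x)) (at x)"
    by (intro has_derivative_add has_derivative_mult_right has_derivative_sum) auto
  moreover have "(1 / real CARD('n)) * (\<Sum>i\<in>UNIV. h \<bullet> gradient (\<psi> i) x) + h \<bullet> gradient \<omega> x
      = h \<bullet> (mean (\<lambda>i. gradient (\<psi> i) x) + gradient \<omega> x)" for h
    by (simp add: mean_def inner_add_right inner_sum_right)
  ultimately show ?thesis by (simp add: gderiv_def smooth_part_def[abs_def])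
qed

lemma gradient_smooth_part: "gradient f x = mean (\<lambda>i. gradient (\<psi> i) x) + gradient \<omega> x"
  by (rule gradient_eqI[OF GDERIV_smooth_part])

lemma bregman_smooth_part: "bregman f x w = mean (\<lambda>i. bregman (\<psi> i) x w) + bregman \<omega> x w"
proof -
  have "mean (\<lambda>i. bregman (\<psi> i) x w)
      = mean (\<lambda>i. \<psi> i w) - mean (\<lambda>i. \<psi> i x) - mean (\<lambda>i. gradient (\<psi> i) x) \<bullet> (w - x)"
    by (simp add: bregman_def mean_diff mean_inner_left)
  moreover have "f x = mean (\<lambda>i. \<psi> i x) + \<omega> x" for x
    by (simp add: smooth_part_def mean_def)
  ultimately show ?thesis
    by (simp add: bregman_def gradient_smooth_part inner_add_left)
qed

context
  fixes x\<^sub>m :: "real ^ 'p"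
  assumes minimizer: "is_arg_min (objective \<psi> \<omega> g h) (\<lambda>_. True) x\<^sub>m"
    and domains: "rel_interior (effective_domain g) \<inter> rel_interior (effective_domain h) \<noteq> {}"
begin

lemma minimizer_real:
  "x\<^sub>m \<in> effective_domain g" "x\<^sub>m \<in> effective_domain h"
  and minimizer_real_le: "w \<in> effective_domain g \<Longrightarrow> w \<in> effective_domain h \<Longrightarrow>
    f x\<^sub>m + g\<^sub>r x\<^sub>m + h\<^sub>r x\<^sub>m \<le> f w + g\<^sub>r w + h\<^sub>r w"
proof -
  have min: "ereal (f x\<^sub>m) + g x\<^sub>m + h x\<^sub>m \<le> ereal (f w) + g w + h w" for w
    using minimizer by (simp add: is_arg_min_def objective_def not_less)
  obtain w0 where w0: "w0 \<in> effective_domain g" "w0 \<in> effective_domain h"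
    using domains rel_interior_subset by blast
  have not_MInf: "g x\<^sub>m \<noteq> -\<infinity>" "h x\<^sub>m \<noteq> -\<infinity>" using g(1) h(1) by (auto simp: proper_fun_def)
  have "ereal (f w0) + g w0 + h w0 < \<infinity>" using w0 by (auto simp: effective_domain_def)
  with min[of w0] have "ereal (f x\<^sub>m) + g x\<^sub>m + h x\<^sub>m < \<infinity>" by (rule le_less_trans)
  with not_MInf show dom: "x\<^sub>m \<in> effective_domain g" "x\<^sub>m \<in> effective_domain h"
    by (auto simp: effective_domain_def)
  assume w: "w \<in> effective_domain g" "w \<in> effective_domain h"
  have "ereal (f x\<^sub>m) + ereal (g\<^sub>r x\<^sub>m) + ereal (h\<^sub>r x\<^sub>m) \<le> ereal (f w) + ereal (g\<^sub>r w) + ereal (h\<^sub>r w)"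
    using min[of w] dom w by (simp only: proper_fun_ereal_real[OF g(1)] proper_fun_ereal_real[OF h(1)])
  then show "f x\<^sub>m + g\<^sub>r x\<^sub>m + h\<^sub>r x\<^sub>m \<le> f w + g\<^sub>r w + h\<^sub>r w" by simp
qed

lemma minimizer_subgradients:
  "\<exists>s. subgradient g x\<^sub>m (s - gradient f x\<^sub>m) \<and> subgradient h x\<^sub>m (- s)"
proof -
  let ?S = "effective_domain g" and ?T = "effective_domain h" and ?v = "gradient f x\<^sub>m"
  have cg: "convex_on ?S g\<^sub>r" and ch: "convex_on ?T h\<^sub>r"
    by (rule convex_on_effective_domain[OF g(1,3)]) (rule convex_on_effective_domain[OF h(1,3)])
  have "convex_on (?S \<inter> ?T) (\<lambda>x. g\<^sub>r x + h\<^sub>r x)"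
  proof (rule convex_on_add)
    have "convex (?S \<inter> ?T)" using cg ch by (simp add: convex_on_def convex_Int)
    then show "convex_on (?S \<inter> ?T) g\<^sub>r" "convex_on (?S \<inter> ?T) h\<^sub>r"
      using cg ch by (auto simp: convex_on_def)
  qed
  moreover have "GDERIV f x\<^sub>m :> ?v"
    using GDERIV_smooth_part[of x\<^sub>m] by (simp only: gradient_smooth_part)
  ultimately have sub: "subgradient_on (?S \<inter> ?T) (\<lambda>x. g\<^sub>r x + h\<^sub>r x) x\<^sub>m (- ?v)"
    using minimizer_real minimizer_real_le by (intro minimizer_subgradient_on) (auto simp: add_ac)
  have "\<exists>s. subgradient_on ?S (\<lambda>x. g\<^sub>r x + ?v \<bullet> x) x\<^sub>m s \<and> subgradient_on ?T h\<^sub>r x\<^sub>m (- s)"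
  proof (rule subgradient_sum_split[OF convex_on_add_linear[OF cg] ch domains minimizer_real(1,2)])
    fix w assume "w \<in> ?S" "w \<in> ?T"
    with sub have "g\<^sub>r x\<^sub>m + h\<^sub>r x\<^sub>m + (- ?v) \<bullet> (w - x\<^sub>m) \<le> g\<^sub>r w + h\<^sub>r w"
      by (auto simp: subgradient_on_def)
    then show "g\<^sub>r x\<^sub>m + ?v \<bullet> x\<^sub>m + h\<^sub>r x\<^sub>m \<le> g\<^sub>r w + ?v \<bullet> w + h\<^sub>r w"
      by (simp add: inner_diff_right)
  qed
  then obtain s where s: "subgradient_on ?S (\<lambda>x. g\<^sub>r x + ?v \<bullet> x) x\<^sub>m s" "subgradient h x\<^sub>m (- s)" by blast
  from s(1) have "subgradient g x\<^sub>m (s - ?v)"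
    by (auto simp: subgradient_on_def inner_diff_left inner_diff_right algebra_simps)
  with s(2) show ?thesis by blast
qed

text \<open>With \<open>s - \<nabla>f\<close> and \<open>- s\<close> the subgradients of \<open>g\<close> and \<open>h\<close> at the minimizer, both proximal steps from
\<open>y = x\<^sub>m - \<gamma> D s\<close> return \<open>x\<^sub>m\<close>.\<close>

lemma fixed_point_exists: "\<exists>y. tos_operator \<B> \<psi> \<omega> g h \<gamma> y = y"
proof -
  obtain s where s: "subgradient g x\<^sub>m (s - gradient f x\<^sub>m)" "subgradient h x\<^sub>m (- s)"
    using minimizer_subgradients by blast
  define y where "y = x\<^sub>m - \<gamma> *\<^sub>R D s"
  note lin = linear_diff[OF matrix_vector_mul_linear] matrix_vector_mult_scaleR W_D
  have yx: "y - x\<^sub>m = \<gamma> *\<^sub>R D (- s)"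
    by (simp add: y_def linear_neg[OF matrix_vector_mul_linear])
  have "(1 / \<gamma>) *\<^sub>R W (y - x\<^sub>m) = - s"
    using gamma unfolding yx by (simp add: lin)
  with s(2) have z: "prox\<^sub>h y = x\<^sub>m"
    by (intro prox_eqI[OF h gamma(1)]) simp
  define r where "r = 2 *\<^sub>R x\<^sub>m - y - \<gamma> *\<^sub>R D (gradient f x\<^sub>m)"
  have rx: "r - x\<^sub>m = \<gamma> *\<^sub>R D (s - gradient f x\<^sub>m)"
    by (simp add: r_def y_def lin scaleR_2 scaleR_diff_right)
  have "(1 / \<gamma>) *\<^sub>R W (r - x\<^sub>m) = s - gradient f x\<^sub>m"
    using gamma unfolding rx by (simp add: lin)
  with s(1) have "prox\<^sub>g r = x\<^sub>m"
    by (intro prox_eqI[OF g gamma(1)]) simp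
  then have "residual y = 0" by (simp add: residual_def z r_def)
  then show ?thesis by (auto simp: tos_operator_eq)
qed

end

end

section \<open>Descent of the Lyapunov function in one step\<close>

locale vrtos_fixed_point = vrtos_problem \<B> \<psi> \<omega> g h L\<^sub>\<psi> L\<^sub>\<omega> \<gamma>
  for \<B> :: "'p::finite set set" and \<psi> :: "'n::finite \<Rightarrow> real ^ 'p \<Rightarrow> real"
    and \<omega> g h L\<^sub>\<psi> L\<^sub>\<omega> \<gamma> +
  fixes y\<^sub>s :: "real ^ 'p"
  assumes fixed: "tos_operator \<B> \<psi> \<omega> g h \<gamma> y\<^sub>s = y\<^sub>s"
begin

abbreviation z\<^sub>s :: "real ^ 'p" where "z\<^sub>s \<equiv> prox\<^sub>h y\<^sub>s"

lemma fixed_prox_g: "prox\<^sub>g (2 *\<^sub>R z\<^sub>s - y\<^sub>s - \<gamma> *\<^sub>R D (gradient f z\<^sub>s)) = z\<^sub>s"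
  using fixed by (simp add: tos_operator_eq residual_def)

lemma fixed_subgradients:
  "\<exists>s. subgradient g z\<^sub>s (s - gradient f z\<^sub>s) \<and> subgradient h z\<^sub>s (- s)"
proof (intro exI conjI)
  let ?s = "(1 / \<gamma>) *\<^sub>R W (z\<^sub>s - y\<^sub>s)"
  note lin = linear_diff[OF matrix_vector_mul_linear] matrix_vector_mult_scaleR W_D
  have "subgradient g z\<^sub>s ((1 / \<gamma>) *\<^sub>R W (2 *\<^sub>R z\<^sub>s - y\<^sub>s - \<gamma> *\<^sub>R D (gradient f z\<^sub>s) - z\<^sub>s))"
    using prox_subgradient[OF g gamma(1), of "2 *\<^sub>R z\<^sub>s - y\<^sub>s - \<gamma> *\<^sub>R D (gradient f z\<^sub>s)"]
    unfolding fixed_prox_g .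
  moreover have "2 *\<^sub>R z\<^sub>s - y\<^sub>s - \<gamma> *\<^sub>R D (gradient f z\<^sub>s) - z\<^sub>s = (z\<^sub>s - y\<^sub>s) - \<gamma> *\<^sub>R D (gradient f z\<^sub>s)"
    by (simp add: scaleR_2)
  then have "(1 / \<gamma>) *\<^sub>R W (2 *\<^sub>R z\<^sub>s - y\<^sub>s - \<gamma> *\<^sub>R D (gradient f z\<^sub>s) - z\<^sub>s) = ?s - gradient f z\<^sub>s"
    using gamma by (simp only: lin scaleR_diff_right) simp
  ultimately show "subgradient g z\<^sub>s (?s - gradient f z\<^sub>s)" by simp
  have "- ?s = (1 / \<gamma>) *\<^sub>R W (y\<^sub>s - z\<^sub>s)" by (simp only: lin scaleR_diff_right) simp
  with prox_subgradient[OF h gamma(1), of y\<^sub>s] show "subgradient h z\<^sub>s (- ?s)" by simp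
qed

text \<open>Adding the subgradient inequalities at \<open>z\<^sub>s\<close>, minimality of \<open>x\<^sub>m\<close> forces the Bregman distance of \<open>f\<close>
between the two points to vanish, hence that of each \<open>\<psi>\<^sub>i\<close>, which dominates the difference of the
gradients.\<close>

lemma gradient_at_minimizer:
  assumes minimizer: "is_arg_min (objective \<psi> \<omega> g h) (\<lambda>_. True) x\<^sub>m"
    and domains: "rel_interior (effective_domain g) \<inter> rel_interior (effective_domain h) \<noteq> {}"
  shows "gradient (\<psi> i) x\<^sub>m = gradient (\<psi> i) z\<^sub>s"
proof -
  note min = minimizer_real[OF minimizer domains] minimizer_real_le[OF minimizer domains]
  obtain s where s: "subgradient g z\<^sub>s (s - gradient f z\<^sub>s)" "subgradient h z\<^sub>s (- s)"
    using fixed_subgradients by blast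
  then have "z\<^sub>s \<in> effective_domain g" "z\<^sub>s \<in> effective_domain h"
    and sub: "g\<^sub>r z\<^sub>s + (s - gradient f z\<^sub>s) \<bullet> (x\<^sub>m - z\<^sub>s) \<le> g\<^sub>r x\<^sub>m" "h\<^sub>r z\<^sub>s + (- s) \<bullet> (x\<^sub>m - z\<^sub>s) \<le> h\<^sub>r x\<^sub>m"
    using min(1,2) by (auto simp: subgradient_on_def)
  with min(3)[of z\<^sub>s] have "bregman f z\<^sub>s x\<^sub>m \<le> 0"
    by (simp add: bregman_def inner_diff_left)
  then have le: "mean (\<lambda>i. bregman (\<psi> i) z\<^sub>s x\<^sub>m) + bregman \<omega> z\<^sub>s x\<^sub>m \<le> 0"
    by (simp add: bregman_smooth_part)
  have nonneg: "0 \<le> bregman (\<psi> i) z\<^sub>s x\<^sub>m" "0 \<le> bregman \<omega> z\<^sub>s x\<^sub>m" for i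
    by (rule bregman_nonneg[OF psi(1) differentiable(1)] bregman_nonneg[OF omega(1) differentiable(2)])+
  have "mean (\<lambda>i. bregman (\<psi> i) z\<^sub>s x\<^sub>m) = 0"
    using le nonneg mean_nonneg[of "\<lambda>i. bregman (\<psi> i) z\<^sub>s x\<^sub>m"] by (meson add_nonneg_eq_0_iff antisym add_nonneg_nonneg)
  then have "(\<Sum>i\<in>UNIV. bregman (\<psi> i) z\<^sub>s x\<^sub>m) = 0" by (simp add: mean_def)
  then have "bregman (\<psi> i) z\<^sub>s x\<^sub>m = 0" using nonneg by (simp add: sum_nonneg_eq_0_iff)
  with norm_gradient_diff_le_bregman[OF psi(1) psi(2), of i x\<^sub>m z\<^sub>s] show ?thesis by simp
qed

definition gradient_error :: "real ^ 'p \<Rightarrow> 'n \<Rightarrow> real" where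
  "gradient_error y i = (norm (gradient (\<psi> i) (prox\<^sub>h y) - gradient (\<psi> i) z\<^sub>s))\<^sup>2"

text \<open>Only the part of \<open>\<alpha>\<^sub>i\<close> inside the support of its gradient is compared; the rest is the bias.\<close>

definition memory_error :: "real ^ 'p ^ 'n \<Rightarrow> 'n \<Rightarrow> real" where
  "memory_error \<alpha> i = (norm (P i (\<alpha> $ i) - gradient (\<psi> i) z\<^sub>s))\<^sup>2"

definition bias_error :: "real ^ 'p ^ 'n \<Rightarrow> 'n \<Rightarrow> real" where
  "bias_error \<alpha> i = (norm (\<alpha> $ i - P i (\<alpha> $ i)))\<^sup>2"

text \<open>The conditional mean of the gradient estimate exceeds the true gradient by this vector.\<close>

definition bias :: "real ^ 'p ^ 'n \<Rightarrow> real ^ 'p" where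
  "bias \<alpha> = mean (\<lambda>i. \<alpha> $ i - P i (\<alpha> $ i))"

lemma norm_bias_le: "(norm (bias \<alpha>))\<^sup>2 \<le> mean (bias_error \<alpha>)"
proof -
  show ?thesis
    unfolding bias_def bias_error_def[abs_def] by (rule norm_mean_le)
qed

lemma memory_error_step:
  "memory_error (snd (step i J (y, \<alpha>))) j = (if j \<in> J then gradient_error y j else memory_error \<alpha> j)"
  by (simp add: vrtos_step_def Let_def memory_error_def gradient_error_def P_gradient)

lemma bias_error_step:
  "bias_error (snd (step i J (y, \<alpha>))) j = (if j \<in> J then 0 else bias_error \<alpha> j)"
  by (simp add: vrtos_step_def Let_def bias_error_def P_gradient)

text \<open>The instance of \<open>mean_step_bound\<close> for one iteration.  The new \<open>y\<close> does not depend on the memorized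
indices, so \<open>J\<close> is arbitrary.\<close>

lemma mean_step:
  "mean (\<lambda>i. (norm (fst (step i (J i) (y, \<alpha>)) - y\<^sub>s))\<^sup>2)
      + 3 * \<gamma> / (4 * L) * (mean (gradient_error y) - mean (memory_error \<alpha>))
      + 1 / 10 * (residual y \<bullet> W (residual y))
    \<le> (norm (y - y\<^sub>s))\<^sup>2 + 2 * \<gamma> * d\<^sub>m * norm (y - y\<^sub>s) * norm (bias \<alpha>)
      + 30 * \<gamma>\<^sup>2 * d\<^sub>m * (norm (bias \<alpha>))\<^sup>2"
proof -
  define z where "z = prox\<^sub>h y"
  define v where "v i = P i (gradient (\<psi> i) z - \<alpha> $ i + D (mean (\<lambda>i. \<alpha> $ i) + gradient \<omega> z))" for i
  define x where "x i = prox\<^sub>g (2 *\<^sub>R z - y - \<gamma> *\<^sub>R v i)" for i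
  define x' where "x' = prox\<^sub>g (2 *\<^sub>R z - y - \<gamma> *\<^sub>R D (gradient f z))"
  define p where "p i = gradient (\<psi> i) z - gradient (\<psi> i) z\<^sub>s" for i
  define c where "c i = P i (\<alpha> $ i) - gradient (\<psi> i) z\<^sub>s" for i
  define \<delta> where "\<delta> i = P i (x i - x')" for i
  define o' where "o' = gradient \<omega> z - gradient \<omega> z\<^sub>s"
  define e where "e i = v i - P i (D (gradient f z\<^sub>s))" for i
  define a where "a = y - y\<^sub>s"
  have u: "residual y = x' - z" by (simp add: residual_def x'_def z_def)
  have y_next: "fst (step i (J i) (y, \<alpha>)) = y + P i (x i - z)" for i
    by (simp add: vrtos_step_def Let_def x_def v_def z_def mean_def)
  note P_simps = linear_diff[OF P_linear] linear_add[OF P_linear] linear_scale[OF P_linear]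
    linear_diff[OF D_linear] linear_add[OF D_linear] P_idem P_gradient
  have masked: "P i (p i) = p i" "P i (c i) = c i" "P i (\<delta> i) = \<delta> i" for i
    by (simp_all only: p_def c_def \<delta>_def P_simps)
  have grad_diff: "gradient f z - gradient f z\<^sub>s = mean p + o'"
    by (simp add: gradient_smooth_part p_def[abs_def] o'_def mean_diff)
  have mean_memory: "mean (\<lambda>i. \<alpha> $ i) + gradient \<omega> z = gradient f z\<^sub>s + (mean c + o' + bias \<alpha>)"
    by (simp add: gradient_smooth_part c_def[abs_def] o'_def bias_def mean_diff)
  have e: "e i = p i - c i + P i (D (mean c + o' + bias \<alpha>))" for i
    unfolding e_def v_def mean_memory by (simp only: P_simps p_def c_def) simp
  have e': "e i - P i (D (mean p + o')) = v i - P i (D (gradient f z))" for i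
    unfolding e_def grad_diff[symmetric] by (simp only: P_simps) simp
  have v_masked: "P i (v i) = v i" for i by (simp add: v_def P_idem)
  \<comment> \<open>only the sampled coordinates of the second factor matter\<close>
  have masked_cong: "P i (x - x') \<bullet> b = P i (x - x') \<bullet> b'" if "P i b = P i b'" for i x x' b b'
  proof -
    have "P i (x - x') \<bullet> b = P i (P i (x - x')) \<bullet> b" for b by (simp only: P_idem)
    then have "P i (x - x') \<bullet> b = P i (x - x') \<bullet> P i b" for b by (simp only: P_symmetric[of i "P i (x - x')"])
    from this[of b] this[of b'] that show ?thesis by simp
  qed
  let ?S = "z - z\<^sub>s"
  have w: "P i (x' - z) + \<delta> i = P i (x i - z)" for i
    by (simp only: \<delta>_def P_simps) simp
  have mono_g: "0 \<le> (P i (x' - z) + \<delta> i + P i ?S) \<bullet> (?S - a - (P i (x' - z) + \<delta> i) - \<gamma> *\<^sub>R e i)" for i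
  proof -
    have "0 \<le> P i (x i - z\<^sub>s) \<bullet> ((2 *\<^sub>R z - y - \<gamma> *\<^sub>R v i - x i)
        - (2 *\<^sub>R z\<^sub>s - y\<^sub>s - \<gamma> *\<^sub>R D (gradient f z\<^sub>s) - z\<^sub>s))"
      by (rule prox_block_monotone[OF g separable gamma(1) x_def fixed_prox_g[symmetric]])
    also have "\<dots> = P i (x i - z\<^sub>s) \<bullet> (?S - a - P i (x i - z) - \<gamma> *\<^sub>R e i)"
      by (rule masked_cong) (simp only: e_def a_def P_simps v_masked scaleR_diff_right scaleR_2, simp)
    also have "P i (x i - z\<^sub>s) = P i (x i - z) + P i ?S" by (simp only: P_simps) simp
    finally show ?thesis unfolding w .
  qed
  have mono_g': "0 \<le> \<delta> i \<bullet> (- (\<gamma> *\<^sub>R (e i - P i (D (mean p + o')))) - \<delta> i)" for i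
  proof -
    have "0 \<le> P i (x i - x') \<bullet> ((2 *\<^sub>R z - y - \<gamma> *\<^sub>R v i - x i)
        - (2 *\<^sub>R z - y - \<gamma> *\<^sub>R D (gradient f z) - x'))"
      by (rule prox_block_monotone[OF g separable gamma(1) x_def x'_def])
    also have "\<dots> = P i (x i - x') \<bullet> (- (\<gamma> *\<^sub>R (v i - P i (D (gradient f z)))) - \<delta> i)"
      by (rule masked_cong) (simp only: \<delta>_def P_simps v_masked scaleR_diff_right scaleR_2 linear_neg[OF P_linear], simp)
    finally show ?thesis unfolding e' \<delta>_def .
  qed
  have mono_h: "0 \<le> W ?S \<bullet> (a - ?S)"
  proof -
    have "0 \<le> ((1 / \<gamma>) *\<^sub>R W (y - z) - (1 / \<gamma>) *\<^sub>R W (y\<^sub>s - z\<^sub>s)) \<bullet> (z - z\<^sub>s)"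
      unfolding z_def by (rule subgradient_on_monotone; rule prox_subgradient[OF h gamma(1)])
    also have "\<dots> = (1 / \<gamma>) * (W (a - ?S) \<bullet> ?S)"
    proof -
      have "(y - z) - (y\<^sub>s - z\<^sub>s) = a - ?S" by (simp add: a_def)
      then show ?thesis
        by (simp only: scaleR_diff_right[symmetric] matrix_vector_mult_diff_distrib[symmetric] inner_scaleR_left)
    qed
    finally show ?thesis
      using gamma(1) W_symmetric[of ?S "a - ?S"] by (simp add: zero_le_divide_iff inner_commute)
  qed
  have s: "0 \<le> ?S \<bullet> p i" "p i \<bullet> p i \<le> L\<^sub>\<psi> * (?S \<bullet> p i)" for i
  proof -
    show "0 \<le> ?S \<bullet> p i"
      using bregman_symmetrized[of "\<psi> i" z\<^sub>s z]
        bregman_nonneg[OF psi(1) differentiable(1), of i z\<^sub>s z] bregman_nonneg[OF psi(1) differentiable(1), of i z z\<^sub>s]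
      by (simp add: p_def inner_commute)
    show "p i \<bullet> p i \<le> L\<^sub>\<psi> * (?S \<bullet> p i)"
      using gradient_cocoercive[OF psi(1) psi(2), of i z z\<^sub>s]
      by (simp add: p_def inner_commute power2_norm_eq_inner)
  qed
  have s': "0 \<le> ?S \<bullet> o'" "o' \<bullet> o' \<le> L\<^sub>\<omega> * (?S \<bullet> o')"
    using bregman_symmetrized[of \<omega> z\<^sub>s z] gradient_cocoercive[OF omega, of z z\<^sub>s]
      bregman_nonneg[OF omega(1) differentiable(2), of z\<^sub>s z] bregman_nonneg[OF omega(1) differentiable(2), of z z\<^sub>s]
    by (simp_all add: o'_def inner_commute power2_norm_eq_inner)
  have S0: "0 \<le> ?S \<bullet> mean p"
    using mean_nonneg[of "\<lambda>i. ?S \<bullet> p i"] s(1) by (simp add: mean_inner_right)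
  have p_le: "mean (\<lambda>i. p i \<bullet> p i) \<le> L\<^sub>\<psi> * (?S \<bullet> mean p)"
    using mean_mono[of "\<lambda>i. p i \<bullet> p i", OF s(2)] by (simp only: mean_cmult mean_inner_right)
  have "L\<^sub>\<psi> * (?S \<bullet> mean p) \<le> L * (?S \<bullet> (mean p + o'))"
    using S0 s'(1) L_constants by (intro mult_mono) (auto simp: inner_add_right)
  with p_le have smooth1: "mean (\<lambda>i. p i \<bullet> p i) \<le> L * (?S \<bullet> (mean p + o'))" by simp
  have smooth2: "mean (\<lambda>i. (p i + P i (D o')) \<bullet> (p i + P i (D o'))) \<le> L * (?S \<bullet> (mean p + o'))"
    using mean_norm_sum_le[OF masked(1) p_le s'(2) L_constants(1,2) S0 s'(1) L_constants(5)]
    by (simp add: L_f_def inner_add_right)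
  have "mean (\<lambda>i. (norm (a + (P i (x' - z) + \<delta> i)))\<^sup>2)
      + 3 * \<gamma> / (4 * L) * (mean (\<lambda>i. p i \<bullet> p i) - mean (\<lambda>i. c i \<bullet> c i)) + 1 / 10 * ((x' - z) \<bullet> W (x' - z))
    \<le> (norm a)\<^sup>2 + 2 * \<gamma> * norm ?S * norm (bias \<alpha>) + 30 * \<gamma>\<^sup>2 * (bias \<alpha> \<bullet> D (bias \<alpha>))"
    by (rule mean_step_bound[OF masked e mono_g mono_g' mono_h smooth1 smooth2 L_constants(3) gamma])
  moreover have "a + (P i (x' - z) + \<delta> i) = fst (step i (J i) (y, \<alpha>)) - y\<^sub>s" for i
    unfolding w y_next a_def by simp
  moreover have "(\<lambda>i. p i \<bullet> p i) = gradient_error y" "(\<lambda>i. c i \<bullet> c i) = memory_error \<alpha>"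
    by (simp_all add: fun_eq_iff p_def c_def gradient_error_def memory_error_def z_def power2_norm_eq_inner)
  moreover have "2 * \<gamma> * norm ?S * norm (bias \<alpha>) \<le> 2 * \<gamma> * d\<^sub>m * norm a * norm (bias \<alpha>)"
    using mult_left_mono[OF norm_le_of_W_monotone[OF mono_h], of "2 * \<gamma>"] gamma(1)
    by (intro mult_right_mono) (auto simp: mult.assoc)
  moreover have "30 * \<gamma>\<^sup>2 * (bias \<alpha> \<bullet> D (bias \<alpha>)) \<le> 30 * \<gamma>\<^sup>2 * d\<^sub>m * (norm (bias \<alpha>))\<^sup>2"
    using mult_left_mono[OF D_upper[of "bias \<alpha>"], of "30 * \<gamma>\<^sup>2"] by (simp add: power2_norm_eq_inner mult.assoc)
  ultimately show ?thesis unfolding u a_def by simp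
qed

end

section \<open>Conditioning on the past\<close>

locale random_choices = prob_space M for M :: "'s measure" +
  fixes I :: "nat \<Rightarrow> 's \<Rightarrow> 'n::finite" and J :: "nat \<Rightarrow> 's \<Rightarrow> 'n set" and q :: real
  assumes sampling: "uniform_sampling M I J"
    and memorization: "uniform_memorization M I J q"
begin

lemma measurable_choices [measurable]:
  "I t \<in> measurable M (count_space UNIV)" "J t \<in> measurable M (count_space UNIV)"
  using sampling memorization by (auto simp: uniform_sampling_def uniform_memorization_def)

lemma history_Suc: "history I J (Suc t) \<xi> = history I J t \<xi> @ [(I t \<xi>, J t \<xi>)]"
  by (simp add: history_def)

lemma measurable_history [measurable]: "history I J t \<in> measurable M (count_space UNIV)"
proof (induction t)
  case 0
  show ?case by (simp add: history_def[abs_def])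
next
  case (Suc t)
  have "(\<lambda>\<xi>. l @ [(I t \<xi>, J t \<xi>)]) \<in> measurable M (count_space UNIV)" for l
  proof (rule measurable_compose_countable[OF _ measurable_choices(1)])
    fix i
    show "(\<lambda>\<xi>. l @ [(i, J t \<xi>)]) \<in> measurable M (count_space UNIV)"
      by (rule measurable_compose_countable[OF _ measurable_choices(2)]) simp
  qed
  then have "(\<lambda>\<xi>. history I J t \<xi> @ [(I t \<xi>, J t \<xi>)]) \<in> measurable M (count_space UNIV)"
    by (rule measurable_compose_countable[OF _ Suc])
  then show ?case by (simp add: history_Suc[abs_def])
qed

text \<open>The history up to time \<open>t\<close> takes finitely many values, so every function of it is bounded.\<close>

lemma integrable_history: "integrable M (\<lambda>\<xi>. F (history I J t \<xi>))" for F :: "_ \<Rightarrow> real"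
proof (rule integrable_const_bound)
  let ?A = "{l :: ('n \<times> 'n set) list. length l = t}"
  have fin: "finite ?A" using finite_lists_length_eq[of "UNIV :: ('n \<times> 'n set) set" t] by simp
  have "history I J t \<xi> \<in> ?A" for \<xi> by (simp add: history_def)
  then show "AE \<xi> in M. norm (F (history I J t \<xi>)) \<le> Max ((\<lambda>l. norm (F l)) ` ?A)"
    using fin by (intro AE_I2 Max_ge) auto
  show "(\<lambda>\<xi>. F (history I J t \<xi>)) \<in> borel_measurable M"
    by (rule measurable_compose[OF measurable_history]) simp
qed

lemma integrable_history_choices:
  "integrable M (\<lambda>\<xi>. F (history I J t \<xi>) (I t \<xi>) (J t \<xi>))" for F :: "_ \<Rightarrow> _ \<Rightarrow> _ \<Rightarrow> real"
  using integrable_history[of "\<lambda>l. F (butlast l) (fst (last l)) (snd (last l))" "Suc t"]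
  by (simp add: history_Suc)

lemma indep_index_history:
  fixes X :: "'n \<Rightarrow> real" and Y :: "('n \<times> 'n set) list \<Rightarrow> real"
  shows "indep_var borel (\<lambda>\<xi>. X (I t \<xi>)) borel (\<lambda>\<xi>. Y (history I J t \<xi>))"
proof -
  let ?\<sigma> = "\<lambda>Z. sigma_sets (space M) {Z -` A \<inter> space M | A. A \<in> UNIV}"
  have gen: "sigma_sets (space M) {(\<lambda>\<xi>. f (Z \<xi>)) -` A \<inter> space M | A. A \<in> sets borel} \<subseteq> ?\<sigma> Z"
    for f :: "'b \<Rightarrow> real" and Z :: "'s \<Rightarrow> 'b"
  proof (rule sigma_sets_mono')
    have "(\<lambda>\<xi>. f (Z \<xi>)) -` A = Z -` (f -` A)" for A by auto
    then show "{(\<lambda>\<xi>. f (Z \<xi>)) -` A \<inter> space M | A. A \<in> sets borel} \<subseteq> {Z -` A \<inter> space M | A. A \<in> UNIV}"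
      by blast
  qed
  have "indep_set (?\<sigma> (I t)) (?\<sigma> (history I J t))"
    using sampling unfolding uniform_sampling_def past_def by (simp add: sets_vimage_algebra)
  then have "indep_set (sigma_sets (space M) {(\<lambda>\<xi>. X (I t \<xi>)) -` A \<inter> space M | A. A \<in> sets borel})
      (sigma_sets (space M) {(\<lambda>\<xi>. Y (history I J t \<xi>)) -` A \<inter> space M | A. A \<in> sets borel})"
    using gen[of X "I t"] gen[of Y "history I J t"] unfolding indep_sets2_eq by blast
  moreover have "(\<lambda>\<xi>. X (I t \<xi>)) \<in> borel_measurable M" "(\<lambda>\<xi>. Y (history I J t \<xi>)) \<in> borel_measurable M"
    by (rule measurable_compose[OF measurable_choices(1)], simp)
      (rule measurable_compose[OF measurable_history], simp)
  ultimately show ?thesis by (simp only: indep_var_eq)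
qed

text \<open>Independence of the sampled index from the past, in the form in which it is used: the index may be
averaged out under the expectation.\<close>

lemma expectation_index:
  fixes F :: "_ \<Rightarrow> 'n \<Rightarrow> real"
  shows "(\<integral>\<xi>. F (history I J t \<xi>) (I t \<xi>) \<partial>M) = (\<integral>\<xi>. mean (F (history I J t \<xi>)) \<partial>M)"
proof -
  have prod: "(\<integral>\<xi>. (indicator {i} (I t \<xi>) :: real) * F (history I J t \<xi>) i \<partial>M)
      = 1 / real CARD('n) * (\<integral>\<xi>. F (history I J t \<xi>) i \<partial>M)" for i
  proof -
    have "(\<integral>\<xi>. (indicator {i} (I t \<xi>) :: real) * F (history I J t \<xi>) i \<partial>M)
        = (\<integral>\<xi>. (indicator {i} (I t \<xi>) :: real) \<partial>M) * (\<integral>\<xi>. F (history I J t \<xi>) i \<partial>M)"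
      by (rule indep_var_lebesgue_integral[OF indep_index_history[of "indicator {i}" t "\<lambda>l. F l i"]])
        (rule integrable_history_choices[of "\<lambda>_ k _. indicator {i} k" t], rule integrable_history[of "\<lambda>l. F l i" t])
    also have "(\<integral>\<xi>. (indicator {i} (I t \<xi>) :: real) \<partial>M) = (\<integral>\<xi>. indicator {\<xi> \<in> space M. I t \<xi> = i} \<xi> \<partial>M)"
      by (rule Bochner_Integration.integral_cong) (auto split: split_indicator)
    also have "\<dots> = measure M {\<xi> \<in> space M. I t \<xi> = i}" by simp
    also have "\<dots> = 1 / real CARD('n)" using sampling by (simp add: uniform_sampling_def)
    finally show ?thesis .
  qed
  have split: "F l k = (\<Sum>i\<in>UNIV. indicator {i} k * F l i)" for l k
    by (simp add: indicator_def)
  have "(\<integral>\<xi>. F (history I J t \<xi>) (I t \<xi>) \<partial>M)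
      = (\<integral>\<xi>. (\<Sum>i\<in>UNIV. indicator {i} (I t \<xi>) * F (history I J t \<xi>) i) \<partial>M)"
    by (rule Bochner_Integration.integral_cong[OF refl]) (rule split)
  also have "\<dots> = (\<Sum>i\<in>UNIV. \<integral>\<xi>. indicator {i} (I t \<xi>) * F (history I J t \<xi>) i \<partial>M)"
    by (rule Bochner_Integration.integral_sum)
      (rule integrable_history_choices[of "\<lambda>l k _. indicator {i} k * F l i" t for i])
  also have "\<dots> = 1 / real CARD('n) * (\<Sum>i\<in>UNIV. \<integral>\<xi>. F (history I J t \<xi>) i \<partial>M)"
    by (simp only: prod sum_distrib_left)
  also have "\<dots> = (\<integral>\<xi>. 1 / real CARD('n) * (\<Sum>i\<in>UNIV. F (history I J t \<xi>) i) \<partial>M)"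
    by (simp add: Bochner_Integration.integral_sum[OF integrable_history[of "\<lambda>l. F l i" t for i]])
  finally show ?thesis by (simp add: mean_def)
qed

lemma expectation_memorized:
  fixes F :: "_ \<Rightarrow> real"
  shows "(\<integral>\<xi>. F (history I J t \<xi>) * indicator (J t \<xi>) j \<partial>M)
    = q / real CARD('n) * (\<integral>\<xi>. F (history I J t \<xi>) \<partial>M)"
proof -
  have sub: "subalgebra M (past M I J t)"
    unfolding subalgebra_def past_def
    by (intro conjI sets_image_in_sets[OF refl measurable_history]) simp
  interpret finite_measure_subalgebra M "past M I J t"
    by unfold_locales (rule sub)
  let ?ce = "real_cond_exp M (past M I J t) (\<lambda>\<xi>. indicator (J t \<xi>) j)"
  have meas: "(\<lambda>\<xi>. F (history I J t \<xi>)) \<in> borel_measurable (past M I J t)"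
    unfolding past_def by (rule measurable_compose[OF measurable_vimage_algebra1]) auto
  have ind: "(\<lambda>\<xi>. indicator (J t \<xi>) j :: real) \<in> borel_measurable M"
    by (rule measurable_compose[OF measurable_choices(2)]) simp
  have "(\<integral>\<xi>. F (history I J t \<xi>) * indicator (J t \<xi>) j \<partial>M) = (\<integral>\<xi>. F (history I J t \<xi>) * ?ce \<xi> \<partial>M)"
    by (rule real_cond_exp_intg(2)[symmetric, OF _ meas ind])
      (rule integrable_history_choices[of "\<lambda>l _ K. F l * indicator K j" t])
  also have "\<dots> = (\<integral>\<xi>. F (history I J t \<xi>) * (q / real CARD('n)) \<partial>M)"
  proof (rule integral_cong_AE)
    have "AE \<xi> in M. ?ce \<xi> = q / real CARD('n)"
      using memorization by (simp add: uniform_memorization_def)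
    then show "AE \<xi> in M. F (history I J t \<xi>) * ?ce \<xi> = F (history I J t \<xi>) * (q / real CARD('n))"
      by eventually_elim simp
  qed (use integrable_history[of F t] in \<open>auto intro!: borel_measurable_times borel_measurable_cond_exp2\<close>)
  finally show ?thesis by (simp add: mult.commute)
qed

lemma expectation_square_le:
  fixes X :: "'s \<Rightarrow> real"
  assumes "integrable M X" "integrable M (\<lambda>\<xi>. (X \<xi>)\<^sup>2)"
  shows "(\<integral>\<xi>. X \<xi> \<partial>M)\<^sup>2 \<le> (\<integral>\<xi>. (X \<xi>)\<^sup>2 \<partial>M)"
  using variance_positive[of X] variance_eq[OF assms] by simp

end

section \<open>Convergence of the expected residual\<close>

text \<open>The products \<open>\<Prod> (1 + \<epsilon>\<^sub>k)\<close> are bounded by \<open>exp (\<Sum> \<epsilon>\<^sub>k)\<close>.\<close>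

lemma discrete_gronwall:
  fixes v R \<epsilon> :: "nat \<Rightarrow> real"
  assumes step: "\<And>t. v (Suc t) + R t \<le> (1 + \<epsilon> t) * v t"
    and R: "\<And>t. 0 \<le> R t" and \<epsilon>: "\<And>t. 0 \<le> \<epsilon> t" and v: "0 \<le> v 0"
  shows "v t + (\<Sum>k<t. R k) \<le> v 0 * exp (\<Sum>k<t. \<epsilon> k)"
proof (induction t)
  case (Suc t)
  have S: "0 \<le> (\<Sum>k<t. R k)" using R by (simp add: sum_nonneg)
  have "v (Suc t) + (\<Sum>k<Suc t. R k) \<le> (1 + \<epsilon> t) * v t + (\<Sum>k<t. R k)"
    using step[of t] by simp
  also have "\<dots> \<le> (1 + \<epsilon> t) * (v t + (\<Sum>k<t. R k))"
    using \<epsilon>[of t] S by (simp add: algebra_simps)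
  also have "\<dots> \<le> (1 + \<epsilon> t) * (v 0 * exp (\<Sum>k<t. \<epsilon> k))"
    using Suc \<epsilon>[of t] by (intro mult_left_mono) auto
  also have "\<dots> \<le> exp (\<epsilon> t) * (v 0 * exp (\<Sum>k<t. \<epsilon> k))"
    using v by (intro mult_right_mono) auto
  also have "\<dots> = v 0 * exp (\<Sum>k<Suc t. \<epsilon> k)" by (simp add: exp_add)
  finally show ?case .
qed simp

lemma vrtos_cong:
  assumes "\<And>s. s < t \<Longrightarrow> I s = I' s \<and> J s = J' s"
  shows "vrtos \<B> \<psi> \<omega> g h \<gamma> y\<^sub>0 \<alpha>\<^sub>0 I J t = vrtos \<B> \<psi> \<omega> g h \<gamma> y\<^sub>0 \<alpha>\<^sub>0 I' J' t"
  using assms by (induction t) auto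

locale vrtos_random =
  vrtos_fixed_point \<B> \<psi> \<omega> g h L\<^sub>\<psi> L\<^sub>\<omega> \<gamma> y\<^sub>s + random_choices M I J q
  for \<B> :: "'p::finite set set" and \<psi> :: "'n::finite \<Rightarrow> real ^ 'p \<Rightarrow> real"
    and \<omega> g h L\<^sub>\<psi> L\<^sub>\<omega> \<gamma> y\<^sub>s and M :: "'s measure" and I :: "nat \<Rightarrow> 's \<Rightarrow> 'n" and J q +
  fixes y\<^sub>0 :: "real ^ 'p" and \<alpha>\<^sub>0 :: "real ^ 'p ^ 'n"
  assumes q_pos: "0 < q"
begin

definition state :: "nat \<Rightarrow> 's \<Rightarrow> (real ^ 'p) \<times> (real ^ 'p ^ 'n)" where
  "state t \<xi> = vrtos \<B> \<psi> \<omega> g h \<gamma> y\<^sub>0 \<alpha>\<^sub>0 (\<lambda>s. I s \<xi>) (\<lambda>s. J s \<xi>) t"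

lemma state_0: "state 0 \<xi> = (y\<^sub>0, \<alpha>\<^sub>0)"
  by (simp add: state_def)

lemma state_Suc: "state (Suc t) \<xi> = step (I t \<xi>) (J t \<xi>) (state t \<xi>)"
  by (simp add: state_def)

text \<open>This makes conditioning on the past applicable to every function of the state.\<close>

lemma state_of_history: "\<exists>S. \<forall>\<xi>. state t \<xi> = S (history I J t \<xi>)"
proof (rule exI, rule allI)
  fix \<xi>
  show "state t \<xi> = (\<lambda>l. vrtos \<B> \<psi> \<omega> g h \<gamma> y\<^sub>0 \<alpha>\<^sub>0 (\<lambda>s. fst (l ! s)) (\<lambda>s. snd (l ! s)) t) (history I J t \<xi>)"
    unfolding state_def by (rule vrtos_cong) (simp add: history_def)
qed

lemma integrable_state: "integrable M (\<lambda>\<xi>. F (state t \<xi>))" for F :: "_ \<Rightarrow> real"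
proof -
  obtain S where "\<And>\<xi>. state t \<xi> = S (history I J t \<xi>)" using state_of_history by blast
  then show ?thesis using integrable_history[of "\<lambda>l. F (S l)" t] by simp
qed

lemma integrable_state_memorized: "integrable M (\<lambda>\<xi>. F (state t \<xi>) * indicator (J t \<xi>) j)" for F :: "_ \<Rightarrow> real"
proof -
  obtain S where "\<And>\<xi>. state t \<xi> = S (history I J t \<xi>)" using state_of_history by blast
  then show ?thesis using integrable_history_choices[of "\<lambda>l _ K. F (S l) * indicator K j" t] by simp
qed

lemma expectation_state_index:
  "(\<integral>\<xi>. F (state t \<xi>) (I t \<xi>) \<partial>M) = (\<integral>\<xi>. mean (F (state t \<xi>)) \<partial>M)" for F :: "_ \<Rightarrow> _ \<Rightarrow> real"
proof -
  obtain S where "\<And>\<xi>. state t \<xi> = S (history I J t \<xi>)" using state_of_history by blast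
  then show ?thesis using expectation_index[of "\<lambda>l. F (S l)" t] by simp
qed

lemma expectation_state_memorized:
  "(\<integral>\<xi>. F (state t \<xi>) * indicator (J t \<xi>) j \<partial>M) = q / real CARD('n) * (\<integral>\<xi>. F (state t \<xi>) \<partial>M)"
  for F :: "_ \<Rightarrow> real"
proof -
  obtain S where "\<And>\<xi>. state t \<xi> = S (history I J t \<xi>)" using state_of_history by blast
  then show ?thesis using expectation_memorized[of "\<lambda>l. F (S l)" t j] by simp
qed

lemma expectation_memory_update:
  fixes A B :: "(real ^ 'p) \<times> (real ^ 'p ^ 'n) \<Rightarrow> 'n \<Rightarrow> real"
  shows "(\<integral>\<xi>. mean (\<lambda>j. if j \<in> J t \<xi> then A (state t \<xi>) j else B (state t \<xi>) j) \<partial>M)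
    = (1 - q / real CARD('n)) * (\<integral>\<xi>. mean (B (state t \<xi>)) \<partial>M)
      + q / real CARD('n) * (\<integral>\<xi>. mean (A (state t \<xi>)) \<partial>M)"
proof -
  let ?r = "q / real CARD('n)"
  have one: "(\<integral>\<xi>. (if j \<in> J t \<xi> then A (state t \<xi>) j else B (state t \<xi>) j) \<partial>M)
      = (1 - ?r) * (\<integral>\<xi>. B (state t \<xi>) j \<partial>M) + ?r * (\<integral>\<xi>. A (state t \<xi>) j \<partial>M)"
    and int: "integrable M (\<lambda>\<xi>. if j \<in> J t \<xi> then A (state t \<xi>) j else B (state t \<xi>) j)" for j
  proof -
    note iB = integrable_state[of "\<lambda>s. B s j" t] and iA = integrable_state[of "\<lambda>s. A s j" t]
      and iM = integrable_state_memorized[of "\<lambda>s. A s j - B s j" t j]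
    have split: "(\<lambda>\<xi>. if j \<in> J t \<xi> then A (state t \<xi>) j else B (state t \<xi>) j)
        = (\<lambda>\<xi>. B (state t \<xi>) j + (A (state t \<xi>) j - B (state t \<xi>) j) * indicator (J t \<xi>) j)"
      by (auto simp: fun_eq_iff)
    show "integrable M (\<lambda>\<xi>. if j \<in> J t \<xi> then A (state t \<xi>) j else B (state t \<xi>) j)"
      unfolding split by (rule Bochner_Integration.integrable_add[OF iB iM])
    have "(\<integral>\<xi>. (if j \<in> J t \<xi> then A (state t \<xi>) j else B (state t \<xi>) j) \<partial>M)
        = (\<integral>\<xi>. B (state t \<xi>) j \<partial>M) + ?r * ((\<integral>\<xi>. A (state t \<xi>) j \<partial>M) - (\<integral>\<xi>. B (state t \<xi>) j \<partial>M))"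
      unfolding split Bochner_Integration.integral_add[OF iB iM]
        expectation_state_memorized[of "\<lambda>s. A s j - B s j" t j] Bochner_Integration.integral_diff[OF iA iB] ..
    then show "(\<integral>\<xi>. (if j \<in> J t \<xi> then A (state t \<xi>) j else B (state t \<xi>) j) \<partial>M)
      = (1 - ?r) * (\<integral>\<xi>. B (state t \<xi>) j \<partial>M) + ?r * (\<integral>\<xi>. A (state t \<xi>) j \<partial>M)"
      by (simp add: algebra_simps)
  qed
  have mean_int: "(\<integral>\<xi>. mean (F \<xi>) \<partial>M) = mean (\<lambda>j. \<integral>\<xi>. F \<xi> j \<partial>M)"
    if "\<And>j. integrable M (\<lambda>\<xi>. F \<xi> j)" for F :: "'s \<Rightarrow> 'n \<Rightarrow> real"
    using that by (simp add: mean_def Bochner_Integration.integral_sum)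
  show ?thesis
    unfolding mean_int[OF int] mean_int[OF integrable_state[of "\<lambda>s. A s j" t for j]]
      mean_int[OF integrable_state[of "\<lambda>s. B s j" t for j]] one
    by (simp only: mean_add mean_cmult)
qed

text \<open>The weight of the memory error is such that the expected change of the memory in one step, a fraction
\<open>q / n\<close> of the difference between new and old error, contributes exactly the corresponding term of
\<open>mean_step\<close>.\<close>

definition lyapunov :: "nat \<Rightarrow> real" where
  "lyapunov t = (\<integral>\<xi>. (norm (fst (state t \<xi>) - y\<^sub>s))\<^sup>2 \<partial>M)
    + 3 * \<gamma> * real CARD('n) / (4 * L * q) * (\<integral>\<xi>. mean (memory_error (snd (state t \<xi>))) \<partial>M)"

definition residual_energy :: "nat \<Rightarrow> real" where
  "residual_energy t = (\<integral>\<xi>. residual (fst (state t \<xi>)) \<bullet> W (residual (fst (state t \<xi>))) \<partial>M)"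

definition bias_energy :: "nat \<Rightarrow> real" where
  "bias_energy t = (\<integral>\<xi>. mean (bias_error (snd (state t \<xi>))) \<partial>M)"

definition bias_term :: "(real ^ 'p) \<times> (real ^ 'p ^ 'n) \<Rightarrow> real" where
  "bias_term s = 2 * \<gamma> * d\<^sub>m * norm (fst s - y\<^sub>s) * norm (bias (snd s)) + 30 * \<gamma>\<^sup>2 * d\<^sub>m * (norm (bias (snd s)))\<^sup>2"

lemma lyapunov_step:
  "lyapunov (Suc t) + residual_energy t / 10 \<le> lyapunov t + (\<integral>\<xi>. bias_term (state t \<xi>) \<partial>M)"
proof -
  let ?k = "3 * \<gamma> * real CARD('n) / (4 * L * q)" and ?c = "3 * \<gamma> / (4 * L)" and ?r = "q / real CARD('n)"
  define G where "G = (\<integral>\<xi>. mean (gradient_error (fst (state t \<xi>))) \<partial>M)"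
  define H where "H = (\<integral>\<xi>. mean (memory_error (snd (state t \<xi>))) \<partial>M)"
  let ?F = "\<lambda>s i. (norm (fst (step i {} s) - y\<^sub>s))\<^sup>2"
  have fst_step: "fst (step i K s) = fst (step i {} s)" for i K s
    by (cases s) (simp add: vrtos_step_def Let_def)
  have "(\<integral>\<xi>. (norm (fst (state (Suc t) \<xi>) - y\<^sub>s))\<^sup>2 \<partial>M) = (\<integral>\<xi>. ?F (state t \<xi>) (I t \<xi>) \<partial>M)"
    unfolding state_Suc by (rule Bochner_Integration.integral_cong[OF refl]) (simp only: fst_step[of "I t _" "J t _"])
  also have "\<dots> = (\<integral>\<xi>. mean (?F (state t \<xi>)) \<partial>M)" by (rule expectation_state_index)
  finally have 1: "(\<integral>\<xi>. (norm (fst (state (Suc t) \<xi>) - y\<^sub>s))\<^sup>2 \<partial>M) = (\<integral>\<xi>. mean (?F (state t \<xi>)) \<partial>M)" .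
  have "memory_error (snd (state (Suc t) \<xi>))
      = (\<lambda>j. if j \<in> J t \<xi> then gradient_error (fst (state t \<xi>)) j else memory_error (snd (state t \<xi>)) j)" for \<xi>
    using memory_error_step[of "I t \<xi>" "J t \<xi>" "fst (state t \<xi>)" "snd (state t \<xi>)"]
    by (simp add: fun_eq_iff state_Suc)
  then have "(\<integral>\<xi>. mean (memory_error (snd (state (Suc t) \<xi>))) \<partial>M) = (1 - ?r) * H + ?r * G"
    using expectation_memory_update[of t "\<lambda>s. gradient_error (fst s)" "\<lambda>s. memory_error (snd s)"]
    by (simp add: G_def H_def)
  moreover have "?k * ((1 - ?r) * H + ?r * G) = ?k * H + ?c * (G - H)"
    using q_pos L_constants(3) by (simp add: field_simps)
  ultimately have lyap: "lyapunov (Suc t) = (\<integral>\<xi>. mean (?F (state t \<xi>)) \<partial>M) + (?k * H + ?c * (G - H))"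
    by (simp add: lyapunov_def 1)
  let ?lhs = "\<lambda>s. mean (?F s) + ?c * (mean (gradient_error (fst s)) - mean (memory_error (snd s)))
      + 1 / 10 * (residual (fst s) \<bullet> W (residual (fst s)))"
  let ?rhs = "\<lambda>s. (norm (fst s - y\<^sub>s))\<^sup>2 + bias_term s"
  have "(\<integral>\<xi>. ?lhs (state t \<xi>) \<partial>M) \<le> (\<integral>\<xi>. ?rhs (state t \<xi>) \<partial>M)"
  proof (rule integral_mono[OF integrable_state[of ?lhs] integrable_state[of ?rhs]])
    fix \<xi>
    show "?lhs (state t \<xi>) \<le> ?rhs (state t \<xi>)"
      using mean_step[of "\<lambda>_. {}" "fst (state t \<xi>)" "snd (state t \<xi>)"] by (simp add: bias_term_def)
  qed
  also have "(\<integral>\<xi>. ?rhs (state t \<xi>) \<partial>M)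
      = (\<integral>\<xi>. (norm (fst (state t \<xi>) - y\<^sub>s))\<^sup>2 \<partial>M) + (\<integral>\<xi>. bias_term (state t \<xi>) \<partial>M)"
    by (rule Bochner_Integration.integral_add[OF integrable_state[of "\<lambda>s. (norm (fst s - y\<^sub>s))\<^sup>2"] integrable_state])
  also have "(\<integral>\<xi>. ?lhs (state t \<xi>) \<partial>M)
      = (\<integral>\<xi>. mean (?F (state t \<xi>)) \<partial>M) + ?c * (G - H) + 1 / 10 * residual_energy t"
    unfolding G_def H_def residual_energy_def
    using integrable_state[of "\<lambda>s. mean (?F s)" t] integrable_state[of "\<lambda>s. mean (gradient_error (fst s))" t]
      integrable_state[of "\<lambda>s. mean (memory_error (snd s))" t]
      integrable_state[of "\<lambda>s. residual (fst s) \<bullet> W (residual (fst s))" t]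
    by simp
  finally show ?thesis
    unfolding lyap by (simp add: lyapunov_def H_def)
qed

lemma lyapunov_nonneg: "0 \<le> lyapunov t"
  unfolding lyapunov_def using gamma(1) L_constants(3) q_pos
  by (intro add_nonneg_nonneg mult_nonneg_nonneg Bochner_Integration.integral_nonneg mean_nonneg)
    (auto simp: memory_error_def)

lemma residual_energy_nonneg: "0 \<le> residual_energy t"
  unfolding residual_energy_def
proof (rule Bochner_Integration.integral_nonneg)
  fix \<xi>
  show "0 \<le> residual (fst (state t \<xi>)) \<bullet> W (residual (fst (state t \<xi>)))"
    by (rule order_trans[OF _ coercive]) (use L_constants(5) in simp)
qed

lemma bias_energy_step: "bias_energy (Suc t) = (1 - q / real CARD('n)) * bias_energy t"
proof -
  have "bias_error (snd (state (Suc t) \<xi>)) = (\<lambda>j. if j \<in> J t \<xi> then 0 else bias_error (snd (state t \<xi>)) j)" for \<xi>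
    using bias_error_step[of "I t \<xi>" "J t \<xi>" "fst (state t \<xi>)" "snd (state t \<xi>)"]
    by (simp add: fun_eq_iff state_Suc)
  then show ?thesis
    using expectation_memory_update[of t "\<lambda>_ _. 0" "\<lambda>s. bias_error (snd s)"]
    by (simp add: bias_energy_def mean_const)
qed

lemma bias_energy_nonneg: "0 \<le> bias_energy t"
  unfolding bias_energy_def
  by (intro Bochner_Integration.integral_nonneg mean_nonneg) (simp add: bias_error_def)

lemma bias_energy_geometric:
  assumes "1 - q / real CARD('n) \<le> r" "0 \<le> r"
  shows "bias_energy t \<le> r ^ t * bias_energy 0"
proof (induction t)
  case (Suc t)
  have "bias_energy (Suc t) \<le> r * bias_energy t"
    unfolding bias_energy_step using assms bias_energy_nonneg by (intro mult_right_mono) auto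
  also have "\<dots> \<le> r * (r ^ t * bias_energy 0)" using Suc assms by (intro mult_left_mono) auto
  finally show ?case by (simp add: mult.assoc)
qed simp

lemma bias_term_zero:
  assumes "sparse_memory \<B> \<psi> \<alpha>\<^sub>0"
  shows "bias_term (state t \<xi>) = 0"
proof -
  have "bias_error (snd (state t \<xi>)) j = 0" for j
  proof (induction t)
    case 0
    show ?case using assms by (simp add: state_0 bias_error_def sparse_memory_def)
  next
    case (Suc t)
    then show ?case
      using bias_error_step[of "I t \<xi>" "J t \<xi>" "fst (state t \<xi>)" "snd (state t \<xi>)" j]
      by (simp add: state_Suc)
  qed
  then have "bias_error (snd (state t \<xi>)) = (\<lambda>_. 0)" by (rule ext)
  then have "(norm (bias (snd (state t \<xi>))))\<^sup>2 \<le> 0"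
    using norm_bias_le[of "snd (state t \<xi>)"] by (simp add: mean_const)
  then show ?thesis by (simp add: bias_term_def)
qed

lemma residual_energy_sum_sparse:
  assumes "sparse_memory \<B> \<psi> \<alpha>\<^sub>0"
  shows "(\<Sum>k<t. residual_energy k) \<le> 10 * lyapunov 0"
proof -
  have "lyapunov t + (\<Sum>k<t. residual_energy k / 10) \<le> lyapunov 0 * exp (\<Sum>k<t. 0)"
    using lyapunov_step bias_term_zero[OF assms] residual_energy_nonneg lyapunov_nonneg
    by (intro discrete_gronwall) auto
  then show ?thesis
    using lyapunov_nonneg[of t] by (simp add: sum_divide_distrib[symmetric])
qed

text \<open>The bias enters linearly, multiplied by the distance to the fixed point.  Its square decays like
\<open>r\<^bsup>2t\<^esup>\<close>, so Young's inequality with weight \<open>r\<^sup>t\<close> leaves terms of order \<open>r\<^sup>t\<close> only.\<close>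

lemma residual_energy_sum_bounded: "\<exists>C. \<forall>t. (\<Sum>k<t. residual_energy k) \<le> C"
proof -
  \<comment> \<open>the maximum keeps \<open>r\<close> positive when \<open>q = n\<close>, as \<open>r ^ t\<close> is divided by\<close>
  define r where "r = sqrt (max (1 / 2) (1 - q / real CARD('n)))"
  have "0 < q / real CARD('n)" using q_pos by simp
  then have r: "0 < r" "r < 1" and r2: "1 - q / real CARD('n) \<le> r\<^sup>2"
    by (auto simp: r_def real_sqrt_less_iff[of _ 1, simplified])
  define K where "K = \<gamma> * d\<^sub>m * (1 + bias_energy 0) + 30 * \<gamma>\<^sup>2 * d\<^sub>m * bias_energy 0"
  have pos: "0 < \<gamma>" "0 < d\<^sub>m" "0 \<le> bias_energy 0" using gamma L_constants bias_energy_nonneg by auto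
  have K: "0 \<le> K" using pos by (simp add: K_def)
  have noise: "(\<integral>\<xi>. bias_term (state t \<xi>) \<partial>M) \<le> K * r ^ t * (lyapunov t + 1)" for t
  proof -
    let ?a = "\<lambda>s. (norm (fst s - y\<^sub>s))\<^sup>2" and ?b = "\<lambda>s. mean (bias_error (snd s))"
    have rt: "0 < r ^ t" "r ^ t \<le> 1" using r by (auto simp: power_le_one)
    have bt: "bias_term s \<le> \<gamma> * d\<^sub>m * (r ^ t * ?a s + ?b s / r ^ t) + 30 * \<gamma>\<^sup>2 * d\<^sub>m * ?b s" for s
    proof -
      define a b where "a = norm (fst s - y\<^sub>s)" and "b = norm (bias (snd s))"
      have b: "b\<^sup>2 \<le> ?b s" unfolding b_def by (rule norm_bias_le)
      have "2 * (r ^ t * a) * b \<le> (r ^ t * a)\<^sup>2 + b\<^sup>2" by (rule sum_squares_bound)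
      then have "(2 * (r ^ t * a) * b) / r ^ t \<le> ((r ^ t * a)\<^sup>2 + b\<^sup>2) / r ^ t"
        using rt by (intro divide_right_mono) auto
      then have "2 * a * b \<le> r ^ t * a\<^sup>2 + b\<^sup>2 / r ^ t"
        using r(1) by (simp add: add_divide_distrib power2_eq_square mult_ac)
      also have "\<dots> \<le> r ^ t * a\<^sup>2 + ?b s / r ^ t"
        using b rt by (intro add_left_mono divide_right_mono) auto
      finally have "\<gamma> * d\<^sub>m * (2 * a * b) \<le> \<gamma> * d\<^sub>m * (r ^ t * a\<^sup>2 + ?b s / r ^ t)"
        using pos by (intro mult_left_mono) auto
      moreover have "30 * \<gamma>\<^sup>2 * d\<^sub>m * b\<^sup>2 \<le> 30 * \<gamma>\<^sup>2 * d\<^sub>m * ?b s"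
        using b pos by (intro mult_left_mono) auto
      ultimately show ?thesis by (simp add: bias_term_def a_def b_def mult_ac)
    qed
    define A where "A = (\<integral>\<xi>. ?a (state t \<xi>) \<partial>M)"
    have A: "A \<le> lyapunov t"
      unfolding A_def lyapunov_def using gamma(1) L_constants(3) q_pos
      by (intro add_increasing2 order_refl mult_nonneg_nonneg Bochner_Integration.integral_nonneg mean_nonneg)
        (auto simp: memory_error_def)
    have B: "bias_energy t \<le> r ^ t * r ^ t * bias_energy 0"
      using bias_energy_geometric[OF r2, of t] by (simp add: power2_eq_square power_mult_distrib)
    have "(\<integral>\<xi>. bias_term (state t \<xi>) \<partial>M)
        \<le> (\<integral>\<xi>. \<gamma> * d\<^sub>m * (r ^ t * ?a (state t \<xi>) + ?b (state t \<xi>) / r ^ t) + 30 * \<gamma>\<^sup>2 * d\<^sub>m * ?b (state t \<xi>) \<partial>M)"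
      by (rule integral_mono[OF integrable_state
            integrable_state[of "\<lambda>s. \<gamma> * d\<^sub>m * (r ^ t * ?a s + ?b s / r ^ t) + 30 * \<gamma>\<^sup>2 * d\<^sub>m * ?b s"] bt])
    also have "\<dots> = \<gamma> * d\<^sub>m * (r ^ t * A + bias_energy t / r ^ t) + 30 * \<gamma>\<^sup>2 * d\<^sub>m * bias_energy t"
      using integrable_state[of ?a t] integrable_state[of ?b t] by (simp add: A_def bias_energy_def)
    also have "\<dots> \<le> \<gamma> * d\<^sub>m * (r ^ t * lyapunov t + r ^ t * bias_energy 0)
        + 30 * \<gamma>\<^sup>2 * d\<^sub>m * (r ^ t * bias_energy 0)"
    proof (intro add_mono mult_left_mono)
      show "A \<le> lyapunov t" by (rule A)
      show "bias_energy t / r ^ t \<le> r ^ t * bias_energy 0"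
        using B rt by (simp add: divide_le_eq mult_ac)
      have "r ^ t * r ^ t * bias_energy 0 \<le> r ^ t * 1 * bias_energy 0"
        using rt pos by (intro mult_right_mono mult_left_mono) auto
      with B show "bias_energy t \<le> r ^ t * bias_energy 0" by simp
    qed (use pos rt in auto)
    also have "\<dots> = (\<gamma> * d\<^sub>m) * r ^ t * lyapunov t + (K - \<gamma> * d\<^sub>m) * r ^ t"
      by (simp add: K_def algebra_simps)
    also have "\<dots> \<le> K * r ^ t * lyapunov t + K * r ^ t"
    proof (intro add_mono mult_right_mono)
      show "\<gamma> * d\<^sub>m \<le> K" using pos by (simp add: K_def algebra_simps)
      show "K - \<gamma> * d\<^sub>m \<le> K" using pos by simp
    qed (use rt lyapunov_nonneg in auto)
    finally show ?thesis by (simp add: algebra_simps)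
  qed
  have "(\<Sum>k<t. residual_energy k) \<le> 10 * ((lyapunov 0 + 1) * exp (K * (1 / (1 - r))))" for t
  proof -
    have "(lyapunov t + 1) + (\<Sum>k<t. residual_energy k / 10) \<le> (lyapunov 0 + 1) * exp (\<Sum>k<t. K * r ^ k)"
    proof (rule discrete_gronwall[of "\<lambda>t. lyapunov t + 1"])
      fix t
      show "lyapunov (Suc t) + 1 + residual_energy t / 10 \<le> (1 + K * r ^ t) * (lyapunov t + 1)"
        using lyapunov_step[of t] noise[of t] by (simp add: algebra_simps)
    qed (use residual_energy_nonneg lyapunov_nonneg K r in auto)
    also have "\<dots> \<le> (lyapunov 0 + 1) * exp (K * (1 / (1 - r)))"
    proof (intro mult_left_mono)
      have "(\<Sum>k<t. r ^ k) \<le> (\<Sum>k. r ^ k)"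
        using r by (intro sum_le_suminf summable_geometric) auto
      then have "(\<Sum>k<t. r ^ k) \<le> 1 / (1 - r)" using r by (simp add: suminf_geometric)
      then show "exp (\<Sum>k<t. K * r ^ k) \<le> exp (K * (1 / (1 - r)))"
        using K by (simp only: exp_le_cancel_iff sum_distrib_left[symmetric] mult_left_mono)
    qed (use lyapunov_nonneg[of 0] in simp)
    finally show ?thesis
      using lyapunov_nonneg[of t] by (simp add: sum_divide_distrib[symmetric])
  qed
  then show ?thesis by blast
qed

text \<open>The square of the smallest expected norm is at most the average of the squared expected norms, which
Jensen's inequality and \<open>\<parallel>u\<parallel>\<^sup>2 \<le> d\<^sub>m \<langle>u, W u\<rangle>\<close> compare with the residual energies.\<close>

lemma min_residual_le:
  assumes "(\<Sum>k<Suc t. residual_energy k) \<le> C"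
  shows "(MIN k\<in>{0..t}. (\<integral>\<xi>. norm (residual (fst (state k \<xi>))) \<partial>M)) \<le> sqrt (d\<^sub>m * C / (real t + 1))"
proof -
  define E where "E k = (\<integral>\<xi>. norm (residual (fst (state k \<xi>))) \<partial>M)" for k
  define m where "m = (MIN k\<in>{0..t}. E k)"
  have E0: "0 \<le> E k" for k unfolding E_def by (rule Bochner_Integration.integral_nonneg) simp
  have m0: "0 \<le> m" unfolding m_def using E0 by (subst Min_ge_iff) auto
  have E: "(E k)\<^sup>2 \<le> d\<^sub>m * residual_energy k" for k
  proof -
    have "(E k)\<^sup>2 \<le> (\<integral>\<xi>. (norm (residual (fst (state k \<xi>))))\<^sup>2 \<partial>M)"
      unfolding E_def
      by (rule expectation_square_le)
        (rule integrable_state[of "\<lambda>s. norm (residual (fst s))"],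
         rule integrable_state[of "\<lambda>s. (norm (residual (fst s)))\<^sup>2"])
    also have "\<dots> \<le> (\<integral>\<xi>. d\<^sub>m * (residual (fst (state k \<xi>)) \<bullet> W (residual (fst (state k \<xi>)))) \<partial>M)"
      by (rule integral_mono[OF integrable_state[of "\<lambda>s. (norm (residual (fst s)))\<^sup>2"]
            integrable_state[of "\<lambda>s. d\<^sub>m * (residual (fst s) \<bullet> W (residual (fst s)))"] norm_sq_le_W])
    finally show ?thesis by (simp add: residual_energy_def)
  qed
  have "(real t + 1) * m\<^sup>2 = (\<Sum>k<Suc t. m\<^sup>2)" by simp
  also have "\<dots> \<le> (\<Sum>k<Suc t. d\<^sub>m * residual_energy k)"
  proof (rule sum_mono)
    fix k assume "k \<in> {..<Suc t}"
    then have "m \<le> E k" unfolding m_def by (intro Min_le) auto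
    then have "m\<^sup>2 \<le> (E k)\<^sup>2" using m0 by (rule power_mono)
    with E[of k] show "m\<^sup>2 \<le> d\<^sub>m * residual_energy k" by simp
  qed
  also have "\<dots> \<le> d\<^sub>m * C"
    unfolding sum_distrib_left[symmetric] using assms L_constants(5) by (intro mult_left_mono) auto
  finally have "m\<^sup>2 \<le> d\<^sub>m * C / (real t + 1)" by (simp add: le_divide_eq mult.commute)
  then show ?thesis unfolding m_def E_def by (rule real_le_rsqrt)
qed

end

section \<open>The convergence theorem\<close>

theorem theorem2:
  fixes \<psi> :: "'n::finite \<Rightarrow> real ^ 'p::finite \<Rightarrow> real"
    and \<omega> :: "real ^ 'p \<Rightarrow> real"
    and g h :: "real ^ 'p \<Rightarrow> ereal"
    and L\<^sub>\<psi> L\<^sub>\<omega> \<gamma> q :: real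
    and \<B> :: "'p set set"
    and x_star y\<^sub>0 :: "real ^ 'p"
    and \<alpha>\<^sub>0 :: "real ^ 'p ^ 'n"
    and M :: "'s measure"
    and I :: "nat \<Rightarrow> 's \<Rightarrow> 'n"
    and J :: "nat \<Rightarrow> 's \<Rightarrow> 'n set"
    and y :: "nat \<Rightarrow> 's \<Rightarrow> real ^ 'p"
    and G :: "real ^ 'p \<Rightarrow> real ^ 'p"
    and res :: "nat \<Rightarrow> real"
  assumes psi: "\<And>i. convex_on UNIV (\<psi> i)" "\<And>i. smooth_fun L\<^sub>\<psi> (\<psi> i)"
    and omega: "convex_on UNIV \<omega>" "smooth_fun L\<^sub>\<omega> \<omega>"
    and g: "proper_fun g" "lsc_fun g" "convex_fun g"
    and h: "proper_fun h" "lsc_fun h" "convex_fun h"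
    and domains: "rel_interior (effective_domain g) \<inter> rel_interior (effective_domain h) \<noteq> {}"
    and minimizer: "is_arg_min (objective \<psi> \<omega> g h) (\<lambda>_. True) x_star"
    and blocks: "partition_on UNIV \<B>"
    and separable: "block_separable \<B> g" "block_separable \<B> \<omega>"
    and covered: "\<And>B. B \<in> \<B> \<Longrightarrow> \<exists>i. B \<in> ext_support \<B> (\<psi> i)"
    and prob: "prob_space M"
    and sampling: "uniform_sampling M I J"
    and q: "0 < q" "uniform_memorization M I J q"
    and gamma: "0 < \<gamma>" "\<gamma> \<le> 1 / (3 * L_f \<B> \<psi> L\<^sub>\<psi> L\<^sub>\<omega>)"
    and y: "\<And>t \<xi>. y t \<xi> = fst (vrtos \<B> \<psi> \<omega> g h \<gamma> y\<^sub>0 \<alpha>\<^sub>0 (\<lambda>s. I s \<xi>) (\<lambda>s. J s \<xi>) t)"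
    and G: "\<And>u. G u = tos_operator \<B> \<psi> \<omega> g h \<gamma> u"
    and res: "\<And>t. res t = (MIN k\<in>{0..t}. (\<integral>\<xi>. norm (y k \<xi> - G (y k \<xi>)) \<partial>M))"
  shows "res \<longlonglongrightarrow> 0 \<and>
    (\<gamma> = 1 / (3 * L_f \<B> \<psi> L\<^sub>\<psi> L\<^sub>\<omega>) \<longrightarrow>
      (sparse_memory \<B> \<psi> \<alpha>\<^sub>0 \<longrightarrow>
        (\<forall>y_star. G y_star = y_star \<longrightarrow> (\<forall>t\<ge>1.
           res t \<le> sqrt (C_0 \<B> \<psi> L\<^sub>\<psi> L\<^sub>\<omega> q y\<^sub>0 \<alpha>\<^sub>0 x_star y_star
                         / (L_f \<B> \<psi> L\<^sub>\<psi> L\<^sub>\<omega> * q * (real t + 1)))))) \<and>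
      res \<in> O(\<lambda>t. 1 / sqrt (real t)))"
proof -
  interpret problem: vrtos_problem \<B> \<psi> \<omega> g h L\<^sub>\<psi> L\<^sub>\<omega> \<gamma>
    by unfold_locales (fact blocks covered psi omega g h separable gamma)+
  have random: "vrtos_random \<B> \<psi> \<omega> g h L\<^sub>\<psi> L\<^sub>\<omega> \<gamma> y_star M I J q" if "G y_star = y_star" for y_star
  proof -
    interpret prob_space M by (rule prob)
    show ?thesis
      by unfold_locales (use that G sampling q in auto)
  qed
  have bound: "res t \<le> sqrt (d_max \<B> \<psi> * C / (real t + 1))"
    if fp: "G y_star = y_star"
      and C: "(\<Sum>k<Suc t. vrtos_random.residual_energy \<B> \<psi> \<omega> g h \<gamma> M I J y\<^sub>0 \<alpha>\<^sub>0 k) \<le> C" for y_star t C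
  proof -
    interpret run: vrtos_random \<B> \<psi> \<omega> g h L\<^sub>\<psi> L\<^sub>\<omega> \<gamma> y_star M I J q y\<^sub>0 \<alpha>\<^sub>0
      by (rule random[OF fp])
    have "norm (y k \<xi> - G (y k \<xi>)) = norm (problem.residual (fst (run.state k \<xi>)))" for k \<xi>
      by (simp add: y G problem.tos_operator_eq run.state_def)
    then show ?thesis using run.min_residual_le[OF C] by (simp add: res)
  qed
  have res_nonneg: "0 \<le> res t" for t
    unfolding res by (subst Min_ge_iff) (auto intro!: Bochner_Integration.integral_nonneg)
  obtain y_fix where fixp: "G y_fix = y_fix"
    using problem.fixed_point_exists[OF minimizer domains] G by auto
  obtain C where C: "\<And>t. (\<Sum>k<t. vrtos_random.residual_energy \<B> \<psi> \<omega> g h \<gamma> M I J y\<^sub>0 \<alpha>\<^sub>0 k) \<le> C"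
    using vrtos_random.residual_energy_sum_bounded[OF random[OF fixp]] by blast
  define K where "K = d_max \<B> \<psi> * C"
  have K: "0 \<le> K" using C[of 0] problem.L_constants(5) by (simp add: K_def)
  have res_le: "res t \<le> sqrt (K / (real t + 1))" for t
    unfolding K_def by (rule bound[OF fixp C])
  have "res \<longlonglongrightarrow> 0"
  proof (rule real_tendsto_sandwich[OF _ _ tendsto_const])
    have "(\<lambda>t. K / real (Suc t)) \<longlonglongrightarrow> 0" by (rule LIMSEQ_Suc[OF lim_const_over_n])
    then have "(\<lambda>t. sqrt (K / real (Suc t))) \<longlonglongrightarrow> sqrt 0" by (rule tendsto_real_sqrt)
    then show "(\<lambda>t. sqrt (K / (real t + 1))) \<longlonglongrightarrow> 0" by (simp add: add.commute)
  qed (use res_nonneg res_le in auto)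
  moreover have "res \<in> O(\<lambda>t. 1 / sqrt (real t))"
  proof (rule bigoI[where c = "sqrt K"])
    show "\<forall>\<^sub>F t in sequentially. norm (res t) \<le> sqrt K * norm (1 / sqrt (real t))"
      using eventually_gt_at_top[of 0]
    proof eventually_elim
      case (elim t)
      have "res t \<le> sqrt (K / (real t + 1))" by (rule res_le)
      also have "\<dots> \<le> sqrt (K / real t)"
        using K elim by (intro real_sqrt_le_mono divide_left_mono) auto
      finally show ?case using res_nonneg[of t] by (simp add: real_sqrt_divide)
    qed
  qed
  moreover have "res t \<le> sqrt (C_0 \<B> \<psi> L\<^sub>\<psi> L\<^sub>\<omega> q y\<^sub>0 \<alpha>\<^sub>0 x_star y_star
      / (L_f \<B> \<psi> L\<^sub>\<psi> L\<^sub>\<omega> * q * (real t + 1)))"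
    if step_size: "\<gamma> = 1 / (3 * L_f \<B> \<psi> L\<^sub>\<psi> L\<^sub>\<omega>)" and sparse: "sparse_memory \<B> \<psi> \<alpha>\<^sub>0" and fp: "G y_star = y_star"
    for y_star t
  proof -
    interpret run: vrtos_random \<B> \<psi> \<omega> g h L\<^sub>\<psi> L\<^sub>\<omega> \<gamma> y_star M I J q y\<^sub>0 \<alpha>\<^sub>0
      by (rule random[OF fp])
    define n where "n = real CARD('n)"
    define S where "S = (\<Sum>i\<in>UNIV. (norm (\<alpha>\<^sub>0 $ i - gradient (\<psi> i) x_star))\<^sup>2)"
    let ?L = "L_f \<B> \<psi> L\<^sub>\<psi> L\<^sub>\<omega>"
    have pos: "0 < n" "0 < ?L" using problem.L_constants(3) by (auto simp: n_def)
    have "run.memory_error \<alpha>\<^sub>0 = (\<lambda>i. (norm (\<alpha>\<^sub>0 $ i - gradient (\<psi> i) x_star))\<^sup>2)"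
      using sparse run.gradient_at_minimizer[OF minimizer domains]
      by (simp add: fun_eq_iff run.memory_error_def sparse_memory_def)
    then have "run.lyapunov 0 = (norm (y\<^sub>0 - y_star))\<^sup>2 + 3 * \<gamma> * n / (4 * ?L * q) * (S / n)"
      by (simp add: run.lyapunov_def run.state_0 run.prob_space mean_def S_def n_def)
    also have "3 * \<gamma> * n / (4 * ?L * q) * (S / n) = S / (4 * ?L\<^sup>2 * q)"
      using pos unfolding step_size by (simp add: power2_eq_square)
    finally have lyapunov_0: "run.lyapunov 0 = (norm (y\<^sub>0 - y_star))\<^sup>2 + S / (4 * ?L\<^sup>2 * q)" .
    have "d_max \<B> \<psi> * (10 * run.lyapunov 0)
        = C_0 \<B> \<psi> L\<^sub>\<psi> L\<^sub>\<omega> q y\<^sub>0 \<alpha>\<^sub>0 x_star y_star / (?L * q)"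
      using pos q(1) unfolding lyapunov_0 C_0_def H_0_def S_def[symmetric] n_def[symmetric]
      by (simp add: field_simps power2_eq_square)
    then have rate: "d_max \<B> \<psi> * (10 * run.lyapunov 0) / (real t + 1)
        = C_0 \<B> \<psi> L\<^sub>\<psi> L\<^sub>\<omega> q y\<^sub>0 \<alpha>\<^sub>0 x_star y_star / (?L * q * (real t + 1))"
      by simp
    have "res t \<le> sqrt (d_max \<B> \<psi> * (10 * run.lyapunov 0) / (real t + 1))"
      by (rule bound[OF fp run.residual_energy_sum_sparse[OF sparse]])
    then show ?thesis unfolding rate .
  qed
  ultimately show ?thesis by blast
qed

end
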